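(* Let $K$ be a field of characteristic $0$, $G$ a finite commutative group scheme over $K$, and $L\subseteq K^c$ a finite Galois extension of $K$. Then for every $x\in H^1(L,G)$, $$\Upsilon_K(\mathrm{Cores}_{L/K}(x))=\mathcal{N}_{L/K}(\Upsilon_L(x)),$$ where $\mathrm{Cores}_{L/K}:H^1(L,G)\to H^1(K,G)$ is corestriction.
   Context: Let $\Gamma=G(K^c)$ with its $\Omega_K=\mathrm{Gal}(K^c/K)$-action. $K^c[\Gamma]$ is the group algebra, with $\Omega_K$ acting by $(\sum c_gg)^\omega=\sum c_g^\omega g^\omega$; $A=K^c[\Gamma]^{\Omega_K}$ (the Hopf algebra of the Cartier dual of $G$), so $A\otimes_KK^c=K^c[\Gamma]$. For $M\in\{K,L\}$ put $A_M=A\otimes_KM$, $\mathbf{H}(A_M)=\{\alpha\in K^c[\Gamma]^\times:\alpha^\omega\alpha^{-1}\in\Gamma\ \forall\omega\in\Omega_M\}$, $H(A_M)=\mathbf{H}(A_M)/(\Gamma\cdot A_M^\times)$. There is an isomorphism $\Upsilon_M:H^1(M,G)\to H(A_M)$ characterised by: $\Upsilon_M(x)$ is the class of any $\alpha\in\mathbf{H}(A_M)$ such that the cocycle $\omega\mapsto\alpha^\omega\alpha^{-1}$ ($\omega\in\Omega_M$) represents $x$. Let $\omega_1,\dots,\omega_n$ ($n=[L:K]$) be a transversal of $\Omega_L$ in $\Omega_K$, and $\mathcal{N}_{L/K}:K^c[\Gamma]\to K^c[\Gamma]$, $a\mapsto\prod_{i=1}^na^{\omega_i}$. This induces homomorphisms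 $\mathbf{H}(A_L)\to\mathbf{H}(A_K)$ and $\mathcal{N}_{L/K}:H(A_L)\to H(A_K)$. *)

theory Defs
  imports
    "HOL-Algebra.Algebra"
    "HOL-Algebra.Algebraic_Closure_Type"
    "HOL-Analysis.Function_Topology"
begin

section \<open>Fields\<close>

text \<open>
  The base field \<open>K\<close> is a type \<open>'k\<close>, its algebraic closure \<open>K\<^sup>c\<close> is the library type
  \<open>'k alg_closure\<close>, and \<open>K\<close> sits in \<open>K\<^sup>c\<close> via \<open>to_ac\<close>.
\<close>

abbreviation Kc :: "'k::field alg_closure ring" where
  "Kc \<equiv> ring_of_type_algebra"

abbreviation base_field :: "'k::field alg_closure set" where
  "base_field \<equiv> range to_ac"

text \<open>
  Separability is not listed in the next definition: it is only used over fields of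
  characteristic \<open>0\<close>, where it is automatic. All roots of \<open>p\<close> lie in \<open>K\<^sup>c\<close>, so the last clause
  says that an irreducible polynomial over \<open>K\<close> with a root in \<open>L\<close> splits over \<open>L\<close>.
\<close>

definition finite_galois_extension :: "'k::field_char_0 alg_closure set \<Rightarrow> bool" where
  "finite_galois_extension L \<longleftrightarrow>
     subfield L Kc \<and> base_field \<subseteq> L \<and> ring.finite_dimension Kc base_field L \<and>
     (\<forall>p :: 'k poly. Factorial_Ring.irreducible p \<longrightarrow>
        (\<exists>x\<in>L. poly (map_poly to_ac p) x = 0) \<longrightarrow>
        (\<forall>x. poly (map_poly to_ac p) x = 0 \<longrightarrow> x \<in> L))"

definition extension_degree :: "'k::field alg_closure set \<Rightarrow> nat" where
  "extension_degree L = ring.dim Kc base_field L"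

text \<open>
  \<open>Gal M\<close> is the absolute Galois group of \<open>M\<close>, for \<open>K \<subseteq> M \<subseteq> K\<^sup>c\<close>. It acts on the left, i.e.
  \<open>c\<close> to the power \<open>\<omega>\<close> is \<open>\<omega> c\<close> and the group law is \<open>\<circ>\<close>.
\<close>

definition Gal :: "'k::field alg_closure set \<Rightarrow> ('k alg_closure \<Rightarrow> 'k alg_closure) set" where
  "Gal M = {\<omega> \<in> ring_iso Kc Kc. \<forall>x\<in>M. \<omega> x = x}"

text \<open>
  The Krull topology: the topology of pointwise convergence on the discrete set \<open>K\<^sup>c\<close>, so that
  the stabilisers of finite subsets of \<open>K\<^sup>c\<close> are the basic neighbourhoods of the identity.
\<close>

definition krull_topology ::
    "'k::field alg_closure set \<Rightarrow> ('k alg_closure \<Rightarrow> 'k alg_closure) topology" where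
  "krull_topology M =
     subtopology (product_topology (\<lambda>_. discrete_topology UNIV) UNIV) (Gal M)"

text \<open>
  \<open>\<omega> 1, \<dots>, \<omega> n\<close>, where \<open>n = [L:K]\<close>, represent each left coset of \<open>Gal L\<close> in \<open>Gal K\<close> exactly
  once. For \<open>L\<close> normal over \<open>K\<close> left and right cosets coincide.
\<close>

definition transversal ::
    "'k::field alg_closure set \<Rightarrow> (nat \<Rightarrow> 'k alg_closure \<Rightarrow> 'k alg_closure) \<Rightarrow> bool" where
  "transversal L \<omega> \<longleftrightarrow>
     (\<forall>i\<in>{1..extension_degree L}. \<omega> i \<in> Gal base_field) \<and>
     (\<forall>\<sigma>\<in>Gal base_field.
        \<exists>!i. i \<in> {1..extension_degree L} \<and> (\<exists>\<tau>\<in>Gal L. \<sigma> = \<omega> i \<circ> \<tau>))"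


section \<open>Finite commutative group schemes\<close>

text \<open>
  A finite group scheme \<open>G\<close> over \<open>K\<close> is \<open>Spec B\<close> for a finite-dimensional commutative Hopf algebra
  \<open>B\<close>. Having chosen a basis \<open>(e\<^sub>i)\<close> of \<open>B\<close>, indexed by a finite type \<open>'i\<close>, the structure maps
  are given by their coordinates:

    \<^item> \<open>e\<^sub>i e\<^sub>j = \<Sum>\<^sub>k mul i j k e\<^sub>k\<close> and \<open>1 = \<Sum>\<^sub>i unit i e\<^sub>i\<close>;
    \<^item> comultiplication \<open>\<Delta> e\<^sub>i = \<Sum>\<^sub>j\<^sub>,\<^sub>k comul i j k e\<^sub>j \<otimes> e\<^sub>k\<close> and counit \<open>e\<^sub>i \<mapsto> counit i\<close>;
    \<^item> antipode \<open>e\<^sub>i \<mapsto> \<Sum>\<^sub>j antipode i j e\<^sub>j\<close>.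
\<close>

record ('k, 'i) hopf_data =
  mul :: "'i \<Rightarrow> 'i \<Rightarrow> 'i \<Rightarrow> 'k"
  unit :: "'i \<Rightarrow> 'k"
  comul :: "'i \<Rightarrow> 'i \<Rightarrow> 'i \<Rightarrow> 'k"
  counit :: "'i \<Rightarrow> 'k"
  antipode :: "'i \<Rightarrow> 'i \<Rightarrow> 'k"

locale finite_comm_group_scheme =
  fixes G :: "('k::field, 'i::finite) hopf_data"
  assumes mul_assoc:
      "(\<Sum>l\<in>UNIV. mul G i j l * mul G l k p) = (\<Sum>l\<in>UNIV. mul G j k l * mul G i l p)"
    and mul_comm: "mul G i j k = mul G j i k"
    and mul_unit: "(\<Sum>i\<in>UNIV. unit G i * mul G i j k) = (if j = k then 1 else 0)"
    and comul_coassoc: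
      "(\<Sum>l\<in>UNIV. comul G i l r * comul G l p q) = (\<Sum>l\<in>UNIV. comul G i p l * comul G l q r)"
    and comul_cocomm: "comul G i j k = comul G i k j"
    and comul_counit: "(\<Sum>j\<in>UNIV. counit G j * comul G i j k) = (if i = k then 1 else 0)"
    \<comment> \<open>the comultiplication, counit and antipode are homomorphisms of \<open>K\<close>-algebras\<close>
    and comul_mul:
      "(\<Sum>l\<in>UNIV. mul G i j l * comul G l p q) =
       (\<Sum>a\<in>UNIV. \<Sum>b\<in>UNIV. \<Sum>c\<in>UNIV. \<Sum>d\<in>UNIV.
          comul G i a b * comul G j c d * mul G a c p * mul G b d q)"
    and comul_unit: "(\<Sum>i\<in>UNIV. unit G i * comul G i p q) = unit G p * unit G q"
    and counit_mul: "(\<Sum>l\<in>UNIV. mul G i j l * counit G l) = counit G i * counit G j"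
    and counit_unit: "(\<Sum>i\<in>UNIV. unit G i * counit G i) = 1"
    and antipode_mul:
      "(\<Sum>l\<in>UNIV. mul G i j l * antipode G l p) =
       (\<Sum>a\<in>UNIV. \<Sum>b\<in>UNIV. antipode G i a * antipode G j b * mul G a b p)"
    and antipode_unit: "(\<Sum>i\<in>UNIV. unit G i * antipode G i p) = unit G p"
    \<comment> \<open>multiplying after applying the antipode to the left factor of \<open>\<Delta>\<close> is the counit\<close>
    and antipode_inverse:
      "(\<Sum>j\<in>UNIV. \<Sum>k\<in>UNIV. \<Sum>l\<in>UNIV. comul G i j k * antipode G j l * mul G l k p) =
       counit G i * unit G p"

text \<open>
  The group \<open>\<Gamma> = G(K\<^sup>c)\<close> of \<open>K\<close>-algebra homomorphisms \<open>B \<rightarrow> K\<^sup>c\<close>, such a homomorphism being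
  identified with the family \<open>x\<close> of its values on the basis. The Galois group acts by
  composition: \<open>x\<close> to the power \<open>\<omega>\<close> is \<open>\<omega> \<circ> x\<close>.
\<close>

definition points ::
    "('k::field, 'i::finite) hopf_data \<Rightarrow> ('i \<Rightarrow> 'k alg_closure) monoid" where
  "points G =
     \<lparr>carrier = {x. (\<forall>i j. x i * x j = (\<Sum>k\<in>UNIV. to_ac (mul G i j k) * x k)) \<and>
                    (\<Sum>i\<in>UNIV. to_ac (unit G i) * x i) = 1},
      monoid.mult = (\<lambda>x y i. \<Sum>j\<in>UNIV. \<Sum>k\<in>UNIV. to_ac (comul G i j k) * x j * y k),
      one = (\<lambda>i. to_ac (counit G i))\<rparr>"


section \<open>Galois cohomology\<close>

text \<open>
  Since the characteristic is \<open>0\<close>, \<open>G\<close> is etale and \<open>H\<^sup>1(M, G)\<close> is the group of continuous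
  \<open>1\<close>-cocycles of \<open>Gal M\<close> in the discrete module \<open>\<Gamma>\<close> modulo coboundaries.
\<close>

definition Z1 :: "('k::field, 'i::finite) hopf_data \<Rightarrow> 'k alg_closure set \<Rightarrow>
    (('k alg_closure \<Rightarrow> 'k alg_closure) \<Rightarrow> 'i \<Rightarrow> 'k alg_closure) monoid" where
  "Z1 G M =
     \<lparr>carrier = {f \<in> Gal M \<rightarrow>\<^sub>E carrier (points G).
         continuous_map (krull_topology M) (discrete_topology (carrier (points G))) f \<and>
         (\<forall>\<sigma>\<in>Gal M. \<forall>\<tau>\<in>Gal M. f (\<sigma> \<circ> \<tau>) = f \<sigma> \<otimes>\<^bsub>points G\<^esub> (\<sigma> \<circ> f \<tau>))},
      monoid.mult = (\<lambda>f h. \<lambda>\<sigma>\<in>Gal M. f \<sigma> \<otimes>\<^bsub>points G\<^esub> h \<sigma>),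
      one = (\<lambda>\<sigma>\<in>Gal M. \<one>\<^bsub>points G\<^esub>)\<rparr>"

definition B1 :: "('k::field, 'i::finite) hopf_data \<Rightarrow> 'k alg_closure set \<Rightarrow>
    (('k alg_closure \<Rightarrow> 'k alg_closure) \<Rightarrow> 'i \<Rightarrow> 'k alg_closure) set" where
  "B1 G M = (\<lambda>x. \<lambda>\<sigma>\<in>Gal M. (\<sigma> \<circ> x) \<otimes>\<^bsub>points G\<^esub> inv\<^bsub>points G\<^esub> x) ` carrier (points G)"

definition H1 :: "('k::field, 'i::finite) hopf_data \<Rightarrow> 'k alg_closure set \<Rightarrow>
    (('k alg_closure \<Rightarrow> 'k alg_closure) \<Rightarrow> 'i \<Rightarrow> 'k alg_closure) set monoid" where
  "H1 G M = Z1 G M Mod B1 G M"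

definition coset_index :: "'k::field alg_closure set \<Rightarrow>
    (nat \<Rightarrow> 'k alg_closure \<Rightarrow> 'k alg_closure) \<Rightarrow> ('k alg_closure \<Rightarrow> 'k alg_closure) \<Rightarrow> nat" where
  "coset_index L \<omega> \<sigma> =
     (THE i. i \<in> {1..extension_degree L} \<and> (\<exists>\<tau>\<in>Gal L. \<sigma> = \<omega> i \<circ> \<tau>))"

text \<open>
  Corestriction on cochains (the standard transfer formula for inhomogeneous \<open>1\<close>-cochains). For
  \<open>\<sigma> \<in> Gal K\<close> write \<open>\<sigma> \<omega>\<^sub>j = \<omega>\<^sub>i u\<^sub>j\<close> with \<open>u\<^sub>j \<in> Gal L\<close>; then the value at \<open>\<sigma>\<close> of the
  corestriction of \<open>f\<close> is the product over \<open>j\<close> of \<open>\<omega>\<^sub>i\<close> applied to \<open>f u\<^sub>j\<close>.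
\<close>

definition cores_cochain :: "('k::field, 'i::finite) hopf_data \<Rightarrow> 'k alg_closure set \<Rightarrow>
    (nat \<Rightarrow> 'k alg_closure \<Rightarrow> 'k alg_closure) \<Rightarrow>
    (('k alg_closure \<Rightarrow> 'k alg_closure) \<Rightarrow> 'i \<Rightarrow> 'k alg_closure) \<Rightarrow>
    (('k alg_closure \<Rightarrow> 'k alg_closure) \<Rightarrow> 'i \<Rightarrow> 'k alg_closure)" where
  "cores_cochain G L \<omega> f =
     (\<lambda>\<sigma>\<in>Gal base_field.
        finprod (points G)
          (\<lambda>j. let i = coset_index L \<omega> (\<sigma> \<circ> \<omega> j);
                   u = inv_into UNIV (\<omega> i) \<circ> \<sigma> \<circ> \<omega> j
               in \<omega> i \<circ> f u)
          {1..extension_degree L})"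

text \<open>
  The class of the corestriction depends neither on the transversal nor on the cocycle
  representing the given class.
\<close>

definition Cores :: "('k::field, 'i::finite) hopf_data \<Rightarrow> 'k alg_closure set \<Rightarrow>
    (('k alg_closure \<Rightarrow> 'k alg_closure) \<Rightarrow> 'i \<Rightarrow> 'k alg_closure) set \<Rightarrow>
    (('k alg_closure \<Rightarrow> 'k alg_closure) \<Rightarrow> 'i \<Rightarrow> 'k alg_closure) set" where
  "Cores G L x =
     (THE y. \<exists>\<omega> f. transversal L \<omega> \<and> f \<in> x \<and>
        y = B1 G base_field #>\<^bsub>Z1 G base_field\<^esub> cores_cochain G L \<omega> f)"


section \<open>The group algebra\<close>

text \<open>\<open>\<Sum>\<^sub>g c\<^sub>g g \<in> K\<^sup>c[\<Gamma>]\<close> is represented by the finitely supported function \<open>g \<mapsto> c\<^sub>g\<close>.\<close>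

definition group_algebra :: "('k::field, 'i::finite) hopf_data \<Rightarrow>
    (('i \<Rightarrow> 'k alg_closure) \<Rightarrow> 'k alg_closure) ring" where
  "group_algebra G =
     \<lparr>carrier = {a. finite {g. a g \<noteq> 0} \<and> {g. a g \<noteq> 0} \<subseteq> carrier (points G)},
      monoid.mult = (\<lambda>a b g. \<Sum>(h, k) \<in> {(h, k). a h \<noteq> 0 \<and> b k \<noteq> 0 \<and> h \<otimes>\<^bsub>points G\<^esub> k = g}. a h * b k),
      one = (\<lambda>g. if g = \<one>\<^bsub>points G\<^esub> then 1 else 0),
      ring.zero = (\<lambda>_. 0),
      add = (\<lambda>a b g. a g + b g)\<rparr>"

definition group_elt :: "('i \<Rightarrow> 'k::field alg_closure) \<Rightarrow> ('i \<Rightarrow> 'k alg_closure) \<Rightarrow> 'k alg_closure" where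
  "group_elt g = (\<lambda>h. if h = g then 1 else 0)"

text \<open>The action taking \<open>\<Sum>\<^sub>h c\<^sub>h h\<close> to \<open>\<Sum>\<^sub>h (\<omega> c\<^sub>h) (\<omega> \<circ> h)\<close>.\<close>

definition galois_act :: "('k::field alg_closure \<Rightarrow> 'k alg_closure) \<Rightarrow>
    (('i \<Rightarrow> 'k alg_closure) \<Rightarrow> 'k alg_closure) \<Rightarrow> ('i \<Rightarrow> 'k alg_closure) \<Rightarrow> 'k alg_closure" where
  "galois_act \<omega> a = (\<lambda>g. \<Sum>h \<in> {h. a h \<noteq> 0 \<and> \<omega> \<circ> h = g}. \<omega> (a h))"

definition fixed_algebra :: "('k::field, 'i::finite) hopf_data \<Rightarrow>
    (('i \<Rightarrow> 'k alg_closure) \<Rightarrow> 'k alg_closure) set" where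
  "fixed_algebra G =
     {a \<in> carrier (group_algebra G). \<forall>\<omega>\<in>Gal base_field. galois_act \<omega> a = a}"

text \<open>
  Under the identification of \<open>A \<otimes>\<^sub>K K\<^sup>c\<close> with \<open>K\<^sup>c[\<Gamma>]\<close>, the subalgebra \<open>A\<^sub>M = A \<otimes>\<^sub>K M\<close> is the set of
  \<open>M\<close>-linear combinations of elements of \<open>A\<close>.
\<close>

definition A_sub :: "('k::field, 'i::finite) hopf_data \<Rightarrow> 'k alg_closure set \<Rightarrow>
    (('i \<Rightarrow> 'k alg_closure) \<Rightarrow> 'k alg_closure) set" where
  "A_sub G M =
     {(\<lambda>g. \<Sum>j<n. c j * a j g) | (n :: nat) c a.
        (\<forall>j<n. c j \<in> M) \<and> (\<forall>j<n. a j \<in> fixed_algebra G)}"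

definition bold_H :: "('k::field, 'i::finite) hopf_data \<Rightarrow> 'k alg_closure set \<Rightarrow>
    (('i \<Rightarrow> 'k alg_closure) \<Rightarrow> 'k alg_closure) monoid" where
  "bold_H G M =
     (units_of (group_algebra G))
       \<lparr>carrier := {\<alpha> \<in> Units (group_algebra G). \<forall>\<omega>\<in>Gal M.
          galois_act \<omega> \<alpha> \<otimes>\<^bsub>group_algebra G\<^esub> inv\<^bsub>group_algebra G\<^esub> \<alpha>
            \<in> group_elt ` carrier (points G)}\<rparr>"

text \<open>The subgroup \<open>\<Gamma> \<cdot> A\<^sub>M\<^sup>\<times>\<close>.\<close>

definition trivial_classes :: "('k::field, 'i::finite) hopf_data \<Rightarrow> 'k alg_closure set \<Rightarrow>
    (('i \<Rightarrow> 'k alg_closure) \<Rightarrow> 'k alg_closure) set" where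
  "trivial_classes G M =
     group_elt ` carrier (points G) <#>\<^bsub>group_algebra G\<^esub>
     Units ((group_algebra G)\<lparr>carrier := A_sub G M\<rparr>)"

definition H_A :: "('k::field, 'i::finite) hopf_data \<Rightarrow> 'k alg_closure set \<Rightarrow>
    (('i \<Rightarrow> 'k alg_closure) \<Rightarrow> 'k alg_closure) set monoid" where
  "H_A G M = bold_H G M Mod trivial_classes G M"

text \<open>
  \<open>\<Upsilon>\<^sub>M x\<close> is the class of any \<open>\<alpha>\<close> whose cocycle \<open>\<omega> \<mapsto> (\<omega> \<alpha>) \<alpha>\<inverse>\<close> represents \<open>x\<close>. That such
  \<open>\<alpha>\<close> exist and all have the same class is what makes the description definite.
\<close>

definition Upsilon :: "('k::field, 'i::finite) hopf_data \<Rightarrow> 'k alg_closure set \<Rightarrow>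
    (('k alg_closure \<Rightarrow> 'k alg_closure) \<Rightarrow> 'i \<Rightarrow> 'k alg_closure) set \<Rightarrow>
    (('i \<Rightarrow> 'k alg_closure) \<Rightarrow> 'k alg_closure) set" where
  "Upsilon G M x =
     (THE h. \<exists>\<alpha> \<in> carrier (bold_H G M). \<exists>f \<in> x.
        (\<forall>\<omega>\<in>Gal M. group_elt (f \<omega>) =
           galois_act \<omega> \<alpha> \<otimes>\<^bsub>group_algebra G\<^esub> inv\<^bsub>group_algebra G\<^esub> \<alpha>) \<and>
        h = trivial_classes G M #>\<^bsub>bold_H G M\<^esub> \<alpha>)"

definition norm_elt :: "('k::field, 'i::finite) hopf_data \<Rightarrow> 'k alg_closure set \<Rightarrow>
    (nat \<Rightarrow> 'k alg_closure \<Rightarrow> 'k alg_closure) \<Rightarrow>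
    (('i \<Rightarrow> 'k alg_closure) \<Rightarrow> 'k alg_closure) \<Rightarrow> ('i \<Rightarrow> 'k alg_closure) \<Rightarrow> 'k alg_closure" where
  "norm_elt G L \<omega> a =
     finprod (group_algebra G) (\<lambda>i. galois_act (\<omega> i) a) {1..extension_degree L}"

text \<open>The map \<open>H(A\<^sub>L) \<rightarrow> H(A\<^sub>K)\<close> induced by \<open>norm_elt\<close> on classes.\<close>

definition norm_on_H :: "('k::field, 'i::finite) hopf_data \<Rightarrow> 'k alg_closure set \<Rightarrow>
    (nat \<Rightarrow> 'k alg_closure \<Rightarrow> 'k alg_closure) \<Rightarrow>
    (('i \<Rightarrow> 'k alg_closure) \<Rightarrow> 'k alg_closure) set \<Rightarrow>
    (('i \<Rightarrow> 'k alg_closure) \<Rightarrow> 'k alg_closure) set" where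
  "norm_on_H G L \<omega> h =
     (THE h'. \<exists>\<alpha>\<in>h. h' = trivial_classes G base_field #>\<^bsub>bold_H G base_field\<^esub> norm_elt G L \<omega> \<alpha>)"

end

theory Submission
  imports Defs
begin

text \<open>
  If \<open>\<alpha>\<close> is a unit with \<open>\<tau> \<alpha> = f(\<tau>) \<alpha>\<close> for \<open>\<tau> \<in> Gal L\<close>, then applying \<open>\<sigma> \<in> Gal K\<close> to the norm
  \<open>\<Prod>\<^sub>j \<omega>\<^sub>j \<alpha>\<close> and writing \<open>\<sigma> \<omega>\<^sub>j = \<omega>\<^sub>i u\<^sub>j\<close> multiplies it by \<open>\<Prod>\<^sub>j \<omega>\<^sub>i f(u\<^sub>j)\<close>, which is the transfer formula for
  the corestriction of \<open>f\<close>. The same computation for a second transversal, and for \<open>\<alpha>\<close> multiplied by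
  an element of \<open>\<Gamma>\<close>, shows that the class of the corestriction is well defined. What remains is that
  \<open>\<alpha>\<close> exists, which is Hilbert 90 for the finite \<open>K\<close>-algebra \<open>A\<close>, and that it is unique modulo
  \<open>\<Gamma> \<cdot> A\<^sub>L\<^sup>\<times>\<close>, which is Galois descent: \<open>A\<^sub>L\<close> consists of all elements fixed by \<open>Gal L\<close>.
\<close>

section \<open>Linear algebra and Galois groups\<close>

text \<open>The linear algebra uses only coefficient families on the finite group \<Gamma>;
  \<open>A\<close> is never split into fields. Hilbert 90 then meets an obstacle: the solutions of
  \<sigma> \<alpha> = f(\<sigma>) \<alpha> are closed under addition but not under multiplication by
  \<open>K^c\<close>, and a nonzero solution may fail to be a unit. Separating functions first
  produce a unit as a \<open>K^c\<close>-linear combination of solutions. An element of the group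
  algebra has finitely many eigenvalues, while characteristic 0 supplies infinitely many distinct
  integers, so the coefficients can be replaced one at a time by natural numbers, under which the
  solutions are stable. \<open>Upsilon\<close>, \<open>Cores\<close> and \<open>norm_on_H\<close>
  are definite descriptions, so each is evaluated by a uniqueness argument. For
  \<open>Cores\<close>, two choices of transversal and representative give norms that differ by a
  factor from \<Gamma>; cancelling the norm, which is a unit, turns this into a coboundary relation
  between the two cochains.\<close>

lemma nontrivial_relation:
  fixes v :: "'a \<Rightarrow> 'b \<Rightarrow> 'k::field"
  assumes "finite S" "finite I" "card S < card I"
  shows "\<exists>c. (\<exists>i\<in>I. c i \<noteq> 0) \<and> (\<forall>s\<in>S. (\<Sum>i\<in>I. c i * v i s) = 0)"
  using assms
proof (induction S arbitrary: I v rule: finite_induct)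
  case empty
  then have "I \<noteq> {}" by auto
  then show ?case by (intro exI[of _ "\<lambda>_. 1"]) auto
next
  case (insert s S)
  show ?case
  proof (cases "\<forall>i\<in>I. v i s = 0")
    case True
    have "card S < card I" using insert by simp
    from insert.IH[OF insert.prems(1) this, of v] True show ?thesis by auto
  next
    case False
    then obtain i0 where i0: "i0 \<in> I" "v i0 s \<noteq> 0" by auto
    define J where "J = I - {i0}"
    have fJ: "finite J" and cJ: "card S < card J" and IJ: "I = insert i0 J" "i0 \<notin> J"
      using insert i0 by (auto simp: J_def card_Diff_singleton)
    \<comment> \<open>Elimination with pivot \<open>v i0 s\<close>: coordinate \<open>s\<close> is
      cleared from all other vectors, leaving \<open>S\<close> as the coordinates.\<close>
    define v' where "v' = (\<lambda>i t. v i t - v i s / v i0 s * v i0 t)"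
    obtain c where c: "\<exists>i\<in>J. c i \<noteq> 0" "\<forall>t\<in>S. (\<Sum>i\<in>J. c i * v' i t) = 0"
      using insert.IH[OF fJ cJ, of v'] by blast
    \<comment> \<open>The coefficient of the pivot collects the multiples of \<open>v i0\<close>
      that were subtracted from the other vectors.\<close>
    define c' where "c' = c(i0 := - (\<Sum>i\<in>J. c i * v i s / v i0 s))"
    have eq: "(\<Sum>i\<in>I. c' i * v i t) = (\<Sum>i\<in>J. c i * v' i t)" for t
    proof -
      have "(\<Sum>i\<in>I. c' i * v i t) = c' i0 * v i0 t + (\<Sum>i\<in>J. c' i * v i t)"
        using IJ fJ by simp
      also have "(\<Sum>i\<in>J. c' i * v i t) = (\<Sum>i\<in>J. c i * v i t)"
        using IJ by (intro sum.cong) (auto simp: c'_def)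
      also have "c' i0 * v i0 t = - (\<Sum>i\<in>J. c i * (v i s / v i0 s * v i0 t))"
        by (simp add: c'_def sum_distrib_right mult.assoc)
      finally show ?thesis by (simp add: v'_def right_diff_distrib sum_subtractf)
    qed
    have "v' i s = 0" for i using i0 by (simp add: v'_def)
    then have "\<forall>t\<in>insert s S. (\<Sum>i\<in>I. c' i * v i t) = 0" using c eq by auto
    moreover have "\<exists>i\<in>I. c' i \<noteq> 0" using c IJ by (auto simp: c'_def)
    ultimately show ?thesis by blast
  qed
qed

text \<open>
  Replaces the independence of characters: multiply functions separating \<open>s\<close> from the other points.
\<close>

lemma indicator_of_mult_closed:
  fixes F :: "('a \<Rightarrow> 'k::comm_semiring_1) set"
  assumes "finite S" and "(\<lambda>_. 1) \<in> F"
    and mult: "\<And>f g. f \<in> F \<Longrightarrow> g \<in> F \<Longrightarrow> \<exists>h\<in>F. \<forall>t\<in>insert s S. h t = f t * g t"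
    and sep: "\<And>t. t \<in> S \<Longrightarrow> t \<noteq> s \<Longrightarrow> \<exists>f\<in>F. f s = 1 \<and> f t = 0"
  shows "\<exists>f\<in>F. f s = 1 \<and> (\<forall>t\<in>S - {s}. f t = 0)"
proof -
  have "\<exists>f\<in>F. f s = 1 \<and> (\<forall>t\<in>U. f t = 0)" if "finite U" "U \<subseteq> S - {s}" for U
    using that
  proof (induction U rule: finite_induct)
    case empty
    then show ?case using assms(2) by auto
  next
    case (insert u U)
    then obtain f g where "f \<in> F" "f s = 1" "\<forall>t\<in>U. f t = 0" "g \<in> F" "g s = 1" "g u = 0"
      using sep[of u] by auto
    moreover from this obtain h where "h \<in> F" "\<forall>t\<in>insert s S. h t = f t * g t"
      using mult by blast
    ultimately show ?case using insert.prems by (intro bexI[of _ h]) auto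
  qed
  then show ?thesis using assms(1) by auto
qed

lemma sum_list_product:
  fixes f :: "'a \<Rightarrow> 'k::semiring_0"
  shows "sum_list (map f xs) * sum_list (map g ys) =
    (\<Sum>p\<leftarrow>List.product xs ys. f (fst p) * g (snd p))"
  by (induction xs) (simp_all add: distrib_right sum_list_const_mult o_def)

section \<open>Automorphisms of the algebraic closure and normal extensions\<close>

lemma Gal_iff:
  "\<omega> \<in> Gal M \<longleftrightarrow> bij \<omega> \<and> (\<forall>x y. \<omega> (x + y) = \<omega> x + \<omega> y) \<and> (\<forall>x y. \<omega> (x * y) = \<omega> x * \<omega> y) \<and>
    \<omega> 1 = 1 \<and> (\<forall>x\<in>M. \<omega> x = x)"
  by (auto simp: Gal_def ring_iso_def ring_hom_def ring_of_type_algebra_def)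

lemma
  assumes "\<omega> \<in> Gal M"
  shows Gal_bij: "bij \<omega>"
    and Gal_add: "\<omega> (x + y) = \<omega> x + \<omega> y"
    and Gal_mult: "\<omega> (x * y) = \<omega> x * \<omega> y"
    and Gal_1: "\<omega> 1 = 1"
    and Gal_fix: "z \<in> M \<Longrightarrow> \<omega> z = z"
  using assms by (auto simp: Gal_iff)

lemma Gal_0: "\<omega> \<in> Gal M \<Longrightarrow> \<omega> 0 = 0"
  using Gal_add[of \<omega> M 0 0] by (metis add.right_neutral add_left_imp_eq)

lemma Gal_sum: "\<omega> \<in> Gal M \<Longrightarrow> \<omega> (sum f A) = (\<Sum>a\<in>A. \<omega> (f a))"
  by (induction A rule: infinite_finite_induct) (auto simp: Gal_0 Gal_add)

lemma Gal_power: "\<omega> \<in> Gal M \<Longrightarrow> \<omega> (x ^ n) = \<omega> x ^ n"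
  by (induction n) (auto simp: Gal_1 Gal_mult)

lemma Gal_comp: "\<sigma> \<in> Gal M \<Longrightarrow> \<tau> \<in> Gal M \<Longrightarrow> \<sigma> \<circ> \<tau> \<in> Gal M"
  by (auto simp: Gal_iff bij_comp)

lemma Gal_inv:
  assumes "\<sigma> \<in> Gal M" shows "inv_into UNIV \<sigma> \<in> Gal M"
proof -
  have b: "bij \<sigma>" and i: "inj \<sigma>" using assms Gal_bij bij_is_inj by auto
  have s: "\<sigma> (inv_into UNIV \<sigma> x) = x" for x using b by (meson bij_inv_eq_iff)
  have *: "inv_into UNIV \<sigma> x = y" if "x = \<sigma> y" for x y
    using i that by simp
  show ?thesis unfolding Gal_iff
    by (safe intro!: bij_imp_bij_inv b; rule *)
      (simp_all add: s Gal_add[OF assms] Gal_mult[OF assms] Gal_1[OF assms] Gal_fix[OF assms])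
qed

lemma Gal_id: "id \<in> Gal M"
  by (auto simp: Gal_iff)

lemma Gal_anti_mono: "M \<subseteq> M' \<Longrightarrow> Gal M' \<subseteq> Gal M"
  by (auto simp: Gal_iff subset_iff)

lemma Gal_inv_left: "\<sigma> \<in> Gal M \<Longrightarrow> inv_into UNIV \<sigma> \<circ> \<sigma> = id"
  and Gal_inv_right: "\<sigma> \<in> Gal M \<Longrightarrow> \<sigma> \<circ> inv_into UNIV \<sigma> = id"
  using Gal_bij[of \<sigma> M] by (auto simp: bij_def surj_iff)

lemma Gal_poly_root:
  assumes "\<sigma> \<in> Gal base_field" "poly (map_poly to_ac p) x = 0"
  shows "poly (map_poly to_ac p) (\<sigma> x) = 0"
proof -
  have "\<sigma> (poly (map_poly to_ac p) x) = poly (map_poly to_ac p) (\<sigma> x)"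
    using assms(1)
    by (simp add: poly_altdef Gal_sum Gal_mult Gal_power Gal_fix coeff_map_poly)
  then show ?thesis using assms Gal_0 by metis
qed

text \<open>Conjugates are roots of one nonzero polynomial over \<open>K\<close>. In Hilbert 90 this
  bounds the number of restrictions of automorphisms to a finite set.\<close>

lemma finite_Gal_orbit: "finite ((\<lambda>\<sigma>. \<sigma> x) ` Gal base_field)"
proof -
  obtain p where p: "p \<noteq> 0" "poly (map_poly to_ac p) x = 0" by (rule alg_closure_algebraic)
  have "map_poly to_ac p \<noteq> 0" using p by (auto simp: poly_eq_iff coeff_map_poly)
  then have "finite {y. poly (map_poly to_ac p) y = 0}" by (rule poly_roots_finite)
  then show ?thesis by (rule finite_subset[rotated]) (auto intro: Gal_poly_root p)
qed

text \<open>A reducible polynomial vanishing at \<open>x\<close> has a factor of smaller degree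
  vanishing at \<open>x\<close>; nonzero constants are excluded because they have no roots. The
  irreducible form is what the normality clause of \<open>finite_galois_extension\<close> asks
  for.\<close>

lemma exists_irreducible_poly_root:
  fixes x :: "'k::field_char_0 alg_closure"
  shows "\<exists>p :: 'k poly. Factorial_Ring.irreducible p \<and> poly (map_poly to_ac p) x = 0"
proof -
  obtain p :: "'k poly" where p: "p \<noteq> 0" "poly (map_poly to_ac p) x = 0" by (rule alg_closure_algebraic)
  have hom: "map_poly to_ac (a * b) = map_poly to_ac a * map_poly to_ac b" for a b :: "'k poly"
    by (rule poly_eqI) (simp add: coeff_map_poly coeff_mult to_ac_sum)
  let ?Q = "\<exists>p :: 'k poly. Factorial_Ring.irreducible p \<and> poly (map_poly to_ac p) x = 0"
  have "p \<noteq> 0 \<longrightarrow> poly (map_poly to_ac p) x = 0 \<longrightarrow> ?Q"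
  proof (induction "degree p" arbitrary: p rule: less_induct)
    case less
    show ?case
    proof (cases "Factorial_Ring.irreducible p")
      case False
      show ?thesis
      proof (intro impI)
        assume p: "p \<noteq> 0" "poly (map_poly to_ac p) x = 0"
        have "\<not> is_unit p"
        proof
          assume "is_unit p"
          then obtain c where c: "p = [:c:]" "c dvd 1" by (auto simp: is_unit_poly_iff)
          then show False using p by (auto simp: map_poly_pCons)
        qed
        with False p obtain a b where ab: "p = a * b" "\<not> is_unit a" "\<not> is_unit b"
          by (auto simp: Factorial_Ring.irreducible_def)
        with p have nz: "a \<noteq> 0" "b \<noteq> 0" by auto
        have "degree a > 0" "degree b > 0"
          using nz ab by (auto simp: is_unit_iff_degree)
        then have "degree a < degree p" "degree b < degree p"
          using ab nz by (auto simp: degree_mult_eq)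
        moreover have "poly (map_poly to_ac a) x = 0 \<or> poly (map_poly to_ac b) x = 0"
          using p ab by (simp add: hom)
        ultimately show ?Q using less nz by blast
      qed
    qed blast
  qed
  then show ?thesis using p by blast
qed

lemma galois_extension_stable:
  assumes "finite_galois_extension L" "\<sigma> \<in> Gal base_field" "x \<in> L"
  shows "\<sigma> x \<in> L"
proof -
  obtain p where "Factorial_Ring.irreducible p" "poly (map_poly to_ac p) x = 0"
    using exists_irreducible_poly_root by blast
  then show ?thesis using assms Gal_poly_root unfolding finite_galois_extension_def by blast
qed

lemma galois_extension_closed:
  assumes "finite_galois_extension L"
  shows "1 \<in> L" "0 \<in> L" "\<And>x y. x \<in> L \<Longrightarrow> y \<in> L \<Longrightarrow> x * y \<in> L"
    "\<And>x y. x \<in> L \<Longrightarrow> y \<in> L \<Longrightarrow> x + y \<in> L" "\<And>x. x \<in> L \<Longrightarrow> - x \<in> L"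
    "\<And>x. x \<in> L \<Longrightarrow> inverse x \<in> L" "base_field \<subseteq> L"
proof -
  interpret F: field "Kc :: 'a alg_closure ring" by (rule field_from_type_algebra)
  have s: "subfield L Kc" using assms by (simp add: finite_galois_extension_def)
  note simps = ring_of_type_algebra_def
  have r: "subring L Kc" using s by (rule subfieldE)
  show "1 \<in> L" "0 \<in> L" using subringE(2,3)[OF r] by (simp_all add: simps)
  show "x * y \<in> L" "x + y \<in> L" if "x \<in> L" "y \<in> L" for x y
    using subringE(6,7)[OF r that] by (simp_all add: simps)
  show neg: "- x \<in> L" if "x \<in> L" for x
  proof -
    have "\<ominus>\<^bsub>Kc\<^esub> x = - x"
      by (rule F.minus_equality) (auto simp: simps)
    then show ?thesis using subringE(5)[OF r that] by simp
  qed
  \<comment> \<open>The record inverse is only meaningful for units, so \<open>x = 0\<close>, where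
    the type class gives \<open>inverse 0 = 0\<close>, is treated apart.\<close>
  show "inverse x \<in> L" if "x \<in> L" for x
  proof (cases "x = 0")
    case False
    have "x \<in> L - {\<zero>\<^bsub>Kc\<^esub>}" using that False by (simp add: simps)
    from F.subfield_m_inv[OF s this] have "inv\<^bsub>Kc\<^esub> x \<in> L" "x * inv\<^bsub>Kc\<^esub> x = 1" by (auto simp: simps)
    then show ?thesis using inverse_unique by metis
  qed (use \<open>0 \<in> L\<close> in simp)
  show "base_field \<subseteq> L" using assms by (simp add: finite_galois_extension_def)
qed

section \<open>The group of points\<close>

text \<open>This and its two longer variants carry the innermost summation index to the outside.
  Expanding products at a point creates a free index innermost, whereas the Hopf axioms fix that
  index and sum over the others.\<close>

lemma sum_move_in_3:
  "(\<Sum>a\<in>A. \<Sum>b\<in>B. \<Sum>p\<in>P. f a b p) = (\<Sum>p\<in>P. \<Sum>a\<in>A. \<Sum>b\<in>B. f a b p)"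
  by (rule trans[OF sum.cong[OF refl sum.swap] sum.swap])

lemma sum_move_in_4:
  "(\<Sum>a\<in>A. \<Sum>b\<in>B. \<Sum>c\<in>C. \<Sum>p\<in>P. f a b c p) = (\<Sum>p\<in>P. \<Sum>a\<in>A. \<Sum>b\<in>B. \<Sum>c\<in>C. f a b c p)"
  by (rule trans[OF sum.cong[OF refl sum_move_in_3] sum.swap])

lemma sum_move_in_5:
  "(\<Sum>a\<in>A. \<Sum>b\<in>B. \<Sum>c\<in>C. \<Sum>d\<in>D. \<Sum>p\<in>P. f a b c d p) =
    (\<Sum>p\<in>P. \<Sum>a\<in>A. \<Sum>b\<in>B. \<Sum>c\<in>C. \<Sum>d\<in>D. f a b c d p)"
  by (rule trans[OF sum.cong[OF refl sum_move_in_4] sum.swap])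

lemma points_simps:
  "x \<in> carrier (points G) \<longleftrightarrow> (\<forall>i j. x i * x j = (\<Sum>k\<in>UNIV. to_ac (mul G i j k) * x k)) \<and>
     (\<Sum>i\<in>UNIV. to_ac (unit G i) * x i) = 1"
  "x \<otimes>\<^bsub>points G\<^esub> y = (\<lambda>i. \<Sum>j\<in>UNIV. \<Sum>k\<in>UNIV. to_ac (comul G i j k) * x j * y k)"
  "\<one>\<^bsub>points G\<^esub> = (\<lambda>i. to_ac (counit G i))"
  by (simp_all add: points_def)

context finite_comm_group_scheme
begin

lemma points_mult_value:
  assumes "x \<in> carrier (points G)"
  shows "x i * x j = (\<Sum>k\<in>UNIV. to_ac (mul G i j k) * x k)"
  using assms by (simp add: points_simps)

lemma points_unit_value:
  assumes "x \<in> carrier (points G)"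
  shows "(\<Sum>i\<in>UNIV. to_ac (unit G i) * x i) = 1"
  using assms by (simp add: points_simps)

text \<open>The product is the tensor product of \<open>x\<close> and \<open>y\<close> composed with
  the comultiplication, hence a homomorphism because all three maps are and \<open>K^c\<close> is
  commutative. Below, \<open>comul_mul\<close> and \<open>comul_unit\<close> carry this argument in
  coordinates.\<close>

lemma points_m_closed:
  assumes x: "x \<in> carrier (points G)" and y: "y \<in> carrier (points G)"
  shows "x \<otimes>\<^bsub>points G\<^esub> y \<in> carrier (points G)"
proof -
  define z where "z = x \<otimes>\<^bsub>points G\<^esub> y"
  have z: "z i = (\<Sum>p\<in>UNIV. \<Sum>q\<in>UNIV. to_ac (comul G i p q) * x p * y q)" for i
    by (simp add: z_def points_simps)
  have "z i * z j = (\<Sum>l\<in>UNIV. to_ac (mul G i j l) * z l)" for i j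
  proof -
    have "z i * z j = (\<Sum>a\<in>UNIV. \<Sum>b\<in>UNIV. \<Sum>c\<in>UNIV. \<Sum>d\<in>UNIV.
        to_ac (comul G i a b * comul G j c d) * (x a * x c) * (y b * y d))"
    proof -
      have "z i * z j = (\<Sum>a\<in>UNIV. \<Sum>b\<in>UNIV. to_ac (comul G i a b) * x a * y b * z j)"
        by (subst z) (simp only: sum_distrib_right)
      then show ?thesis by (simp add: z sum_distrib_left ac_simps)
    qed
    also have "\<dots> = (\<Sum>a\<in>UNIV. \<Sum>b\<in>UNIV. \<Sum>c\<in>UNIV. \<Sum>d\<in>UNIV. \<Sum>p\<in>UNIV. \<Sum>q\<in>UNIV.
        to_ac (comul G i a b * comul G j c d * mul G a c p * mul G b d q) * x p * y q)"
      by (simp add: points_mult_value[OF x] points_mult_value[OF y] sum_product sum_distrib_left ac_simps)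
    also have "\<dots> = (\<Sum>p\<in>UNIV. \<Sum>q\<in>UNIV. \<Sum>a\<in>UNIV. \<Sum>b\<in>UNIV. \<Sum>c\<in>UNIV. \<Sum>d\<in>UNIV.
        to_ac (comul G i a b * comul G j c d * mul G a c p * mul G b d q) * x p * y q)"
      by (rule trans[OF sum_move_in_5 sum.cong[OF refl sum_move_in_5]])
    also have "\<dots> = (\<Sum>p\<in>UNIV. \<Sum>q\<in>UNIV. to_ac (\<Sum>a\<in>UNIV. \<Sum>b\<in>UNIV. \<Sum>c\<in>UNIV. \<Sum>d\<in>UNIV.
        comul G i a b * comul G j c d * mul G a c p * mul G b d q) * x p * y q)"
      by (simp only: to_ac_sum sum_distrib_right)
    also have "\<dots> = (\<Sum>p\<in>UNIV. \<Sum>q\<in>UNIV. to_ac (\<Sum>l\<in>UNIV. mul G i j l * comul G l p q) * x p * y q)"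
      by (simp only: comul_mul)
    also have "\<dots> = (\<Sum>p\<in>UNIV. \<Sum>q\<in>UNIV. \<Sum>l\<in>UNIV. to_ac (mul G i j l) * (to_ac (comul G l p q) * x p * y q))"
      by (simp add: to_ac_sum sum_distrib_left sum_distrib_right ac_simps)
    also have "\<dots> = (\<Sum>p\<in>UNIV. \<Sum>l\<in>UNIV. \<Sum>q\<in>UNIV. to_ac (mul G i j l) * (to_ac (comul G l p q) * x p * y q))"
      by (intro sum.cong refl sum.swap)
    also have "\<dots> = (\<Sum>l\<in>UNIV. \<Sum>p\<in>UNIV. \<Sum>q\<in>UNIV. to_ac (mul G i j l) * (to_ac (comul G l p q) * x p * y q))"
      by (rule sum.swap)
    finally show ?thesis by (simp add: z sum_distrib_left)
  qed
  moreover have "(\<Sum>i\<in>UNIV. to_ac (unit G i) * z i) = 1"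
  proof -
    have "(\<Sum>i\<in>UNIV. to_ac (unit G i) * z i) =
        (\<Sum>i\<in>UNIV. \<Sum>p\<in>UNIV. \<Sum>q\<in>UNIV. to_ac (unit G i * comul G i p q) * x p * y q)"
      by (simp add: z sum_distrib_left ac_simps)
    also have "\<dots> = (\<Sum>p\<in>UNIV. \<Sum>i\<in>UNIV. \<Sum>q\<in>UNIV. to_ac (unit G i * comul G i p q) * x p * y q)"
      by (rule sum.swap)
    also have "\<dots> = (\<Sum>p\<in>UNIV. \<Sum>q\<in>UNIV. \<Sum>i\<in>UNIV. to_ac (unit G i * comul G i p q) * x p * y q)"
      by (intro sum.cong refl sum.swap)
    also have "\<dots> = (\<Sum>p\<in>UNIV. \<Sum>q\<in>UNIV. to_ac (\<Sum>i\<in>UNIV. unit G i * comul G i p q) * x p * y q)"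
      by (simp only: to_ac_sum sum_distrib_right)
    also have "\<dots> = (\<Sum>p\<in>UNIV. to_ac (unit G p) * x p) * (\<Sum>q\<in>UNIV. to_ac (unit G q) * y q)"
      by (simp add: comul_unit sum_product ac_simps)
    also have "\<dots> = 1" using x y by (simp add: points_unit_value)
    finally show ?thesis .
  qed
  ultimately show ?thesis unfolding z_def points_simps(1) by blast
qed

lemma points_assoc:
  "(x \<otimes>\<^bsub>points G\<^esub> y) \<otimes>\<^bsub>points G\<^esub> z = x \<otimes>\<^bsub>points G\<^esub> (y \<otimes>\<^bsub>points G\<^esub> z)"
proof
  fix i
  have "((x \<otimes>\<^bsub>points G\<^esub> y) \<otimes>\<^bsub>points G\<^esub> z) i =
      (\<Sum>l\<in>UNIV. \<Sum>r\<in>UNIV. \<Sum>p\<in>UNIV. \<Sum>q\<in>UNIV. to_ac (comul G i l r * comul G l p q) * x p * y q * z r)"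
    by (simp add: points_simps sum_distrib_left sum_distrib_right ac_simps)
  also have "\<dots> = (\<Sum>p\<in>UNIV. \<Sum>q\<in>UNIV. \<Sum>r\<in>UNIV. \<Sum>l\<in>UNIV. to_ac (comul G i l r * comul G l p q) * x p * y q * z r)"
    by (rule trans[OF sum_move_in_3 sum.cong[OF refl trans[OF sum_move_in_3 sum.cong[OF refl sum.swap]]]])
  also have "\<dots> = (\<Sum>p\<in>UNIV. \<Sum>q\<in>UNIV. \<Sum>r\<in>UNIV. to_ac (\<Sum>l\<in>UNIV. comul G i l r * comul G l p q) * x p * y q * z r)"
    by (simp only: to_ac_sum sum_distrib_right)
  also have "\<dots> = (\<Sum>p\<in>UNIV. \<Sum>q\<in>UNIV. \<Sum>r\<in>UNIV. \<Sum>l\<in>UNIV. to_ac (comul G i p l * comul G l q r) * x p * y q * z r)"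
    by (simp only: comul_coassoc to_ac_sum sum_distrib_right)
  also have "\<dots> = (\<Sum>p\<in>UNIV. \<Sum>l\<in>UNIV. \<Sum>q\<in>UNIV. \<Sum>r\<in>UNIV. to_ac (comul G i p l * comul G l q r) * x p * y q * z r)"
    by (rule sum.cong[OF refl sum_move_in_3])
  also have "\<dots> = (x \<otimes>\<^bsub>points G\<^esub> (y \<otimes>\<^bsub>points G\<^esub> z)) i"
    by (simp add: points_simps sum_distrib_left sum_distrib_right ac_simps)
  finally show "((x \<otimes>\<^bsub>points G\<^esub> y) \<otimes>\<^bsub>points G\<^esub> z) i = (x \<otimes>\<^bsub>points G\<^esub> (y \<otimes>\<^bsub>points G\<^esub> z)) i" .
qed

lemma points_comm: "x \<otimes>\<^bsub>points G\<^esub> y = y \<otimes>\<^bsub>points G\<^esub> x"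
proof -
  have "(\<Sum>j\<in>UNIV. \<Sum>k\<in>UNIV. to_ac (comul G i j k) * x j * y k) =
      (\<Sum>j\<in>UNIV. \<Sum>k\<in>UNIV. to_ac (comul G i j k) * y j * x k)" for i
  proof -
    have "(\<Sum>j\<in>UNIV. \<Sum>k\<in>UNIV. to_ac (comul G i j k) * x j * y k) =
        (\<Sum>k\<in>UNIV. \<Sum>j\<in>UNIV. to_ac (comul G i j k) * x j * y k)" by (rule sum.swap)
    also have "\<dots> = (\<Sum>k\<in>UNIV. \<Sum>j\<in>UNIV. to_ac (comul G i k j) * y k * x j)"
      by (subst comul_cocomm) (simp add: ac_simps)
    finally show ?thesis .
  qed
  then show ?thesis by (simp add: points_simps)
qed

lemma points_one_closed: "\<one>\<^bsub>points G\<^esub> \<in> carrier (points G)"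
  unfolding points_simps
  by (simp flip: to_ac_mult to_ac_sum add: counit_mul counit_unit)

lemma points_l_one: "\<one>\<^bsub>points G\<^esub> \<otimes>\<^bsub>points G\<^esub> x = x"
proof
  fix i
  have "(\<one>\<^bsub>points G\<^esub> \<otimes>\<^bsub>points G\<^esub> x) i = (\<Sum>j\<in>UNIV. \<Sum>k\<in>UNIV. to_ac (counit G j * comul G i j k) * x k)"
    by (simp add: points_simps ac_simps)
  also have "\<dots> = (\<Sum>k\<in>UNIV. \<Sum>j\<in>UNIV. to_ac (counit G j * comul G i j k) * x k)"
    by (rule sum.swap)
  also have "\<dots> = (\<Sum>k\<in>UNIV. to_ac (\<Sum>j\<in>UNIV. counit G j * comul G i j k) * x k)"
    by (simp only: to_ac_sum sum_distrib_right)
  also have "\<dots> = (\<Sum>k\<in>UNIV. if i = k then x k else 0)"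
    by (intro sum.cong refl) (simp add: comul_counit)
  also have "\<dots> = x i" by simp
  finally show "(\<one>\<^bsub>points G\<^esub> \<otimes>\<^bsub>points G\<^esub> x) i = x i" .
qed

text \<open>Composition of \<open>x\<close> with the antipode, an explicit candidate for the inverse
  in the convolution product.\<close>

definition points_antipode :: "('i \<Rightarrow> 'k alg_closure) \<Rightarrow> 'i \<Rightarrow> 'k alg_closure" where
  "points_antipode x = (\<lambda>i. \<Sum>j\<in>UNIV. to_ac (antipode G i j) * x j)"

lemma points_antipode_closed:
  assumes x: "x \<in> carrier (points G)"
  shows "points_antipode x \<in> carrier (points G)"
proof -
  let ?y = "points_antipode x"
  have "?y i * ?y j = (\<Sum>l\<in>UNIV. to_ac (mul G i j l) * ?y l)" for i j
  proof -
    have "?y i * ?y j = (\<Sum>a\<in>UNIV. \<Sum>b\<in>UNIV. to_ac (antipode G i a * antipode G j b) * (x a * x b))"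
      by (simp add: points_antipode_def sum_product ac_simps)
    also have "\<dots> = (\<Sum>a\<in>UNIV. \<Sum>b\<in>UNIV. \<Sum>p\<in>UNIV. to_ac (antipode G i a * antipode G j b * mul G a b p) * x p)"
      by (simp add: points_mult_value[OF x] sum_distrib_left ac_simps)
    also have "\<dots> = (\<Sum>p\<in>UNIV. \<Sum>a\<in>UNIV. \<Sum>b\<in>UNIV. to_ac (antipode G i a * antipode G j b * mul G a b p) * x p)"
      by (rule sum_move_in_3)
    also have "\<dots> = (\<Sum>p\<in>UNIV. to_ac (\<Sum>l\<in>UNIV. mul G i j l * antipode G l p) * x p)"
      by (simp only: antipode_mul to_ac_sum sum_distrib_right)
    also have "\<dots> = (\<Sum>p\<in>UNIV. \<Sum>l\<in>UNIV. to_ac (mul G i j l) * (to_ac (antipode G l p) * x p))"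
      by (simp add: to_ac_sum sum_distrib_left sum_distrib_right ac_simps)
    also have "\<dots> = (\<Sum>l\<in>UNIV. \<Sum>p\<in>UNIV. to_ac (mul G i j l) * (to_ac (antipode G l p) * x p))"
      by (rule sum.swap)
    finally show ?thesis by (simp add: points_antipode_def sum_distrib_left)
  qed
  moreover have "(\<Sum>i\<in>UNIV. to_ac (unit G i) * ?y i) = 1"
  proof -
    have "(\<Sum>i\<in>UNIV. to_ac (unit G i) * ?y i) = (\<Sum>i\<in>UNIV. \<Sum>p\<in>UNIV. to_ac (unit G i * antipode G i p) * x p)"
      by (simp add: points_antipode_def sum_distrib_left ac_simps)
    also have "\<dots> = (\<Sum>p\<in>UNIV. \<Sum>i\<in>UNIV. to_ac (unit G i * antipode G i p) * x p)"
      by (rule sum.swap)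
    also have "\<dots> = (\<Sum>p\<in>UNIV. to_ac (unit G p) * x p)"
      by (simp only: antipode_unit flip: to_ac_sum sum_distrib_right)
    finally show ?thesis using x by (simp add: points_unit_value)
  qed
  ultimately show ?thesis unfolding points_simps(1) by blast
qed

text \<open>Since \<open>x\<close> is multiplicative, the convolution product is \<open>x\<close>
  applied to the left side of \<open>antipode_inverse\<close>; its right side is a multiple of the
  unit of the algebra, where \<open>x\<close> takes the value 1.\<close>

lemma points_l_inv:
  assumes x: "x \<in> carrier (points G)"
  shows "points_antipode x \<otimes>\<^bsub>points G\<^esub> x = \<one>\<^bsub>points G\<^esub>"
proof
  fix i
  have "(points_antipode x \<otimes>\<^bsub>points G\<^esub> x) i =
      (\<Sum>j\<in>UNIV. \<Sum>k\<in>UNIV. \<Sum>l\<in>UNIV. to_ac (comul G i j k * antipode G j l) * (x l * x k))"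
    by (simp add: points_simps points_antipode_def sum_distrib_left sum_distrib_right ac_simps)
  also have "\<dots> = (\<Sum>j\<in>UNIV. \<Sum>k\<in>UNIV. \<Sum>l\<in>UNIV. \<Sum>p\<in>UNIV.
      to_ac (comul G i j k * antipode G j l * mul G l k p) * x p)"
    by (simp only: points_mult_value[OF x] sum_distrib_left to_ac_mult mult.assoc)
  also have "\<dots> = (\<Sum>p\<in>UNIV. \<Sum>j\<in>UNIV. \<Sum>k\<in>UNIV. \<Sum>l\<in>UNIV.
      to_ac (comul G i j k * antipode G j l * mul G l k p) * x p)"
    by (rule sum_move_in_4)
  also have "\<dots> = (\<Sum>p\<in>UNIV. to_ac (counit G i * unit G p) * x p)"
    by (simp only: antipode_inverse flip: to_ac_sum sum_distrib_right)
  also have "\<dots> = to_ac (counit G i) * (\<Sum>p\<in>UNIV. to_ac (unit G p) * x p)"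
    by (simp add: sum_distrib_left ac_simps)
  also have "\<dots> = \<one>\<^bsub>points G\<^esub> i" by (simp add: points_unit_value[OF x]) (simp add: points_simps)
  finally show "(points_antipode x \<otimes>\<^bsub>points G\<^esub> x) i = \<one>\<^bsub>points G\<^esub> i" .
qed

lemma points_comm_group: "comm_group (points G)"
  by (rule comm_groupI)
    (use points_m_closed points_one_closed points_assoc points_comm points_l_one points_l_inv
      points_antipode_closed in blast)+

text \<open>Distinct algebra homomorphisms to a field are linearly independent, so there are at most
  as many points as basis elements. A dependency between points is refuted by a linear functional
  that is 1 at one of them and 0 at the others.\<close>

lemma points_finite: "finite (carrier (points G))"
proof -
  have "card P \<le> card (UNIV :: 'i set)" if P: "P \<subseteq> carrier (points G)" "finite P" for P
  proof (rule ccontr)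
    assume "\<not> ?thesis"
    then obtain c where c: "\<exists>x\<in>P. c x \<noteq> 0" "\<forall>i. (\<Sum>x\<in>P. c x * x i) = 0"
      using nontrivial_relation[of "UNIV :: 'i set" P "\<lambda>x. x"] P by auto
    then obtain y where y: "y \<in> P" "c y \<noteq> 0" by blast
    \<comment> \<open>Functions on \<open>P\<close> obtained by evaluating points at an element of
      the scalar extension of the Hopf algebra to \<open>K^c\<close>, with coordinates
      \<open>w\<close>. The structure constants \<open>mul\<close> make \<open>F\<close> closed
      under products.\<close>
    define F where "F = {f. \<exists>w. \<forall>x\<in>P. f x = (\<Sum>i\<in>UNIV. w i * x i)}"
    have "\<exists>f\<in>F. f y = 1 \<and> (\<forall>t\<in>P - {y}. f t = 0)"
    proof (rule indicator_of_mult_closed)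
      show "(\<lambda>_. 1) \<in> F"
        using P points_unit_value unfolding F_def
        by (auto intro!: exI[of _ "\<lambda>i. to_ac (unit G i)"] dest!: subsetD)
    next
      fix f g assume "f \<in> F" "g \<in> F"
      then obtain w v where w: "\<forall>x\<in>P. f x = (\<Sum>i\<in>UNIV. w i * x i)" "\<forall>x\<in>P. g x = (\<Sum>i\<in>UNIV. v i * x i)"
        by (auto simp: F_def)
      have "f x * g x = (\<Sum>k\<in>UNIV. (\<Sum>i\<in>UNIV. \<Sum>j\<in>UNIV. w i * v j * to_ac (mul G i j k)) * x k)" if "x \<in> P" for x
      proof -
        have "f x * g x = (\<Sum>i\<in>UNIV. \<Sum>j\<in>UNIV. w i * v j * (x i * x j))"
          using that w by (simp add: sum_product) (simp add: ac_simps)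
        also have "\<dots> = (\<Sum>i\<in>UNIV. \<Sum>j\<in>UNIV. \<Sum>k\<in>UNIV. w i * v j * to_ac (mul G i j k) * x k)"
          using that P by (subst points_mult_value) (auto simp: sum_distrib_left ac_simps)
        also have "\<dots> = (\<Sum>k\<in>UNIV. \<Sum>i\<in>UNIV. \<Sum>j\<in>UNIV. w i * v j * to_ac (mul G i j k) * x k)"
          by (rule sum_move_in_3)
        finally show ?thesis by (simp add: sum_distrib_right)
      qed
      then show "\<exists>h\<in>F. \<forall>t\<in>insert y P. h t = f t * g t" using y(1)
        by (intro bexI[of _ "\<lambda>x. f x * g x"]) (auto simp: F_def)
    next
      fix t assume t: "t \<in> P" "t \<noteq> y"
      then obtain i where i: "t i \<noteq> y i" by auto
      define f where "f = (\<lambda>x :: 'i \<Rightarrow> 'k alg_closure. (x i - t i) / (y i - t i))"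
      \<comment> \<open>The constant term of \<open>f\<close> becomes linear in \<open>x\<close> by
        multiplying it with the unit relation, whose value at every point is 1.\<close>
      have "f x = (\<Sum>j\<in>UNIV. ((if j = i then 1 else 0) - t i * to_ac (unit G j)) / (y i - t i) * x j)"
        if "x \<in> P" for x
      proof -
        have "(\<Sum>j\<in>UNIV. ((if j = i then 1 else 0) - t i * to_ac (unit G j)) / (y i - t i) * x j) =
          (\<Sum>j\<in>UNIV. (if j = i then x j / (y i - t i) else 0)) -
          t i / (y i - t i) * (\<Sum>j\<in>UNIV. to_ac (unit G j) * x j)"
          unfolding sum_distrib_left sum_subtractf[symmetric]
          by (intro sum.cong refl) (simp add: field_simps diff_divide_distrib)
        then show ?thesis using points_unit_value[of x] that P
          by (auto simp: f_def diff_divide_distrib)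
      qed
      then have "\<exists>w. \<forall>x\<in>P. f x = (\<Sum>j\<in>UNIV. w j * x j)"
        by (intro exI[of _ "\<lambda>j. ((if j = i then 1 else 0) - t i * to_ac (unit G j)) / (y i - t i)"] ballI)
      then have "f \<in> F" by (simp only: F_def mem_Collect_eq)
      then show "\<exists>f\<in>F. f y = 1 \<and> f t = 0" using i by (intro bexI[of _ f]) (auto simp: f_def)
    qed fact
    then obtain f w where f: "f y = 1" "\<forall>t\<in>P - {y}. f t = 0" "\<forall>x\<in>P. f x = (\<Sum>i\<in>UNIV. w i * x i)"
      by (auto simp: F_def)
    \<comment> \<open>The separating functional is applied to the dependency; only the coefficient
      \<open>c y\<close> survives.\<close>
    have "0 = (\<Sum>i\<in>UNIV. w i * (\<Sum>x\<in>P. c x * x i))" using c by simp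
    also have "\<dots> = (\<Sum>i\<in>UNIV. \<Sum>x\<in>P. c x * (w i * x i))" by (simp add: sum_distrib_left ac_simps)
    also have "\<dots> = (\<Sum>x\<in>P. \<Sum>i\<in>UNIV. c x * (w i * x i))" by (rule sum.swap)
    also have "\<dots> = (\<Sum>x\<in>P. c x * f x)" using f by (simp add: sum_distrib_left)
    also have "\<dots> = (\<Sum>x\<in>P. if x = y then c y else 0)" using f by (intro sum.cong) auto
    also have "\<dots> = c y" using y P by simp
    finally show False using y by simp
  qed
  then show ?thesis by (rule finite_if_finite_subsets_card_bdd[THEN conjunct1])
qed

lemma Gal_points_closed:
  assumes "\<sigma> \<in> Gal base_field" "x \<in> carrier (points G)"
  shows "\<sigma> \<circ> x \<in> carrier (points G)"
proof -
  have "\<sigma> (x i) * \<sigma> (x j) = (\<Sum>k\<in>UNIV. to_ac (mul G i j k) * \<sigma> (x k))" for i j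
    using arg_cong[OF points_mult_value[OF assms(2), of i j], of \<sigma>] assms(1)
    by (simp add: Gal_sum[OF assms(1)] Gal_mult[OF assms(1)] Gal_fix[OF assms(1)])
  moreover have "(\<Sum>i\<in>UNIV. to_ac (unit G i) * \<sigma> (x i)) = 1"
    using arg_cong[OF points_unit_value[OF assms(2)], of \<sigma>]
    by (simp add: Gal_sum[OF assms(1)] Gal_mult[OF assms(1)] Gal_fix[OF assms(1)] Gal_1[OF assms(1)])
  ultimately show ?thesis by (simp add: points_simps)
qed

lemma Gal_points_mult:
  assumes "\<sigma> \<in> Gal base_field"
  shows "\<sigma> \<circ> (x \<otimes>\<^bsub>points G\<^esub> y) = (\<sigma> \<circ> x) \<otimes>\<^bsub>points G\<^esub> (\<sigma> \<circ> y)"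
  by (simp add: points_simps fun_eq_iff Gal_sum[OF assms] Gal_mult[OF assms] Gal_fix[OF assms])

end

section \<open>The group algebra\<close>

lemma group_elt_simps: "group_elt g h = (if h = g then 1 else 0)"
  by (simp add: group_elt_def)

lemma group_elt_eq_iff [simp]: "group_elt g = group_elt h \<longleftrightarrow> g = h"
  by (metis group_elt_simps zero_neq_one)

text \<open>Composition with \<omega> is injective, so the defining sum has at most one term; when
  it is empty, \<omega> fixing 0 gives the same value.\<close>

lemma galois_act_Gal:
  assumes "\<omega> \<in> Gal M"
  shows "galois_act \<omega> a g = \<omega> (a (inv_into UNIV \<omega> \<circ> g))"
proof -
  let ?h = "inv_into UNIV \<omega> \<circ> g"
  have "\<omega> \<circ> h = g \<longleftrightarrow> h = ?h" for h
    using Gal_inv_left[OF assms] Gal_inv_right[OF assms] by (metis comp_assoc id_comp)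
  then have "{h. a h \<noteq> 0 \<and> \<omega> \<circ> h = g} = (if a ?h = 0 then {} else {?h})" by auto
  then show ?thesis using Gal_0[OF assms] by (simp add: galois_act_def)
qed

context finite_comm_group_scheme
begin

sublocale P: comm_group "points G"
  by (rule points_comm_group)

abbreviation "\<Gamma> \<equiv> carrier (points G)"
abbreviation "R \<equiv> group_algebra G"

text \<open>Finiteness of \<Gamma> makes the condition of finite support automatic.\<close>

lemma ga_carrier: "a \<in> carrier R \<longleftrightarrow> (\<forall>g. g \<notin> \<Gamma> \<longrightarrow> a g = 0)"
  using finite_subset[OF _ points_finite, of "{g. a g \<noteq> 0}"] by (auto simp: group_algebra_def)

lemma ga_simps:
  "\<one>\<^bsub>R\<^esub> = group_elt \<one>\<^bsub>points G\<^esub>" "\<zero>\<^bsub>R\<^esub> = (\<lambda>_. 0)" "a \<oplus>\<^bsub>R\<^esub> b = (\<lambda>g. a g + b g)"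
  by (simp_all add: group_algebra_def group_elt_def)

text \<open>The index set no longer depends on the supports of \<open>a\<close> and
  \<open>b\<close>; the added terms vanish.\<close>

lemma ga_mult:
  assumes "a \<in> carrier R" "b \<in> carrier R"
  shows "(a \<otimes>\<^bsub>R\<^esub> b) g = (\<Sum>p | p \<in> \<Gamma> \<times> \<Gamma> \<and> fst p \<otimes>\<^bsub>points G\<^esub> snd p = g. a (fst p) * b (snd p))"
proof -
  have "(a \<otimes>\<^bsub>R\<^esub> b) g = (\<Sum>p \<in> {(h, k). a h \<noteq> 0 \<and> b k \<noteq> 0 \<and> h \<otimes>\<^bsub>points G\<^esub> k = g}. a (fst p) * b (snd p))"
    by (simp add: group_algebra_def case_prod_unfold)
  also have "\<dots> = (\<Sum>p | p \<in> \<Gamma> \<times> \<Gamma> \<and> fst p \<otimes>\<^bsub>points G\<^esub> snd p = g. a (fst p) * b (snd p))"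
    using assms points_finite by (intro sum.mono_neutral_left) (auto simp: ga_carrier)
  finally show ?thesis .
qed

text \<open>
  Testing against functions on \<open>\<Gamma>\<close> turns products into iterated sums over all of \<open>\<Gamma>\<close>, which avoids the
  fibres of the multiplication in the ring axioms.
\<close>

definition pairing :: "(('i \<Rightarrow> 'k alg_closure) \<Rightarrow> 'k alg_closure) \<Rightarrow>
    (('i \<Rightarrow> 'k alg_closure) \<Rightarrow> 'k alg_closure) \<Rightarrow> 'k alg_closure" where
  "pairing a \<phi> = (\<Sum>g\<in>\<Gamma>. a g * \<phi> g)"

text \<open>\<open>group_elt g\<close>, read as a test function, is the indicator of
  \<open>g\<close> and recovers the coefficient there.\<close>

lemma pairing_eqI:
  assumes "a \<in> carrier R" "b \<in> carrier R" "\<And>\<phi>. pairing a \<phi> = pairing b \<phi>"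
  shows "a = b"
proof
  fix g show "a g = b g"
  proof (cases "g \<in> \<Gamma>")
    case True
    have "pairing c (group_elt g) = (\<Sum>h\<in>\<Gamma>. if h = g then c h else 0)" for c
      by (auto simp: pairing_def group_elt_simps intro: sum.cong)
    then have "pairing c (group_elt g) = c g" for c
      using True points_finite by simp
    then show ?thesis using assms(3) by metis
  qed (use assms in \<open>auto simp: ga_carrier\<close>)
qed

lemma ga_mult_closed:
  assumes "a \<in> carrier R" "b \<in> carrier R"
  shows "a \<otimes>\<^bsub>R\<^esub> b \<in> carrier R"
  unfolding ga_carrier
proof (intro allI impI)
  fix g assume "g \<notin> \<Gamma>"
  then have *: "{p. p \<in> \<Gamma> \<times> \<Gamma> \<and> fst p \<otimes>\<^bsub>points G\<^esub> snd p = g} = {}" by auto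
  show "(a \<otimes>\<^bsub>R\<^esub> b) g = 0" unfolding ga_mult[OF assms] * by simp
qed

text \<open>The fibres of the group multiplication partition all pairs of points, so summing over
  fibres and then over \<Gamma> is a free double sum.\<close>

lemma pairing_mult:
  assumes "a \<in> carrier R" "b \<in> carrier R"
  shows "pairing (a \<otimes>\<^bsub>R\<^esub> b) \<phi> = pairing a (\<lambda>h. pairing b (\<lambda>k. \<phi> (h \<otimes>\<^bsub>points G\<^esub> k)))"
proof -
  have "pairing (a \<otimes>\<^bsub>R\<^esub> b) \<phi> = (\<Sum>g\<in>\<Gamma>. \<Sum>p | p \<in> \<Gamma> \<times> \<Gamma> \<and> fst p \<otimes>\<^bsub>points G\<^esub> snd p = g.
      a (fst p) * b (snd p) * \<phi> (fst p \<otimes>\<^bsub>points G\<^esub> snd p))"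
    by (simp add: pairing_def ga_mult[OF assms] sum_distrib_right)
  also have "\<dots> = (\<Sum>p\<in>\<Gamma> \<times> \<Gamma>. a (fst p) * b (snd p) * \<phi> (fst p \<otimes>\<^bsub>points G\<^esub> snd p))"
    using points_finite by (intro sum.group) auto
  finally show ?thesis
    by (simp add: pairing_def sum.cartesian_product' sum_distrib_left mult.assoc)
qed

lemma group_elt_closed [simp]: "g \<in> \<Gamma> \<Longrightarrow> group_elt g \<in> carrier R"
  by (auto simp: ga_carrier group_elt_simps)

lemma pairing_group_elt: "g \<in> \<Gamma> \<Longrightarrow> pairing (group_elt g) \<phi> = \<phi> g"
proof -
  assume g: "g \<in> \<Gamma>"
  have "pairing (group_elt g) \<phi> = (\<Sum>h\<in>\<Gamma>. if h = g then \<phi> h else 0)"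
    by (auto simp: pairing_def group_elt_simps intro: sum.cong)
  then show ?thesis using g points_finite by simp
qed

lemma pairing_cong: "a = b \<Longrightarrow> (\<And>g. g \<in> \<Gamma> \<Longrightarrow> \<phi> g = \<psi> g) \<Longrightarrow> pairing a \<phi> = pairing b \<psi>"
  by (simp add: pairing_def)

lemma pairing_add: "pairing (\<lambda>g. a g + b g) \<phi> = pairing a \<phi> + pairing b \<phi>"
  by (simp add: pairing_def distrib_right sum.distrib)

lemma ga_cring: "cring R"
proof (rule cringI)
  show "abelian_group R"
  proof (rule abelian_groupI)
    fix a assume a: "a \<in> carrier R"
    show "\<exists>b\<in>carrier R. b \<oplus>\<^bsub>R\<^esub> a = \<zero>\<^bsub>R\<^esub>"
      using a by (intro bexI[of _ "\<lambda>g. - a g"]) (auto simp: ga_simps ga_carrier)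
  qed (auto simp: ga_simps ga_carrier algebra_simps)
  show "comm_monoid R"
  proof (rule comm_monoidI)
    fix a b c assume a: "a \<in> carrier R" and b: "b \<in> carrier R" and c: "c \<in> carrier R"
    show "a \<otimes>\<^bsub>R\<^esub> b \<otimes>\<^bsub>R\<^esub> c = a \<otimes>\<^bsub>R\<^esub> (b \<otimes>\<^bsub>R\<^esub> c)"
      by (rule pairing_eqI) (simp_all add: a b c ga_mult_closed pairing_mult P.m_assoc cong: pairing_cong)
  next
    fix a b assume a: "a \<in> carrier R" and b: "b \<in> carrier R"
    show "a \<otimes>\<^bsub>R\<^esub> b = b \<otimes>\<^bsub>R\<^esub> a"
    proof (rule pairing_eqI)
      fix \<phi>
      have "pairing a (\<lambda>h. pairing b (\<lambda>k. \<phi> (h \<otimes>\<^bsub>points G\<^esub> k))) =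
          (\<Sum>h\<in>\<Gamma>. \<Sum>k\<in>\<Gamma>. a h * b k * \<phi> (h \<otimes>\<^bsub>points G\<^esub> k))"
        by (simp add: pairing_def sum_distrib_left mult.assoc)
      also have "\<dots> = (\<Sum>k\<in>\<Gamma>. \<Sum>h\<in>\<Gamma>. a h * b k * \<phi> (h \<otimes>\<^bsub>points G\<^esub> k))"
        by (rule sum.swap)
      also have "\<dots> = (\<Sum>k\<in>\<Gamma>. \<Sum>h\<in>\<Gamma>. b k * (a h * \<phi> (k \<otimes>\<^bsub>points G\<^esub> h)))"
        by (intro sum.cong refl) (simp add: P.m_comm ac_simps)
      also have "\<dots> = pairing b (\<lambda>k. pairing a (\<lambda>h. \<phi> (k \<otimes>\<^bsub>points G\<^esub> h)))"
        by (simp add: pairing_def sum_distrib_left)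
      finally show "pairing (a \<otimes>\<^bsub>R\<^esub> b) \<phi> = pairing (b \<otimes>\<^bsub>R\<^esub> a) \<phi>"
        by (simp add: pairing_mult a b)
    qed (simp_all add: a b ga_mult_closed)
  next
    fix a assume a: "a \<in> carrier R"
    show "\<one>\<^bsub>R\<^esub> \<otimes>\<^bsub>R\<^esub> a = a"
      by (rule pairing_eqI)
        (simp_all add: a ga_mult_closed ga_simps(1) pairing_mult pairing_group_elt cong: pairing_cong)
  qed (auto simp: ga_simps ga_mult_closed)
  fix a b c assume a: "a \<in> carrier R" and b: "b \<in> carrier R" and c: "c \<in> carrier R"
  have ab: "(\<lambda>g. a g + b g) \<in> carrier R" and
    "(\<lambda>g. (a \<otimes>\<^bsub>R\<^esub> c) g + (b \<otimes>\<^bsub>R\<^esub> c) g) \<in> carrier R"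
    using a b ga_mult_closed[OF a c] ga_mult_closed[OF b c] by (simp_all add: ga_carrier)
  then show "(a \<oplus>\<^bsub>R\<^esub> b) \<otimes>\<^bsub>R\<^esub> c = a \<otimes>\<^bsub>R\<^esub> c \<oplus>\<^bsub>R\<^esub> b \<otimes>\<^bsub>R\<^esub> c"
    unfolding ga_simps
    by (intro pairing_eqI ga_mult_closed c) (simp_all add: c a b pairing_mult pairing_add)
qed

sublocale R: cring R
  by (rule ga_cring)

lemma group_elt_mult:
  assumes "g \<in> \<Gamma>" "h \<in> \<Gamma>"
  shows "group_elt (g \<otimes>\<^bsub>points G\<^esub> h) = group_elt g \<otimes>\<^bsub>R\<^esub> group_elt h"
  by (rule pairing_eqI) (use assms in \<open>simp_all add: pairing_mult pairing_group_elt\<close>)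

lemma group_elt_Units: "g \<in> \<Gamma> \<Longrightarrow> group_elt g \<in> Units R"
  and inv_group_elt: "g \<in> \<Gamma> \<Longrightarrow> inv\<^bsub>R\<^esub> (group_elt g) = group_elt (inv\<^bsub>points G\<^esub> g)"
proof -
  assume g: "g \<in> \<Gamma>"
  have *: "group_elt g \<otimes>\<^bsub>R\<^esub> group_elt (inv\<^bsub>points G\<^esub> g) = \<one>\<^bsub>R\<^esub>"
    using g by (simp add: ga_simps flip: group_elt_mult)
  show "group_elt g \<in> Units R"
    using g * R.m_comm unfolding Units_def by (auto intro!: bexI[of _ "group_elt (inv\<^bsub>points G\<^esub> g)"])
  show "inv\<^bsub>R\<^esub> (group_elt g) = group_elt (inv\<^bsub>points G\<^esub> g)"
    using g * by (intro R.comm_inv_char) auto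
qed

lemma group_elt_finprod:
  assumes "f \<in> A \<rightarrow> \<Gamma>"
  shows "group_elt (finprod (points G) f A) = finprod R (\<lambda>i. group_elt (f i)) A"
  using assms
proof (induction A rule: infinite_finite_induct)
  case (insert i A)
  then show ?case
    by (subst P.finprod_insert; simp?; subst R.finprod_insert) (auto simp: group_elt_mult P.finprod_closed Pi_iff)
qed (simp_all add: ga_simps)

section \<open>The semilinear action of the Galois group on the group algebra\<close>

lemma act_closed:
  assumes "\<sigma> \<in> Gal base_field" "a \<in> carrier R"
  shows "galois_act \<sigma> a \<in> carrier R"
proof -
  have "inv_into UNIV \<sigma> \<circ> g \<notin> \<Gamma>" if "g \<notin> \<Gamma>" for g
    using that Gal_points_closed[OF assms(1), of "inv_into UNIV \<sigma> \<circ> g"] Gal_inv_right[OF assms(1)]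
    by (auto simp flip: comp_assoc)
  then show ?thesis using assms(2) by (simp add: ga_carrier galois_act_Gal[OF assms(1)] Gal_0[OF assms(1)])
qed

lemma act_sum: "\<sigma> \<in> Gal base_field \<Longrightarrow>
    galois_act \<sigma> (\<lambda>g. \<Sum>i\<in>I. a i g) = (\<lambda>g. \<Sum>i\<in>I. galois_act \<sigma> (a i) g)"
  by (simp add: galois_act_Gal fun_eq_iff Gal_sum)

lemma act_smult: "\<sigma> \<in> Gal base_field \<Longrightarrow>
    galois_act \<sigma> (\<lambda>g. c * a g) = (\<lambda>g. \<sigma> c * galois_act \<sigma> a g)"
  by (simp add: galois_act_Gal fun_eq_iff Gal_mult)

lemma act_comp:
  assumes "\<sigma> \<in> Gal base_field" "\<tau> \<in> Gal base_field"
  shows "galois_act \<sigma> (galois_act \<tau> a) = galois_act (\<sigma> \<circ> \<tau>) a"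
  using Gal_bij[OF assms(1)] Gal_bij[OF assms(2)]
  by (auto simp: fun_eq_iff galois_act_Gal[OF assms(1)] galois_act_Gal[OF assms(2)]
      galois_act_Gal[OF Gal_comp[OF assms]] o_inv_distrib comp_assoc)

lemma act_id: "galois_act id a = a"
  using galois_act_Gal[OF Gal_id] by (auto simp: fun_eq_iff)

lemma act_group_elt:
  assumes "\<sigma> \<in> Gal base_field"
  shows "galois_act \<sigma> (group_elt g) = group_elt (\<sigma> \<circ> g)"
proof
  fix h
  have "inv_into UNIV \<sigma> \<circ> h = g \<longleftrightarrow> h = \<sigma> \<circ> g"
    using Gal_inv_left[OF assms] Gal_inv_right[OF assms] by (metis comp_assoc id_comp)
  then show "galois_act \<sigma> (group_elt g) h = group_elt (\<sigma> \<circ> g) h"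
    by (auto simp: galois_act_Gal[OF assms] group_elt_simps Gal_0[OF assms] Gal_1[OF assms])
qed

lemma Gal_points_bij:
  assumes "\<sigma> \<in> Gal base_field"
  shows "bij_betw ((\<circ>) \<sigma>) \<Gamma> \<Gamma>"
  using assms Gal_inv[OF assms] Gal_inv_left[OF assms] Gal_inv_right[OF assms]
  by (intro bij_betw_byWitness[where f' = "(\<circ>) (inv_into UNIV \<sigma>)"])
    (auto simp: Gal_points_closed simp flip: comp_assoc)

text \<open>Reindexing along the permutation of \<Gamma> induced by \<sigma> removes the inverse
  that occurs in the pointwise formula for the action.\<close>

lemma pairing_act:
  assumes "\<sigma> \<in> Gal base_field"
  shows "pairing (galois_act \<sigma> a) \<phi> = (\<Sum>g\<in>\<Gamma>. \<sigma> (a g) * \<phi> (\<sigma> \<circ> g))"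
proof -
  have "pairing (galois_act \<sigma> a) \<phi> = (\<Sum>g\<in>\<Gamma>. galois_act \<sigma> a (\<sigma> \<circ> g) * \<phi> (\<sigma> \<circ> g))"
    unfolding pairing_def by (rule sum.reindex_bij_betw[OF Gal_points_bij[OF assms], symmetric])
  then show ?thesis
    by (simp add: galois_act_Gal[OF assms] Gal_inv_left[OF assms] flip: comp_assoc)
qed

lemma act_mult:
  assumes s: "\<sigma> \<in> Gal base_field" and ab: "a \<in> carrier R" "b \<in> carrier R"
  shows "galois_act \<sigma> (a \<otimes>\<^bsub>R\<^esub> b) = galois_act \<sigma> a \<otimes>\<^bsub>R\<^esub> galois_act \<sigma> b"
proof (rule pairing_eqI)
  fix \<phi> :: "('i \<Rightarrow> 'k alg_closure) \<Rightarrow> 'k alg_closure"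
  have inv: "\<sigma> (inv_into UNIV \<sigma> z) = z" for z
    using Gal_inv_right[OF s] by (metis comp_apply id_apply)
  \<comment> \<open>The test function pulled back along \<sigma>: pairing a transformed element with
    \<phi> is \<sigma> applied to the pairing with this function, which moves the whole claim to the
    untransformed product.\<close>
  let ?\<psi> = "\<lambda>g. inv_into UNIV \<sigma> (\<phi> (\<sigma> \<circ> g))"
  have *: "pairing (galois_act \<sigma> c) \<phi> = \<sigma> (pairing c ?\<psi>)" for c
    unfolding pairing_act[OF s] by (simp add: pairing_def Gal_sum[OF s] Gal_mult[OF s] inv)
  show "pairing (galois_act \<sigma> (a \<otimes>\<^bsub>R\<^esub> b)) \<phi> = pairing (galois_act \<sigma> a \<otimes>\<^bsub>R\<^esub> galois_act \<sigma> b) \<phi>"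
    unfolding * pairing_mult[OF ab] pairing_mult[OF act_closed[OF s ab(1)] act_closed[OF s ab(2)]]
    unfolding pairing_act[OF s]
    by (simp add: pairing_def Gal_sum[OF s] Gal_mult[OF s] Gal_points_mult[OF s] inv)
qed (simp_all add: assms act_closed)

lemma act_one: "\<sigma> \<in> Gal base_field \<Longrightarrow> galois_act \<sigma> \<one>\<^bsub>R\<^esub> = \<one>\<^bsub>R\<^esub>"
  by (simp add: ga_simps act_group_elt) (simp add: points_simps fun_eq_iff Gal_fix)

lemma Gal_points_one: "\<sigma> \<in> Gal base_field \<Longrightarrow> \<sigma> \<circ> \<one>\<^bsub>points G\<^esub> = \<one>\<^bsub>points G\<^esub>"
  by (simp add: points_simps fun_eq_iff Gal_fix)

lemma Gal_points_inv:
  assumes "\<sigma> \<in> Gal base_field" "g \<in> \<Gamma>"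
  shows "\<sigma> \<circ> inv\<^bsub>points G\<^esub> g = inv\<^bsub>points G\<^esub> (\<sigma> \<circ> g)"
  using assms
  by (intro P.comm_inv_char[symmetric]) (auto simp: Gal_points_closed Gal_points_one simp flip: Gal_points_mult)

lemma act_Units:
  assumes s: "\<sigma> \<in> Gal base_field" and a: "a \<in> Units R"
  shows "galois_act \<sigma> a \<in> Units R" "galois_act \<sigma> (inv\<^bsub>R\<^esub> a) = inv\<^bsub>R\<^esub> (galois_act \<sigma> a)"
proof -
  have *: "galois_act \<sigma> a \<otimes>\<^bsub>R\<^esub> galois_act \<sigma> (inv\<^bsub>R\<^esub> a) = \<one>\<^bsub>R\<^esub>"
    using a s by (simp add: R.Units_closed act_one flip: act_mult)
  have c: "galois_act \<sigma> a \<in> carrier R" "galois_act \<sigma> (inv\<^bsub>R\<^esub> a) \<in> carrier R"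
    using a s by (auto simp: act_closed R.Units_closed)
  show "galois_act \<sigma> a \<in> Units R" using * c R.m_comm[OF c] unfolding Units_def by auto
  show "galois_act \<sigma> (inv\<^bsub>R\<^esub> a) = inv\<^bsub>R\<^esub> (galois_act \<sigma> a)"
    using * c by (intro R.comm_inv_char[symmetric]) auto
qed

lemma act_finprod:
  assumes s: "\<sigma> \<in> Gal base_field" and f: "f \<in> A \<rightarrow> carrier R"
  shows "galois_act \<sigma> (finprod R f A) = finprod R (\<lambda>i. galois_act \<sigma> (f i)) A"
  using f
proof (induction A rule: infinite_finite_induct)
  case (insert i A)
  then show ?case
    by (subst R.finprod_insert; simp?; subst R.finprod_insert)
      (auto simp: act_mult[OF s] act_closed[OF s] R.finprod_closed Pi_iff)
qed (simp_all add: act_one[OF s])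

end

section \<open>Units of the group algebra\<close>

text \<open>An effective form of the independence of characters, which also keeps track of the
  coefficients (in \<open>C\<close>) and the arguments (in \<open>E\<close>). Hilbert 90 takes all
  of \<open>K^c\<close> for \<open>C\<close>; Galois descent takes \<open>L\<close> for
  both.\<close>

lemma indicator_combination:
  fixes T :: "('k::field alg_closure \<Rightarrow> 'k alg_closure) set"
  assumes T: "finite T" "T \<subseteq> Gal M" "t0 \<in> T"
    and E: "1 \<in> E" "\<And>x y. x \<in> E \<Longrightarrow> y \<in> E \<Longrightarrow> x * y \<in> E"
    and C: "1 \<in> C" "\<And>x y. x \<in> C \<Longrightarrow> y \<in> C \<Longrightarrow> x * y \<in> C" "\<And>x y. x \<in> C \<Longrightarrow> y \<in> C \<Longrightarrow> x - y \<in> C"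
      "\<And>x. x \<in> C \<Longrightarrow> - x \<in> C" "\<And>x. x \<in> C \<Longrightarrow> inverse x \<in> C"
    and val: "\<And>t x. t \<in> T \<Longrightarrow> x \<in> E \<Longrightarrow> t x \<in> C"
    and sep: "\<And>t. t \<in> T \<Longrightarrow> t \<noteq> t0 \<Longrightarrow> \<exists>x\<in>E. t x \<noteq> t0 x"
  shows "\<exists>ps. set ps \<subseteq> C \<times> E \<and>
    (\<forall>t\<in>T. (\<Sum>p\<leftarrow>ps. fst p * t (snd p)) = (if t = t0 then 1 else 0))"
proof -
  define F where "F = {h. \<exists>ps. set ps \<subseteq> C \<times> E \<and> (\<forall>t\<in>T. h t = (\<Sum>p\<leftarrow>ps. fst p * t (snd p)))}"
  have "\<exists>h\<in>F. h t0 = 1 \<and> (\<forall>t\<in>T - {t0}. h t = 0)"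
  proof (rule indicator_of_mult_closed)
    show "(\<lambda>_. 1) \<in> F"
      using T E C unfolding F_def by (auto intro!: exI[of _ "[(1, 1)]"] simp: Gal_1)
  next
    fix f g assume "f \<in> F" "g \<in> F"
    then obtain ps qs where
      ps: "set ps \<subseteq> C \<times> E" "\<forall>t\<in>T. f t = (\<Sum>p\<leftarrow>ps. fst p * t (snd p))" and
      qs: "set qs \<subseteq> C \<times> E" "\<forall>t\<in>T. g t = (\<Sum>p\<leftarrow>qs. fst p * t (snd p))"
      by (auto simp: F_def)
    \<comment> \<open>As each \<open>t\<close> is multiplicative, the product of two combinations is
      the combination over all pairs, with coefficients and arguments multiplied separately.\<close>
    define rs where "rs = map (\<lambda>(p, q). (fst p * fst q, snd p * snd q)) (List.product ps qs)"
    have "set rs \<subseteq> C \<times> E"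
      using ps(1) qs(1) E(2) C(2) by (fastforce simp: rs_def)
    moreover have "f t * g t = (\<Sum>p\<leftarrow>rs. fst p * t (snd p))" if "t \<in> T" for t
    proof -
      have "t \<in> Gal M" using that T by auto
      then show ?thesis using ps(2) qs(2) that
        by (simp add: sum_list_product rs_def o_def case_prod_unfold Gal_mult ac_simps)
    qed
    ultimately show "\<exists>h\<in>F. \<forall>t\<in>insert t0 T. h t = f t * g t"
      using T(3) unfolding F_def by (intro bexI[of _ "\<lambda>t. f t * g t"]) auto
  next
    fix t assume t: "t \<in> T" "t \<noteq> t0"
    then obtain x where x: "x \<in> E" "t x \<noteq> t0 x" using sep by blast
    define d where "d = inverse (t0 x - t x)"
    have d: "d \<in> C" "d * (t0 x - t x) = 1" "- (d * t x) \<in> C"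
      using x t T val C by (simp_all add: d_def)
    \<comment> \<open>The factor \<open>d\<close> normalises the value at \<open>t0\<close> to 1.
      The constant term is a coefficient attached to the argument 1, which every automorphism
      fixes.\<close>
    define h where "h = (\<lambda>s :: 'k alg_closure \<Rightarrow> 'k alg_closure. d * (s x - t x))"
    have "h \<in> F" unfolding F_def
    proof (rule CollectI, intro exI conjI ballI)
      show "set [(d, x), (- (d * t x), 1)] \<subseteq> C \<times> E" using d x E by simp
      fix s assume "s \<in> T"
      then have "s 1 = 1" using T by (auto simp: Gal_1)
      then show "h s = (\<Sum>p\<leftarrow>[(d, x), (- (d * t x), 1)]. fst p * s (snd p))"
        by (simp add: h_def right_diff_distrib)
    qed
    then show "\<exists>f\<in>F. f t0 = 1 \<and> f t = 0" using d by (intro bexI[of _ h]) (auto simp: h_def)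
  qed (fact T)
  then obtain h ps where "h t0 = 1" "\<forall>t\<in>T - {t0}. h t = 0"
    "set ps \<subseteq> C \<times> E" "\<forall>t\<in>T. h t = (\<Sum>p\<leftarrow>ps. fst p * t (snd p))"
    by (auto simp: F_def)
  then show ?thesis by (intro exI[of _ ps]) auto
qed

context finite_comm_group_scheme
begin

section \<open>Scalar multiplication and finite dimensionality of the group algebra\<close>

lemma ga_linear_closed:
  "a \<in> carrier R \<Longrightarrow> (\<lambda>g. c * a g) \<in> carrier R"
  "a \<in> carrier R \<Longrightarrow> b \<in> carrier R \<Longrightarrow> (\<lambda>g. a g + b g) \<in> carrier R"
  "a \<in> carrier R \<Longrightarrow> b \<in> carrier R \<Longrightarrow> (\<lambda>g. a g - b g) \<in> carrier R"
  "(\<And>i. i \<in> I \<Longrightarrow> f i \<in> carrier R) \<Longrightarrow> (\<lambda>g. \<Sum>i\<in>I. f i g) \<in> carrier R"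
  by (simp_all add: ga_carrier)

lemma pairing_smult: "pairing (\<lambda>g. c * a g) \<phi> = c * pairing a \<phi>"
  by (simp add: pairing_def sum_distrib_left mult.assoc)

lemma pairing_smult_right: "pairing a (\<lambda>g. c * \<phi> g) = c * pairing a \<phi>"
  by (simp add: pairing_def sum_distrib_left ac_simps)

lemma pairing_sum: "pairing (\<lambda>g. \<Sum>i\<in>I. a i g) \<phi> = (\<Sum>i\<in>I. pairing (a i) \<phi>)"
  unfolding pairing_def sum_distrib_right by (rule sum.swap)

lemma pairing_sum_right: "pairing a (\<lambda>g. \<Sum>i\<in>I. \<phi> i g) = (\<Sum>i\<in>I. pairing a (\<phi> i))"
  unfolding pairing_def sum_distrib_left by (rule sum.swap)

lemma ga_mult_smult:
  assumes "a \<in> carrier R" "b \<in> carrier R"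
  shows "a \<otimes>\<^bsub>R\<^esub> (\<lambda>g. c * b g) = (\<lambda>g. c * (a \<otimes>\<^bsub>R\<^esub> b) g)"
  using assms by (intro pairing_eqI)
    (simp_all add: ga_linear_closed pairing_mult pairing_smult pairing_smult_right)

lemma ga_mult_sum:
  assumes "a \<in> carrier R" "\<And>i. i \<in> I \<Longrightarrow> b i \<in> carrier R"
  shows "a \<otimes>\<^bsub>R\<^esub> (\<lambda>g. \<Sum>i\<in>I. b i g) = (\<lambda>g. \<Sum>i\<in>I. (a \<otimes>\<^bsub>R\<^esub> b i) g)"
  using assms by (intro pairing_eqI)
    (simp_all add: ga_linear_closed pairing_mult pairing_sum pairing_sum_right)

lemma ga_mult_add:
  assumes "a \<in> carrier R" "b \<in> carrier R" "c \<in> carrier R"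
  shows "a \<otimes>\<^bsub>R\<^esub> (\<lambda>g. b g + c g) = (\<lambda>g. (a \<otimes>\<^bsub>R\<^esub> b) g + (a \<otimes>\<^bsub>R\<^esub> c) g)"
  using R.r_distr[OF assms(2,3,1)] by (simp add: ga_simps)

lemma ga_UnitsI:
  assumes "a \<in> carrier R" "b \<in> carrier R" "a \<otimes>\<^bsub>R\<^esub> b = \<one>\<^bsub>R\<^esub>"
  shows "a \<in> Units R"
  using assms R.m_comm[OF assms(1,2)] unfolding Units_def by auto

text \<open>The powers with exponents 0 to \<open>card \<Gamma>\<close> are one more than the number
  of coordinates, so they are linearly dependent.\<close>

lemma ga_integral:
  assumes z: "z \<in> carrier R"
  shows "\<exists>c n. (\<exists>k\<le>n. c k \<noteq> 0) \<and> (\<forall>g. (\<Sum>k\<le>n. c k * (z [^]\<^bsub>R\<^esub> (k::nat)) g) = 0)"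
proof -
  obtain c where c: "\<exists>k\<in>{..card \<Gamma>}. c k \<noteq> 0"
      "\<forall>g\<in>\<Gamma>. (\<Sum>k\<in>{..card \<Gamma>}. c k * (z [^]\<^bsub>R\<^esub> k) g) = 0"
    using nontrivial_relation[OF points_finite, of "{..card \<Gamma>}" "\<lambda>k. z [^]\<^bsub>R\<^esub> k"] by auto
  have "(\<Sum>k\<le>card \<Gamma>. c k * (z [^]\<^bsub>R\<^esub> k) g) = 0" if "g \<notin> \<Gamma>" for g
    using that R.nat_pow_closed[OF z] by (simp add: ga_carrier)
  then show ?thesis using c by (intro exI[of _ c] exI[of _ "card \<Gamma>"]) auto
qed

text \<open>Divisibility of \<open>z^k - r^k\<close> by \<open>w = z - r\<close>. If
  \<open>z^k = r^k + w s\<close>, then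
  \<open>z^(k+1) = r^k z + w z s = r^(k+1) + w (r^k + z s)\<close>, which supplies the next
  cofactor.\<close>

lemma ga_power_diff:
  assumes z: "z \<in> carrier R"
  shows "\<exists>s\<in>carrier R. z [^]\<^bsub>R\<^esub> (k::nat) =
    (\<lambda>g. r ^ k * \<one>\<^bsub>R\<^esub> g + ((\<lambda>g. z g - r * \<one>\<^bsub>R\<^esub> g) \<otimes>\<^bsub>R\<^esub> s) g)"
proof (induction k)
  case 0
  have "(\<lambda>g. z g - r * \<one>\<^bsub>R\<^esub> g) \<in> carrier R" using z by (simp add: ga_linear_closed)
  then show ?case by (intro bexI[of _ "\<zero>\<^bsub>R\<^esub>"]) (simp_all add: R.r_null, simp add: ga_simps(2))
next
  case (Suc k)
  let ?w = "\<lambda>g. z g - r * \<one>\<^bsub>R\<^esub> g"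
  have w: "?w \<in> carrier R" using z by (simp add: ga_linear_closed)
  obtain s where s: "s \<in> carrier R" and eq: "z [^]\<^bsub>R\<^esub> k = (\<lambda>g. r ^ k * \<one>\<^bsub>R\<^esub> g + (?w \<otimes>\<^bsub>R\<^esub> s) g)"
    using Suc by blast
  have "z [^]\<^bsub>R\<^esub> Suc k = z \<otimes>\<^bsub>R\<^esub> z [^]\<^bsub>R\<^esub> k"
    using z by (simp add: R.m_comm)
  also have "\<dots> = (\<lambda>g. r ^ k * z g + (z \<otimes>\<^bsub>R\<^esub> (?w \<otimes>\<^bsub>R\<^esub> s)) g)"
    unfolding eq using z w s by (simp add: ga_mult_add ga_mult_smult ga_linear_closed)
  also have "z \<otimes>\<^bsub>R\<^esub> (?w \<otimes>\<^bsub>R\<^esub> s) = ?w \<otimes>\<^bsub>R\<^esub> (z \<otimes>\<^bsub>R\<^esub> s)"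
    using z w s by (simp add: R.m_lcomm)
  also have "(\<lambda>g. r ^ k * z g + (?w \<otimes>\<^bsub>R\<^esub> (z \<otimes>\<^bsub>R\<^esub> s)) g) =
      (\<lambda>g. r ^ Suc k * \<one>\<^bsub>R\<^esub> g + (?w \<otimes>\<^bsub>R\<^esub> (\<lambda>g. r ^ k * \<one>\<^bsub>R\<^esub> g + (z \<otimes>\<^bsub>R\<^esub> s) g)) g)"
    using z w s by (subst ga_mult_add) (simp_all add: ga_mult_smult ga_linear_closed fun_eq_iff algebra_simps)
  finally show ?case
    using z s by (intro bexI[of _ "\<lambda>g. r ^ k * \<one>\<^bsub>R\<^esub> g + (z \<otimes>\<^bsub>R\<^esub> s) g"]) (simp_all add: ga_linear_closed)
qed

text \<open>If the nonzero polynomial \<open>p\<close> annihilates \<open>z\<close>, then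
  \<open>z - r\<close> divides the scalar \<open>p(r)\<close>, so it is invertible unless
  \<open>r\<close> is one of the finitely many roots of \<open>p\<close>.\<close>

lemma finite_spectrum:
  assumes z: "z \<in> carrier R"
  shows "finite {r. (\<lambda>g. z g - r * \<one>\<^bsub>R\<^esub> g) \<notin> Units R}"
proof -
  obtain c n where c: "\<exists>k\<le>n. c k \<noteq> 0" and rel: "\<And>g. (\<Sum>k\<le>n. c k * (z [^]\<^bsub>R\<^esub> (k::nat)) g) = 0"
    using ga_integral[OF z] by blast
  define p where "p = (\<Sum>k\<le>n. monom (c k) k)"
  have "poly.coeff p k = c k" if "k \<le> n" for k
    using that by (simp add: p_def coeff_sum)
  then have "p \<noteq> 0" using c by auto
  moreover have "(\<lambda>g. z g - r * \<one>\<^bsub>R\<^esub> g) \<in> Units R" if r: "poly p r \<noteq> 0" for r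
  proof -
    let ?w = "\<lambda>g. z g - r * \<one>\<^bsub>R\<^esub> g"
    have w: "?w \<in> carrier R" using z by (simp add: ga_linear_closed)
    have "\<forall>k::nat. \<exists>s. s \<in> carrier R \<and>
        z [^]\<^bsub>R\<^esub> k = (\<lambda>g. r ^ k * \<one>\<^bsub>R\<^esub> g + (?w \<otimes>\<^bsub>R\<^esub> s) g)"
      by (intro allI ga_power_diff[OF z, unfolded Bex_def])
    from choice[OF this] obtain s where s: "\<And>k. s k \<in> carrier R"
      and eq: "\<And>k::nat. z [^]\<^bsub>R\<^esub> k = (\<lambda>g. r ^ k * \<one>\<^bsub>R\<^esub> g + (?w \<otimes>\<^bsub>R\<^esub> s k) g)"
      by blast
    \<comment> \<open>The quotient of the annihilating polynomial by \<open>z - r\<close> after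
      removal of its value at \<open>r\<close>: the product with \<open>z - r\<close> is the scalar
      \<open>- p(r)\<close>.\<close>
    define S where "S = (\<lambda>g. \<Sum>k\<le>n. c k * s k g)"
    have S: "S \<in> carrier R" using s by (simp add: S_def ga_linear_closed)
    have "(?w \<otimes>\<^bsub>R\<^esub> S) g = - poly p r * \<one>\<^bsub>R\<^esub> g" for g
    proof -
      have "0 = (\<Sum>k\<le>n. c k * (r ^ k * \<one>\<^bsub>R\<^esub> g + (?w \<otimes>\<^bsub>R\<^esub> s k) g))"
        using rel[of g] by (simp only: eq)
      also have "\<dots> = poly p r * \<one>\<^bsub>R\<^esub> g + (\<Sum>k\<le>n. c k * (?w \<otimes>\<^bsub>R\<^esub> s k) g)"
        by (simp add: p_def poly_sum poly_monom sum_distrib_right distrib_left sum.distrib mult.assoc)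
      also have "(\<Sum>k\<le>n. c k * (?w \<otimes>\<^bsub>R\<^esub> s k) g) = (?w \<otimes>\<^bsub>R\<^esub> S) g"
        unfolding S_def using w s by (subst ga_mult_sum) (simp_all add: ga_linear_closed ga_mult_smult)
      finally show ?thesis by (simp add: eq_neg_iff_add_eq_0 add.commute)
    qed
    then have "?w \<otimes>\<^bsub>R\<^esub> (\<lambda>g. - inverse (poly p r) * S g) = \<one>\<^bsub>R\<^esub>"
      using r by (simp only: ga_mult_smult[OF w S]) (simp add: fun_eq_iff)
    then show ?thesis using w S by (intro ga_UnitsI) (simp_all add: ga_carrier)
  qed
  ultimately show ?thesis
    by (intro finite_subset[OF _ poly_roots_finite[of p]]) auto
qed

end

section \<open>From linear combinations to natural multiples in characteristic 0\<close>

locale finite_comm_group_scheme_char_0 = finite_comm_group_scheme G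
  for G :: "('k::field_char_0, 'i::finite) hopf_data"
begin

text \<open>
  If \<open>u = a + x b\<close> is a unit and \<open>z = u\<inverse> b\<close>, then \<open>a + n b = u (1 + (n - x) z)\<close>, and \<open>z\<close> has only
  finitely many eigenvalues.
\<close>

lemma unit_on_line:
  assumes a: "a \<in> carrier R" and b: "b \<in> carrier R" and u: "(\<lambda>g. a g + x * b g) \<in> Units R"
  shows "\<exists>n::nat. (\<lambda>g. a g + of_nat n * b g) \<in> Units R"
proof -
  let ?u = "\<lambda>g. a g + x * b g"
  define z where "z = inv\<^bsub>R\<^esub> ?u \<otimes>\<^bsub>R\<^esub> b"
  have z: "z \<in> carrier R" using u b by (simp add: z_def)
  have uz: "?u \<otimes>\<^bsub>R\<^esub> z = b"
    using u b unfolding z_def by (subst R.m_assoc[symmetric]) (auto simp: R.Units_closed)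
  define B where "B = {r. (\<lambda>g. z g - r * \<one>\<^bsub>R\<^esub> g) \<notin> Units R}"
  \<comment> \<open>For \<open>n\<close> different from \<open>x\<close>, the element
    \<open>a + n b\<close> equals \<open>(n - x) u (z - q n)\<close>, so \<open>q n\<close> must
    avoid the eigenvalues of \<open>z\<close>. For \<open>n = x\<close> the convention
    \<open>inverse 0 = 0\<close> gives \<open>q n = 0\<close>, which is why 0 is excluded as
    well.\<close>
  define q where "q = (\<lambda>n::nat. - inverse (of_nat n - x))"
  \<comment> \<open>Characteristic 0 enters here: distinct natural numbers stay distinct in
    \<open>K^c\<close>, so only finitely many of them are excluded.\<close>
  have "inj q" by (auto simp: q_def inj_def)
  then have "finite (q -` (insert 0 B))"
    using finite_spectrum[OF z] by (intro finite_vimageI) (auto simp: B_def)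
  then have "q -` (insert 0 B) \<noteq> UNIV" by auto
  then obtain n where n: "q n \<noteq> 0" "q n \<notin> B" by auto
  define y where "y = of_nat n - x"
  have y: "y \<noteq> 0" "q n = - inverse y" using n by (auto simp: q_def y_def)
  let ?w = "\<lambda>g. z g - q n * \<one>\<^bsub>R\<^esub> g"
  let ?y = "\<lambda>g. y * \<one>\<^bsub>R\<^esub> g"
  have w: "?w \<in> Units R" using n by (simp add: B_def)
  have c: "?y \<in> carrier R" "?u \<in> carrier R" "?w \<in> carrier R"
    using u w by (auto intro: ga_linear_closed R.Units_closed)
  have "?y \<otimes>\<^bsub>R\<^esub> (\<lambda>g. inverse y * \<one>\<^bsub>R\<^esub> g) = \<one>\<^bsub>R\<^esub>"
    using y c by (simp add: ga_mult_smult ga_linear_closed fun_eq_iff)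
  then have yu: "?y \<in> Units R" using c by (intro ga_UnitsI) (auto intro: ga_linear_closed)
  have w': "?w = (\<lambda>g. z g + (inverse y) * \<one>\<^bsub>R\<^esub> g)"
    by (simp add: y)
  have "?u \<otimes>\<^bsub>R\<^esub> ?w = (\<lambda>g. b g + inverse y * ?u g)"
    unfolding w' using z c by (simp add: ga_mult_add ga_mult_smult ga_linear_closed uz)
  moreover have "(?u \<otimes>\<^bsub>R\<^esub> ?w) \<otimes>\<^bsub>R\<^esub> ?y = (\<lambda>g. y * (?u \<otimes>\<^bsub>R\<^esub> ?w) g)"
    using c by (simp add: ga_mult_smult)
  ultimately have "(?u \<otimes>\<^bsub>R\<^esub> ?w) \<otimes>\<^bsub>R\<^esub> ?y = (\<lambda>g. y * b g + ?u g)"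
    using y by (simp add: distrib_left mult.assoc[symmetric])
  also have "\<dots> = (\<lambda>g. a g + of_nat n * b g)"
    by (simp add: y_def algebra_simps)
  finally have "(?u \<otimes>\<^bsub>R\<^esub> ?w) \<otimes>\<^bsub>R\<^esub> ?y = (\<lambda>g. a g + of_nat n * b g)" .
  moreover have "(?u \<otimes>\<^bsub>R\<^esub> ?w) \<otimes>\<^bsub>R\<^esub> ?y \<in> Units R" using u w yu by blast
  ultimately show ?thesis by metis
qed

text \<open>The scalars of the combination are exchanged one at a time for natural numbers by
  \<open>unit_on_line\<close>; natural multiples and sums of elements of \<open>V\<close> remain in
  \<open>V\<close>.\<close>

lemma unit_in_additive_set:
  assumes V: "V \<subseteq> carrier R" "(\<lambda>_. 0) \<in> V" "\<And>v w. v \<in> V \<Longrightarrow> w \<in> V \<Longrightarrow> (\<lambda>g. v g + w g) \<in> V"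
    and ps: "\<And>c v. (c, v) \<in> set ps \<Longrightarrow> v \<in> V"
    and unit: "(\<lambda>g. \<Sum>p\<leftarrow>ps. fst p * snd p g) \<in> Units R"
  shows "\<exists>v\<in>V. v \<in> Units R"
proof -
  have mult: "(\<lambda>g. of_nat n * v g) \<in> V" if "v \<in> V" for n :: nat and v
  proof (induction n)
    case (Suc n)
    then show ?case using V(3)[OF that Suc] by (simp add: distrib_right)
  qed (use V in simp)
  \<comment> \<open>The offset \<open>a\<close> carries the terms whose coefficients have already
    been exchanged, so that the induction can run along the list.\<close>
  have "\<exists>v\<in>V. (\<lambda>g. a g + v g) \<in> Units R"
    if "a \<in> carrier R" "(\<lambda>g. a g + (\<Sum>p\<leftarrow>ps. fst p * snd p g)) \<in> Units R" for a
    using that ps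
  proof (induction ps arbitrary: a)
    case Nil
    then show ?case using V(2) by (intro bexI[of _ "\<lambda>_. 0"]) auto
  next
    case (Cons p ps)
    let ?W = "\<lambda>g. \<Sum>p\<leftarrow>ps. fst p * snd p g"
    have b: "snd p \<in> V" using Cons.prems(3)[of "fst p" "snd p"] by simp
    have "\<forall>v\<in>snd ` set ps. v \<in> carrier R" using Cons.prems(3) V(1) by force
    then have W: "?W \<in> carrier R" unfolding ga_carrier by (induction ps) auto
    have "(\<lambda>g. (a g + ?W g) + fst p * snd p g) \<in> Units R"
      using Cons.prems(2) by (simp add: ac_simps)
    then obtain n :: nat where "(\<lambda>g. (a g + ?W g) + of_nat n * snd p g) \<in> Units R"
      using unit_on_line[of "\<lambda>g. a g + ?W g" "snd p"] Cons.prems(1) W b V(1) ga_linear_closed(2) by blast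
    then have "(\<lambda>g. (a g + of_nat n * snd p g) + ?W g) \<in> Units R" by (simp add: ac_simps)
    moreover have "(\<lambda>g. a g + of_nat n * snd p g) \<in> carrier R"
      using Cons.prems(1) subsetD[OF V(1) b] by (simp add: ga_linear_closed)
    ultimately obtain v where v: "v \<in> V" "(\<lambda>g. (a g + of_nat n * snd p g) + v g) \<in> Units R"
      using Cons.IH[of "\<lambda>g. a g + of_nat n * snd p g"] Cons.prems(3) by auto
    then show ?case using V(3)[OF mult[OF b, of n] v(1)]
      by (intro bexI[of _ "\<lambda>g. of_nat n * snd p g + v g"]) (simp_all add: ac_simps)
  qed
  from this[of "\<lambda>_. 0"] unit show ?thesis by (simp add: ga_carrier)
qed

end

section \<open>Transversals\<close>

lemma coset_index:
  assumes "transversal L \<omega>" "\<sigma> \<in> Gal base_field"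
  shows "coset_index L \<omega> \<sigma> \<in> {1..extension_degree L}"
    and "\<exists>\<tau>\<in>Gal L. \<sigma> = \<omega> (coset_index L \<omega> \<sigma>) \<circ> \<tau>"
proof -
  have "\<exists>!i. i \<in> {1..extension_degree L} \<and> (\<exists>\<tau>\<in>Gal L. \<sigma> = \<omega> i \<circ> \<tau>)"
    using assms unfolding transversal_def by blast
  from theI'[OF this] show "coset_index L \<omega> \<sigma> \<in> {1..extension_degree L}"
    and "\<exists>\<tau>\<in>Gal L. \<sigma> = \<omega> (coset_index L \<omega> \<sigma>) \<circ> \<tau>"
    unfolding coset_index_def by blast+
qed

lemma transversal_Gal:
  "transversal L \<omega> \<Longrightarrow> i \<in> {1..extension_degree L} \<Longrightarrow> \<omega> i \<in> Gal base_field"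
  by (simp add: transversal_def)

lemma transversal_inj:
  assumes t: "transversal L \<omega>" and ij: "i \<in> {1..extension_degree L}" "j \<in> {1..extension_degree L}"
    and \<tau>: "\<tau> \<in> Gal L" "\<omega> i = \<omega> j \<circ> \<tau>"
  shows "i = j"
proof -
  have "\<exists>!k. k \<in> {1..extension_degree L} \<and> (\<exists>\<tau>\<in>Gal L. \<omega> i = \<omega> k \<circ> \<tau>)"
    using t ij(1) transversal_Gal[OF t ij(1)] unfolding transversal_def by blast
  moreover have "\<exists>\<tau>\<in>Gal L. \<omega> i = \<omega> i \<circ> \<tau>" using Gal_id by (metis comp_id)
  ultimately show ?thesis using ij \<tau> by blast
qed

text \<open>The family \<rho> meets pairwise different left cosets of \<open>Gal L\<close>. The two
  instances are a left translate of \<omega>, for the action on norms and traces, and a second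
  transversal, for independence of the choice.\<close>

locale transversal_family =
  fixes L :: "'k::field alg_closure set" and \<omega> \<rho> :: "nat \<Rightarrow> 'k alg_closure \<Rightarrow> 'k alg_closure"
  assumes base_subset: "base_field \<subseteq> L"
    and transversal: "transversal L \<omega>"
    and family_Gal: "j \<in> {1..extension_degree L} \<Longrightarrow> \<rho> j \<in> Gal base_field"
    and family_inj: "i \<in> {1..extension_degree L} \<Longrightarrow> j \<in> {1..extension_degree L} \<Longrightarrow>
      \<tau> \<in> Gal L \<Longrightarrow> \<rho> i = \<rho> j \<circ> \<tau> \<Longrightarrow> i = j"
begin

text \<open>With \<open>cofactor\<close>, this is the decomposition of \<rho>(j) as \<omega>(i)
  followed on the right by an element u(j) of \<open>Gal L\<close>. For a left translate of \<omega>
  these are the index and the argument in the transfer formula.\<close>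

definition "slot j = coset_index L \<omega> (\<rho> j)"
definition "cofactor j = inv_into UNIV (\<omega> (slot j)) \<circ> \<rho> j"

lemma slot_in: "j \<in> {1..extension_degree L} \<Longrightarrow> slot j \<in> {1..extension_degree L}"
  unfolding slot_def by (intro coset_index[OF transversal] family_Gal)

lemma transversal_slot_Gal: "j \<in> {1..extension_degree L} \<Longrightarrow> \<omega> (slot j) \<in> Gal base_field"
  by (intro transversal_Gal[OF transversal] slot_in)

lemma family_eq: "j \<in> {1..extension_degree L} \<Longrightarrow> \<rho> j = \<omega> (slot j) \<circ> cofactor j"
  using Gal_inv_right[OF transversal_slot_Gal] by (simp add: cofactor_def flip: comp_assoc)

lemma cofactor_Gal:
  assumes j: "j \<in> {1..extension_degree L}"
  shows "cofactor j \<in> Gal L"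
proof -
  obtain \<tau> where \<tau>: "\<tau> \<in> Gal L" "\<rho> j = \<omega> (slot j) \<circ> \<tau>"
    using coset_index(2)[OF transversal family_Gal[OF j]] unfolding slot_def by blast
  then have "cofactor j = \<tau>"
    using Gal_inv_left[OF transversal_slot_Gal[OF j]] by (simp add: cofactor_def flip: comp_assoc)
  then show ?thesis using \<tau> by simp
qed

text \<open>Families in the same coset differ by an element of \<open>Gal L\<close>, so
  \<open>slot\<close> is injective, and an injection of a finite set into itself is onto.\<close>

lemma slot_bij: "bij_betw slot {1..extension_degree L} {1..extension_degree L}"
proof -
  have "inj_on slot {1..extension_degree L}"
  proof (rule inj_onI)
    fix i j assume i: "i \<in> {1..extension_degree L}" and j: "j \<in> {1..extension_degree L}"
      and eq: "slot i = slot j"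
    have "\<rho> j \<circ> (inv_into UNIV (cofactor j) \<circ> cofactor i) =
        \<omega> (slot j) \<circ> (cofactor j \<circ> inv_into UNIV (cofactor j)) \<circ> cofactor i"
      by (subst family_eq[OF j]) (simp only: comp_assoc)
    also have "\<dots> = \<rho> i"
      by (simp add: Gal_inv_right[OF cofactor_Gal[OF j]] family_eq[OF i] eq)
    finally show "i = j"
      using family_inj[OF i j Gal_comp[OF Gal_inv[OF cofactor_Gal[OF j]] cofactor_Gal[OF i]]] by simp
  qed
  then show ?thesis
    by (intro bij_betw_imageI) (auto intro!: endo_inj_surj[THEN equalityD2, THEN subsetD] slot_in simp: slot_in[simplified])
qed

lemma Gal_L_subset: "Gal L \<subseteq> Gal base_field"
  using base_subset by (rule Gal_anti_mono)

end

lemma transversal_family_left_mult: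
  assumes L: "base_field \<subseteq> L" and t: "transversal L \<omega>" and s: "\<sigma> \<in> Gal base_field"
  shows "transversal_family L \<omega> (\<lambda>j. \<sigma> \<circ> \<omega> j)"
proof
  fix i j \<tau> assume ij: "i \<in> {1..extension_degree L}" "j \<in> {1..extension_degree L}"
    and \<tau>: "\<tau> \<in> Gal L" "\<sigma> \<circ> \<omega> i = \<sigma> \<circ> \<omega> j \<circ> \<tau>"
  have "inv_into UNIV \<sigma> \<circ> (\<sigma> \<circ> \<omega> i) = inv_into UNIV \<sigma> \<circ> (\<sigma> \<circ> (\<omega> j \<circ> \<tau>))"
    using \<tau>(2) by (simp add: comp_assoc)
  then have "\<omega> i = \<omega> j \<circ> \<tau>"
    unfolding comp_assoc[symmetric] Gal_inv_left[OF s] by simp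
  then show "i = j" using transversal_inj[OF t ij \<tau>(1)] by blast
qed (use assms in \<open>blast intro: Gal_comp transversal_Gal\<close>)+

lemma transversal_family_transversal:
  assumes L: "base_field \<subseteq> L" and "transversal L \<omega>" "transversal L \<omega>'"
  shows "transversal_family L \<omega> \<omega>'"
  by unfold_locales (use assms in \<open>auto intro: transversal_Gal transversal_inj\<close>)

section \<open>Hilbert 90\<close>

context finite_comm_group_scheme_char_0
begin

lemma Z1_simps:
  "f \<in> carrier (Z1 G M) \<longleftrightarrow> f \<in> Gal M \<rightarrow>\<^sub>E \<Gamma> \<and>
    continuous_map (krull_topology M) (discrete_topology \<Gamma>) f \<and>
    (\<forall>\<sigma>\<in>Gal M. \<forall>\<tau>\<in>Gal M. f (\<sigma> \<circ> \<tau>) = f \<sigma> \<otimes>\<^bsub>points G\<^esub> (\<sigma> \<circ> f \<tau>))"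
  "f \<otimes>\<^bsub>Z1 G M\<^esub> h = (\<lambda>\<sigma>\<in>Gal M. f \<sigma> \<otimes>\<^bsub>points G\<^esub> h \<sigma>)"
  by (simp_all add: Z1_def)

lemma cocycle_one:
  assumes "base_field \<subseteq> M" and f: "\<And>\<sigma>. \<sigma> \<in> Gal M \<Longrightarrow> f \<sigma> \<in> \<Gamma>"
    and cocycle: "\<And>\<sigma> \<tau>. \<sigma> \<in> Gal M \<Longrightarrow> \<tau> \<in> Gal M \<Longrightarrow> f (\<sigma> \<circ> \<tau>) = f \<sigma> \<otimes>\<^bsub>points G\<^esub> (\<sigma> \<circ> f \<tau>)"
  shows "f id = \<one>\<^bsub>points G\<^esub>"
proof -
  have "f id = f id \<otimes>\<^bsub>points G\<^esub> f id" using cocycle[OF Gal_id Gal_id] by simp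
  then show ?thesis using f[OF Gal_id] by (simp add: P.l_cancel_one')
qed

text \<open>Continuity is brought into algebraic form: the preimage of the neutral point is an open
  neighbourhood of the identity, so it contains the automorphisms fixing some finite set.\<close>

lemma Z1_finite_support:
  assumes M: "base_field \<subseteq> M" and f: "f \<in> carrier (Z1 G M)"
  shows "\<exists>E. finite E \<and> (\<forall>\<sigma>\<in>Gal M. (\<forall>e\<in>E. \<sigma> e = e) \<longrightarrow> f \<sigma> = \<one>\<^bsub>points G\<^esub>)"
proof -
  have one: "f id = \<one>\<^bsub>points G\<^esub>"
    using f unfolding Z1_simps by (intro cocycle_one[OF M]) (blast dest: PiE_mem)+
  let ?X = "product_topology (\<lambda>_. discrete_topology UNIV) UNIV ::
    ('k alg_closure \<Rightarrow> 'k alg_closure) topology"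
  have "openin (krull_topology M) {\<sigma> \<in> topspace (krull_topology M). f \<sigma> \<in> {\<one>\<^bsub>points G\<^esub>}}"
    using f unfolding Z1_simps by (intro openin_continuous_map_preimage[of _ "discrete_topology \<Gamma>"]) auto
  then obtain W where W: "openin ?X W"
    and eq: "{\<sigma> \<in> topspace (krull_topology M). f \<sigma> \<in> {\<one>\<^bsub>points G\<^esub>}} = W \<inter> Gal M"
    unfolding krull_topology_def openin_subtopology by blast
  have top: "topspace (krull_topology M) = Gal M"
    by (simp add: krull_topology_def)
  have "id \<in> W" using eq one Gal_id[of M] top by blast
  then obtain U where U: "finite {i \<in> UNIV. U i \<noteq> topspace (discrete_topology UNIV :: 'k alg_closure topology)}"
      "id \<in> Pi\<^sub>E UNIV U" "Pi\<^sub>E UNIV U \<subseteq> W"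
    using W unfolding openin_product_topology_alt by blast
  let ?E = "{i. U i \<noteq> UNIV}"
  have "f \<sigma> = \<one>\<^bsub>points G\<^esub>" if \<sigma>: "\<sigma> \<in> Gal M" "\<forall>e\<in>?E. \<sigma> e = e" for \<sigma>
  proof -
    \<comment> \<open>In each restricted coordinate \<sigma> agrees with the identity, which lies in
      the basic open set.\<close>
    have "\<sigma> i \<in> U i" for i
      using U(2) \<sigma>(2) by (cases "i \<in> ?E") (auto simp: PiE_iff)
    then have "\<sigma> \<in> W" using U(3) by (auto simp: PiE_iff)
    then show ?thesis using eq \<sigma>(1) top by blast
  qed
  then show ?thesis using U(1) by (intro exI[of _ ?E]) simp
qed

text \<open>
  Hilbert 90. Let \<open>T\<close> represent \<open>Gal M\<close> modulo agreement on \<open>E\<close>. The elements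
  \<open>\<alpha> c = \<Sum>\<^sub>t t(c) f(t)\<inverse>\<close>, for \<open>c\<close> in the field generated by \<open>E\<close>, satisfy the required equation, and
  a \<open>K\<^sup>c\<close>-linear combination of them is the unit \<open>f(t\<^sub>0)\<inverse>\<close>.
\<close>

lemma hilbert_90:
  assumes M: "base_field \<subseteq> M" and f: "\<And>\<sigma>. \<sigma> \<in> Gal M \<Longrightarrow> f \<sigma> \<in> \<Gamma>"
    and cocycle: "\<And>\<sigma> \<tau>. \<sigma> \<in> Gal M \<Longrightarrow> \<tau> \<in> Gal M \<Longrightarrow> f (\<sigma> \<circ> \<tau>) = f \<sigma> \<otimes>\<^bsub>points G\<^esub> (\<sigma> \<circ> f \<tau>)"
    and E: "finite E" "\<And>\<sigma>. \<sigma> \<in> Gal M \<Longrightarrow> \<forall>e\<in>E. \<sigma> e = e \<Longrightarrow> f \<sigma> = \<one>\<^bsub>points G\<^esub>"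
  shows "\<exists>\<alpha>\<in>Units R. \<forall>\<sigma>\<in>Gal M. galois_act \<sigma> \<alpha> = group_elt (f \<sigma>) \<otimes>\<^bsub>R\<^esub> \<alpha>"
proof -
  have MK: "\<sigma> \<in> Gal base_field" if "\<sigma> \<in> Gal M" for \<sigma>
    using that Gal_anti_mono[OF M] by blast
  \<comment> \<open>Write \<tau> as \<sigma> followed on the right by \<open>?u\<close>, which fixes
    \<open>E\<close>; the cocycle law then multiplies \<open>f \<sigma>\<close> by a neutral
    factor.\<close>
  have f_cong: "f \<sigma> = f \<tau>" if \<sigma>: "\<sigma> \<in> Gal M" and \<tau>: "\<tau> \<in> Gal M" and eq: "\<forall>e\<in>E. \<sigma> e = \<tau> e" for \<sigma> \<tau>
  proof -
    let ?u = "inv_into UNIV \<sigma> \<circ> \<tau>"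
    have u: "?u \<in> Gal M" using \<sigma> \<tau> by (intro Gal_comp Gal_inv)
    have "?u e = e" if "e \<in> E" for e
      using eq that Gal_inv_left[OF \<sigma>] by (metis comp_apply id_apply)
    then have "f ?u = \<one>\<^bsub>points G\<^esub>" using E(2) u by blast
    moreover have "\<tau> = \<sigma> \<circ> ?u" using Gal_inv_right[OF \<sigma>] by (simp flip: comp_assoc)
    ultimately have "f \<tau> = f \<sigma> \<otimes>\<^bsub>points G\<^esub> (\<sigma> \<circ> \<one>\<^bsub>points G\<^esub>)" using cocycle[OF \<sigma> u] by simp
    then show ?thesis using f[OF \<sigma>] by (simp add: Gal_points_one[OF MK[OF \<sigma>]])
  qed
  \<comment> \<open>The choice is made from a predicate that sees only the values on
    \<open>E\<close>, so automorphisms agreeing on \<open>E\<close> get literally the same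
    representative.\<close>
  define rep where "rep = (\<lambda>\<sigma>. SOME \<tau>. \<tau> \<in> Gal M \<and> (\<forall>e\<in>E. \<tau> e = \<sigma> e))"
  have rep: "rep \<sigma> \<in> Gal M" "\<And>e. e \<in> E \<Longrightarrow> rep \<sigma> e = \<sigma> e" if "\<sigma> \<in> Gal M" for \<sigma>
  proof -
    have "rep \<sigma> \<in> Gal M \<and> (\<forall>e\<in>E. rep \<sigma> e = \<sigma> e)"
      unfolding rep_def by (rule someI[of _ \<sigma>]) (use that in auto)
    then show "rep \<sigma> \<in> Gal M" "\<And>e. e \<in> E \<Longrightarrow> rep \<sigma> e = \<sigma> e" by auto
  qed
  have rep_cong: "rep \<sigma> = rep \<tau>" if "\<forall>e\<in>E. \<sigma> e = \<tau> e" for \<sigma> \<tau>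
  proof -
    have "(\<lambda>\<tau>'. \<tau>' \<in> Gal M \<and> (\<forall>e\<in>E. \<tau>' e = \<sigma> e)) = (\<lambda>\<tau>'. \<tau>' \<in> Gal M \<and> (\<forall>e\<in>E. \<tau>' e = \<tau> e))"
      using that by auto
    then show ?thesis unfolding rep_def by simp
  qed
  define T where "T = rep ` Gal M"
  have T: "T \<subseteq> Gal M" and rep_T: "\<And>t. t \<in> T \<Longrightarrow> rep t = t"
    using rep rep_cong unfolding T_def by blast+
  have finT: "finite T"
  proof -
    \<comment> \<open>There are finitely many restrictions to \<open>E\<close>, since each element
      of \<open>E\<close> has finitely many conjugates.\<close>
    have "(\<lambda>\<sigma>. restrict \<sigma> E) ` Gal M \<subseteq> (\<Pi>\<^sub>E e\<in>E. (\<lambda>\<sigma>. \<sigma> e) ` Gal base_field)"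
      using MK by auto
    then have "finite ((\<lambda>\<sigma>. restrict \<sigma> E) ` Gal M)"
      by (rule finite_subset) (use E(1) finite_Gal_orbit in \<open>auto intro: finite_PiE\<close>)
    moreover have "T = rep ` (\<lambda>\<sigma>. restrict \<sigma> E) ` Gal M"
      unfolding T_def image_image by (intro image_cong refl rep_cong) auto
    ultimately show ?thesis by simp
  qed
  \<comment> \<open>The elements on which an automorphism in \<open>Gal M\<close> is determined by
    its values on \<open>E\<close>. This set contains \<open>E\<close> and is closed under sums and
    products, so it stands in for the field generated by \<open>E\<close>.\<close>
  define F where "F = {c. \<forall>\<sigma>\<in>Gal M. \<forall>\<tau>\<in>Gal M. (\<forall>e\<in>E. \<sigma> e = \<tau> e) \<longrightarrow> \<sigma> c = \<tau> c}"
  have F_binop: "x * y \<in> F" "x + y \<in> F" if "x \<in> F" "y \<in> F" for x y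
  proof -
    have "\<sigma> (x * y) = \<tau> (x * y) \<and> \<sigma> (x + y) = \<tau> (x + y)"
      if \<sigma>: "\<sigma> \<in> Gal M" and \<tau>: "\<tau> \<in> Gal M" and eq: "\<forall>e\<in>E. \<sigma> e = \<tau> e" for \<sigma> \<tau>
    proof -
      have "\<sigma> x = \<tau> x" "\<sigma> y = \<tau> y"
        using \<sigma> \<tau> eq \<open>x \<in> F\<close> \<open>y \<in> F\<close> unfolding F_def by blast+
      then show ?thesis by (simp add: Gal_mult[OF \<sigma>] Gal_mult[OF \<tau>] Gal_add[OF \<sigma>] Gal_add[OF \<tau>])
    qed
    then show "x * y \<in> F" "x + y \<in> F" unfolding F_def by blast+
  qed
  have F: "1 \<in> F" "0 \<in> F" "E \<subseteq> F"
    unfolding F_def by (simp_all add: Gal_1[of _ M] Gal_0[of _ M] subset_iff)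
  define \<alpha> where "\<alpha> = (\<lambda>c g. \<Sum>t\<in>T. t c * group_elt (inv\<^bsub>points G\<^esub> f t) g)"
  have fT: "f t \<in> \<Gamma>" if "t \<in> T" for t using that T f by blast
  have \<alpha>_closed: "\<alpha> c \<in> carrier R" for c
    unfolding \<alpha>_def using fT by (intro ga_linear_closed) auto
  have act: "galois_act \<sigma> (\<alpha> c) = group_elt (f \<sigma>) \<otimes>\<^bsub>R\<^esub> \<alpha> c" if \<sigma>: "\<sigma> \<in> Gal M" and c: "c \<in> F" for \<sigma> c
  proof -
    \<comment> \<open>Left multiplication by \<sigma> need not preserve \<open>T\<close>; passing to
      representatives makes it a permutation, and neither evaluation at \<open>c\<close> nor
      \<open>f\<close> notices the change.\<close>
    define \<pi> where "\<pi> = (\<lambda>t. rep (\<sigma> \<circ> t))"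
    have \<sigma>t: "\<sigma> \<circ> t \<in> Gal M" if "t \<in> T" for t using that T \<sigma> by (auto intro: Gal_comp)
    have \<pi>: "bij_betw \<pi> T T"
    proof -
      have "inj_on \<pi> T"
      proof (rule inj_onI)
        fix t t' assume t: "t \<in> T" "t' \<in> T" "\<pi> t = \<pi> t'"
        have "\<sigma> (t e) = \<sigma> (t' e)" if "e \<in> E" for e
          using rep(2)[OF \<sigma>t[OF t(1)] that] rep(2)[OF \<sigma>t[OF t(2)] that] t(3) by (simp add: \<pi>_def)
        then have "\<forall>e\<in>E. t e = t' e" using bij_is_inj[OF Gal_bij[OF \<sigma>]] by (simp add: inj_eq)
        then show "t = t'" using rep_cong rep_T t by metis
      qed
      moreover have "\<pi> ` T \<subseteq> T" using \<sigma>t by (auto simp: \<pi>_def T_def)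
      ultimately show ?thesis using finT by (simp add: bij_betw_def endo_inj_surj)
    qed
    have "galois_act \<sigma> (\<alpha> c) = (\<lambda>g. \<Sum>t\<in>T. \<sigma> (t c) * group_elt (\<sigma> \<circ> inv\<^bsub>points G\<^esub> f t) g)"
      by (simp add: \<alpha>_def act_sum[OF MK[OF \<sigma>]] act_smult[OF MK[OF \<sigma>]] act_group_elt[OF MK[OF \<sigma>]])
    also have "\<dots> = (\<lambda>g. \<Sum>t\<in>T. \<pi> t c * (group_elt (f \<sigma>) \<otimes>\<^bsub>R\<^esub> group_elt (inv\<^bsub>points G\<^esub> f (\<pi> t))) g)"
    proof (intro ext sum.cong refl)
      fix g t assume t: "t \<in> T"
      have \<pi>t: "\<pi> t \<in> Gal M" "\<forall>e\<in>E. (\<sigma> \<circ> t) e = \<pi> t e" using rep[OF \<sigma>t[OF t]] by (auto simp: \<pi>_def)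
      have "(\<sigma> \<circ> t) c = \<pi> t c" using c \<pi>t \<sigma>t[OF t] unfolding F_def by blast
      \<comment> \<open>Solving the cocycle law for \<sigma> applied to \<open>f t\<close> and
        inverting gives the factor \<open>f \<sigma>\<close>, the same for all
        \<open>t\<close>.\<close>
      moreover have "\<sigma> \<circ> inv\<^bsub>points G\<^esub> f t = f \<sigma> \<otimes>\<^bsub>points G\<^esub> inv\<^bsub>points G\<^esub> f (\<pi> t)"
      proof -
        have "f (\<pi> t) = f \<sigma> \<otimes>\<^bsub>points G\<^esub> (\<sigma> \<circ> f t)"
          using f_cong[OF \<sigma>t[OF t] \<pi>t] cocycle[OF \<sigma> subsetD[OF T t]] by metis
        moreover have "\<sigma> \<circ> f t \<in> \<Gamma>" using fT[OF t] MK[OF \<sigma>] by (simp add: Gal_points_closed)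
        ultimately show ?thesis using f[OF \<sigma>] fT[OF t] MK[OF \<sigma>]
          by (simp add: Gal_points_inv P.inv_mult flip: P.m_assoc)
      qed
      ultimately show "\<sigma> (t c) * group_elt (\<sigma> \<circ> inv\<^bsub>points G\<^esub> f t) g =
          \<pi> t c * (group_elt (f \<sigma>) \<otimes>\<^bsub>R\<^esub> group_elt (inv\<^bsub>points G\<^esub> f (\<pi> t))) g"
        using f \<sigma> \<pi>t by (simp add: group_elt_mult)
    qed
    also have "\<dots> = (\<lambda>g. \<Sum>t\<in>T. t c * (group_elt (f \<sigma>) \<otimes>\<^bsub>R\<^esub> group_elt (inv\<^bsub>points G\<^esub> f t)) g)"
      by (rule ext, rule sum.reindex_bij_betw[OF \<pi>])
    also have "\<dots> = group_elt (f \<sigma>) \<otimes>\<^bsub>R\<^esub> \<alpha> c"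
      unfolding \<alpha>_def using f[OF \<sigma>] fT
      by (subst ga_mult_sum) (simp_all add: ga_linear_closed ga_mult_smult)
    finally show ?thesis .
  qed
  \<comment> \<open>Any element of \<open>T\<close> would serve; the representative of the identity
    is at hand.\<close>
  define t0 where "t0 = rep id"
  have t0: "t0 \<in> T" by (simp add: t0_def T_def Gal_id)
  have "\<exists>ps. set ps \<subseteq> UNIV \<times> F \<and> (\<forall>t\<in>T. (\<Sum>p\<leftarrow>ps. fst p * t (snd p)) = (if t = t0 then 1 else 0))"
  proof (rule indicator_combination)
    fix t assume t: "t \<in> T" "t \<noteq> t0"
    then have "\<not> (\<forall>e\<in>E. t e = t0 e)" using rep_cong rep_T t0 by metis
    then show "\<exists>x\<in>F. t x \<noteq> t0 x" using F(3) by blast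
  qed (use finT T t0 F F_binop in auto)
  then obtain ps where ps: "set ps \<subseteq> UNIV \<times> F"
    "\<forall>t\<in>T. (\<Sum>p\<leftarrow>ps. fst p * t (snd p)) = (if t = t0 then 1 else 0)"
    by blast
  have "\<exists>v\<in>\<alpha> ` F. v \<in> Units R"
  proof (rule unit_in_additive_set)
    show "\<alpha> ` F \<subseteq> carrier R" using \<alpha>_closed by blast
    have "\<alpha> 0 = (\<lambda>_. 0)"
      unfolding \<alpha>_def using T by (intro ext sum.neutral) (auto simp: Gal_0)
    then show "(\<lambda>_. 0) \<in> \<alpha> ` F" using F(2) by (metis imageI)
    fix v w assume "v \<in> \<alpha> ` F" "w \<in> \<alpha> ` F"
    then obtain c d where "c \<in> F" "d \<in> F" "v = \<alpha> c" "w = \<alpha> d" by blast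
    moreover have "(\<lambda>g. \<alpha> c g + \<alpha> d g) = \<alpha> (c + d)"
      unfolding \<alpha>_def sum.distrib[symmetric] using T
      by (intro ext sum.cong) (auto simp: Gal_add distrib_right subset_iff)
    ultimately show "(\<lambda>g. v g + w g) \<in> \<alpha> ` F" using F_binop(2) by auto
  next
    \<comment> \<open>Exchanging the two sums, the combination has
      \<open>(\<Sum>p\<leftarrow>ps. fst p * t (snd p))\<close> as the coefficient of the inverse of
      \<open>f t\<close>, so only the term of \<open>t0\<close> remains.\<close>
    let ?qs = "map (\<lambda>p. (fst p, \<alpha> (snd p))) ps"
    show "v \<in> \<alpha> ` F" if "(c, v) \<in> set ?qs" for c v
      using that ps(1) by auto
    have "(\<Sum>p\<leftarrow>?qs. fst p * snd p g) = group_elt (inv\<^bsub>points G\<^esub> f t0) g" for g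
    proof -
      have "(\<Sum>p\<leftarrow>?qs. fst p * snd p g) =
          (\<Sum>t\<in>T. (\<Sum>p\<leftarrow>ps. fst p * t (snd p)) * group_elt (inv\<^bsub>points G\<^esub> f t) g)"
        by (induction ps) (simp_all add: \<alpha>_def sum_distrib_left distrib_right sum.distrib mult.assoc)
      also have "\<dots> = (\<Sum>t\<in>T. if t = t0 then group_elt (inv\<^bsub>points G\<^esub> f t0) g else 0)"
        using ps(2) by (intro sum.cong) auto
      finally show ?thesis using finT t0 by simp
    qed
    then have "(\<lambda>g. \<Sum>p\<leftarrow>?qs. fst p * snd p g) = group_elt (inv\<^bsub>points G\<^esub> f t0)" by blast
    then show "(\<lambda>g. \<Sum>p\<leftarrow>?qs. fst p * snd p g) \<in> Units R"
      using fT[OF t0] by (simp only:) (simp add: group_elt_Units)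
  qed
  then show ?thesis using act by blast
qed

end

section \<open>Galois descent\<close>

lemma r_coset_eq_image: "H #>\<^bsub>G\<^esub> a = (\<lambda>h. h \<otimes>\<^bsub>G\<^esub> a) ` H"
  by (auto simp: r_coset_def)

context finite_comm_group_scheme_char_0
begin

text \<open>Invariance can be checked on norms and quotients directly, whereas membership in
  \<open>A_sub\<close> asks for an explicit linear combination.\<close>

definition fixed_ring :: "'k alg_closure set \<Rightarrow> (('i \<Rightarrow> 'k alg_closure) \<Rightarrow> 'k alg_closure) set" where
  "fixed_ring M = {a \<in> carrier R. \<forall>\<sigma>\<in>Gal M. galois_act \<sigma> a = a}"

lemma A_sub_subset_fixed_ring:
  assumes M: "base_field \<subseteq> M"
  shows "A_sub G M \<subseteq> fixed_ring M"
proof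
  fix v assume "v \<in> A_sub G M"
  then obtain n :: nat and c a where v: "v = (\<lambda>g. \<Sum>j<n. c j * a j g)"
    and c: "\<forall>j<n. c j \<in> M" and a: "\<forall>j<n. a j \<in> fixed_algebra G"
    unfolding A_sub_def by blast
  have "v \<in> carrier R"
    unfolding v using a by (intro ga_linear_closed) (auto simp: fixed_algebra_def)
  moreover have "galois_act \<sigma> v = v" if \<sigma>: "\<sigma> \<in> Gal M" for \<sigma>
  proof -
    have \<sigma>K: "\<sigma> \<in> Gal base_field" using \<sigma> Gal_anti_mono[OF M] by blast
    have "galois_act \<sigma> v = (\<lambda>g. \<Sum>j<n. \<sigma> (c j) * galois_act \<sigma> (a j) g)"
      unfolding v by (simp add: act_sum[OF \<sigma>K] act_smult[OF \<sigma>K])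
    also have "\<dots> = v"
      unfolding v using a c \<sigma>K Gal_fix[OF \<sigma>] by (intro ext sum.cong) (auto simp: fixed_algebra_def)
    finally show ?thesis .
  qed
  ultimately show "v \<in> fixed_ring M" by (simp add: fixed_ring_def)
qed

lemma A_sub_base_field: "A_sub G base_field = fixed_ring base_field"
proof
  show "fixed_ring base_field \<subseteq> A_sub G base_field"
  proof
    fix a assume "a \<in> fixed_ring base_field"
    then have "a \<in> fixed_algebra G" by (simp add: fixed_ring_def fixed_algebra_def)
    moreover have "(1 :: 'k alg_closure) \<in> base_field" by (metis rangeI to_ac_1)
    ultimately show "a \<in> A_sub G base_field"
      unfolding A_sub_def
      by (intro CollectI exI[of _ "1::nat"] exI[of _ "\<lambda>_. 1"] exI[of _ "\<lambda>_. a"]) auto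
  qed
qed (rule A_sub_subset_fixed_ring, simp)

text \<open>
  Galois descent. For \<open>v\<close> fixed by \<open>Gal L\<close>, the traces of the multiples \<open>x v\<close>, \<open>x \<in> L\<close>, are fixed by
  \<open>Gal K\<close>, and \<open>v\<close> is an \<open>L\<close>-linear combination of them.
\<close>

lemma A_sub_galois_extension:
  assumes L: "finite_galois_extension L" and t: "transversal L \<omega>"
  shows "A_sub G L = fixed_ring L"
proof
  note closed = galois_extension_closed[OF L]
  have base: "base_field \<subseteq> L" by (rule closed)
  then show "A_sub G L \<subseteq> fixed_ring L" by (rule A_sub_subset_fixed_ring)
  show "fixed_ring L \<subseteq> A_sub G L"
  proof
    fix v assume v: "v \<in> fixed_ring L"
    then have vc: "v \<in> carrier R" by (simp add: fixed_ring_def)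
    let ?I = "{1..extension_degree L}"
    \<comment> \<open>The index of the coset \<open>Gal L\<close> itself. Its representative lies in
      \<open>Gal L\<close> and so fixes \<open>v\<close>, although it need not be the
      identity.\<close>
    define i0 where "i0 = coset_index L \<omega> id"
    have i0: "i0 \<in> ?I" unfolding i0_def by (rule coset_index[OF t Gal_id])
    have i0_v: "galois_act (\<omega> i0) v = v"
    proof -
      obtain \<tau> where \<tau>: "\<tau> \<in> Gal L" "id = \<omega> i0 \<circ> \<tau>"
        using coset_index(2)[OF t Gal_id] unfolding i0_def by blast
      have "\<tau> \<in> Gal base_field" using \<tau>(1) Gal_anti_mono[OF base] by blast
      then have "galois_act (\<omega> i0) (galois_act \<tau> v) = galois_act (\<omega> i0 \<circ> \<tau>) v"
        by (intro act_comp transversal_Gal[OF t i0])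
      moreover have "galois_act \<tau> v = v" using v \<tau>(1) by (simp add: fixed_ring_def)
      ultimately show ?thesis by (simp add: act_id flip: \<tau>(2))
    qed
    have \<omega>: "\<omega> i \<in> Gal base_field" if "i \<in> ?I" for i using that by (rule transversal_Gal[OF t])
    have \<omega>_sep: "\<exists>x\<in>L. \<omega> i x \<noteq> \<omega> j x" if i: "i \<in> ?I" and j: "j \<in> ?I" and ij: "i \<noteq> j" for i j
    proof (rule ccontr)
      assume "\<not> ?thesis"
      then have eq: "\<forall>x\<in>L. \<omega> i x = \<omega> j x" by blast
      let ?u = "inv_into UNIV (\<omega> j) \<circ> \<omega> i"
      have "?u \<in> Gal base_field" by (intro Gal_comp Gal_inv \<omega> i j)
      moreover have "?u x = x" if "x \<in> L" for x
        using eq that Gal_inv_left[OF \<omega>[OF j]] by (metis comp_apply id_apply)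
      ultimately have "?u \<in> Gal L" unfolding Gal_iff by blast
      moreover have "\<omega> i = \<omega> j \<circ> ?u" using Gal_inv_right[OF \<omega>[OF j]] by (simp flip: comp_assoc)
      ultimately show False using transversal_inj[OF t i j] ij by blast
    qed
    have "\<exists>ps. set ps \<subseteq> L \<times> L \<and>
        (\<forall>s\<in>\<omega> ` ?I. (\<Sum>p\<leftarrow>ps. fst p * s (snd p)) = (if s = \<omega> i0 then 1 else 0))"
    proof (rule indicator_combination)
      show "x - y \<in> L" if "x \<in> L" "y \<in> L" for x y
        using closed(4)[OF that(1) closed(5)[OF that(2)]] by simp
      show "\<omega> ` ?I \<subseteq> Gal base_field" using \<omega> by blast
      \<comment> \<open>Normality keeps all values in \<open>L\<close>, so that the coefficients of
        the separating combination also lie in \<open>L\<close>.\<close>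
      show "s x \<in> L" if "s \<in> \<omega> ` ?I" "x \<in> L" for s x
        using that \<omega> galois_extension_stable[OF L] by blast
      show "\<exists>x\<in>L. s x \<noteq> \<omega> i0 x" if "s \<in> \<omega> ` ?I" "s \<noteq> \<omega> i0" for s
        using that \<omega>_sep i0 by blast
    qed (use i0 closed in auto)
    then obtain ps where ps: "set ps \<subseteq> L \<times> L"
      and sum: "\<And>i. i \<in> ?I \<Longrightarrow> (\<Sum>p\<leftarrow>ps. fst p * \<omega> i (snd p)) = (if \<omega> i = \<omega> i0 then 1 else 0)"
      by blast
    \<comment> \<open>By semilinearity this is the trace of \<open>x v\<close>, the sum of its
      images under the transversal.\<close>
    define a where "a = (\<lambda>x g. \<Sum>i\<in>?I. \<omega> i x * galois_act (\<omega> i) v g)"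
    have a_fixed: "a x \<in> fixed_algebra G" if x: "x \<in> L" for x
    proof -
      let ?xv = "\<lambda>g. x * v g"
      have a: "a x = (\<lambda>g. \<Sum>i\<in>?I. galois_act (\<omega> i) ?xv g)"
        unfolding a_def using \<omega> by (intro ext sum.cong) (simp_all add: act_smult)
      have xv: "galois_act \<tau> ?xv = ?xv" if \<tau>: "\<tau> \<in> Gal L" for \<tau>
      proof -
        have "\<tau> \<in> Gal base_field" using \<tau> Gal_anti_mono[OF base] by blast
        then show ?thesis using v \<tau> x by (simp add: act_smult fixed_ring_def Gal_fix[OF \<tau>])
      qed
      have "a x \<in> carrier R"
        unfolding a using vc \<omega> by (intro ga_linear_closed act_closed)
      moreover have "galois_act \<sigma> (a x) = a x" if \<sigma>: "\<sigma> \<in> Gal base_field" for \<sigma>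
      proof -
        interpret F: transversal_family L \<omega> "\<lambda>j. \<sigma> \<circ> \<omega> j"
          by (rule transversal_family_left_mult[OF base t \<sigma>])
        \<comment> \<open>The cofactor in \<open>Gal L\<close> fixes \<open>x v\<close>, so \<sigma>
          merely permutes the summands of the trace.\<close>
        have step: "galois_act \<sigma> (galois_act (\<omega> j) ?xv) = galois_act (\<omega> (F.slot j)) ?xv" if j: "j \<in> ?I" for j
        proof -
          have "galois_act \<sigma> (galois_act (\<omega> j) ?xv) = galois_act (\<omega> (F.slot j) \<circ> F.cofactor j) ?xv"
            unfolding act_comp[OF \<sigma> \<omega>[OF j]] using F.family_eq[OF j] by simp
          also have "\<dots> = galois_act (\<omega> (F.slot j)) (galois_act (F.cofactor j) ?xv)"
            using F.cofactor_Gal[OF j] F.Gal_L_subset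
            by (intro act_comp[symmetric] F.transversal_slot_Gal j) blast
          finally show ?thesis by (simp add: xv[OF F.cofactor_Gal[OF j]])
        qed
        have "galois_act \<sigma> (a x) = (\<lambda>g. \<Sum>j\<in>?I. galois_act \<sigma> (galois_act (\<omega> j) ?xv) g)"
          unfolding a by (rule act_sum[OF \<sigma>])
        also have "\<dots> = (\<lambda>g. \<Sum>j\<in>?I. galois_act (\<omega> (F.slot j)) ?xv g)"
          by (intro ext sum.cong refl) (simp add: step)
        also have "\<dots> = a x" unfolding a
          by (rule ext, rule sum.reindex_bij_betw[OF F.slot_bij])
        finally show ?thesis .
      qed
      ultimately show ?thesis by (simp add: fixed_algebra_def)
    qed
    \<comment> \<open>The separating combination of the traces annihilates every conjugate of
      \<open>v\<close> except the one at \<open>i0\<close>, which is \<open>v\<close>.\<close>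
    have "v g = (\<Sum>j<length ps. fst (ps ! j) * a (snd (ps ! j)) g)" for g
    proof -
      have "(\<Sum>j<length ps. fst (ps ! j) * a (snd (ps ! j)) g) = (\<Sum>p\<leftarrow>ps. fst p * a (snd p) g)"
        by (simp add: sum_list_sum_nth atLeast0LessThan)
      also have "\<dots> = (\<Sum>i\<in>?I. (\<Sum>p\<leftarrow>ps. fst p * \<omega> i (snd p)) * galois_act (\<omega> i) v g)"
        by (induction ps) (simp_all add: a_def sum_distrib_left distrib_right sum.distrib mult.assoc)
      also have "\<dots> = (\<Sum>i\<in>?I. if i = i0 then v g else 0)"
      proof (intro sum.cong refl)
        fix i assume i: "i \<in> ?I"
        have "\<omega> i = \<omega> i0 \<longleftrightarrow> i = i0" using \<omega>_sep[OF i i0] by metis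
        then show "(\<Sum>p\<leftarrow>ps. fst p * \<omega> i (snd p)) * galois_act (\<omega> i) v g = (if i = i0 then v g else 0)"
          by (simp add: sum[OF i] i0_v)
      qed
      finally show ?thesis using i0 by simp
    qed
    then have "v = (\<lambda>g. \<Sum>j<length ps. fst (ps ! j) * a (snd (ps ! j)) g)" by blast
    moreover have "fst (ps ! j) \<in> L \<and> snd (ps ! j) \<in> L" if "j < length ps" for j
      using subsetD[OF ps nth_mem[OF that]] by (simp add: mem_Times_iff)
    ultimately show "v \<in> A_sub G L"
      unfolding A_sub_def using a_fixed
      by (intro CollectI exI[of _ "length ps"] exI[of _ "\<lambda>j. fst (ps ! j)"] exI[of _ "\<lambda>j. a (snd (ps ! j))"]) blast
  qed
qed

text \<open>The inverse of an invariant unit is again invariant, so a unit of the group algebra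
  lying in the invariants is a unit of that subring.\<close>

lemma trivial_classes_eq:
  assumes M: "base_field \<subseteq> M" and A: "A_sub G M = fixed_ring M"
  shows "trivial_classes G M =
    {group_elt \<gamma> \<otimes>\<^bsub>R\<^esub> \<beta> | \<gamma> \<beta>. \<gamma> \<in> \<Gamma> \<and> \<beta> \<in> Units R \<and> \<beta> \<in> fixed_ring M}"
proof -
  have "Units (R\<lparr>carrier := A_sub G M\<rparr>) = Units R \<inter> fixed_ring M"
  proof (intro equalityI subsetI)
    fix \<beta> assume "\<beta> \<in> Units (R\<lparr>carrier := A_sub G M\<rparr>)"
    then show "\<beta> \<in> Units R \<inter> fixed_ring M"
      unfolding A by (auto simp: Units_def fixed_ring_def)
  next
    fix \<beta> assume \<beta>: "\<beta> \<in> Units R \<inter> fixed_ring M"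
    then have "inv\<^bsub>R\<^esub> \<beta> \<in> fixed_ring M"
      using Gal_anti_mono[OF M] by (auto simp: fixed_ring_def act_Units(2) subset_iff)
    then show "\<beta> \<in> Units (R\<lparr>carrier := A_sub G M\<rparr>)"
      unfolding A using \<beta> by (auto simp: Units_def[of "R\<lparr>carrier := fixed_ring M\<rparr>"] intro!: bexI[of _ "inv\<^bsub>R\<^esub> \<beta>"])
  qed
  then show ?thesis unfolding trivial_classes_def set_mult_def by auto
qed

lemma bold_H_mult: "a \<otimes>\<^bsub>bold_H G M\<^esub> b = a \<otimes>\<^bsub>R\<^esub> b"
  by (simp add: bold_H_def units_of_def)

text \<open>The trivial classes are closed under products and inverses, by commutativity, so
  multiplication by \<open>t\<close> permutes them.\<close>

lemma trivial_coset_eq: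
  assumes M: "base_field \<subseteq> M" and A: "A_sub G M = fixed_ring M"
    and t: "t \<in> trivial_classes G M" and \<alpha>: "\<alpha> \<in> carrier R"
  shows "trivial_classes G M #>\<^bsub>bold_H G M\<^esub> (t \<otimes>\<^bsub>R\<^esub> \<alpha>) = trivial_classes G M #>\<^bsub>bold_H G M\<^esub> \<alpha>"
proof -
  let ?T = "trivial_classes G M"
  note T = trivial_classes_eq[OF M A]
  have units: "s \<in> Units R" if "s \<in> ?T" for s
    using that group_elt_Units unfolding T by blast
  have fixed_mult: "\<beta> \<otimes>\<^bsub>R\<^esub> \<beta>' \<in> fixed_ring M" if "\<beta> \<in> fixed_ring M" "\<beta>' \<in> fixed_ring M" for \<beta> \<beta>'
    using that Gal_anti_mono[OF M] by (auto simp: fixed_ring_def act_mult subset_iff)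
  have mult: "s \<otimes>\<^bsub>R\<^esub> s' \<in> ?T" if ss: "s \<in> ?T" "s' \<in> ?T" for s s'
  proof -
    obtain \<gamma> \<beta> \<gamma>' \<beta>' where s: "s = group_elt \<gamma> \<otimes>\<^bsub>R\<^esub> \<beta>" "\<gamma> \<in> \<Gamma>" "\<beta> \<in> Units R" "\<beta> \<in> fixed_ring M"
      and s': "s' = group_elt \<gamma>' \<otimes>\<^bsub>R\<^esub> \<beta>'" "\<gamma>' \<in> \<Gamma>" "\<beta>' \<in> Units R" "\<beta>' \<in> fixed_ring M"
      using ss unfolding T by blast
    have "s \<otimes>\<^bsub>R\<^esub> s' = group_elt (\<gamma> \<otimes>\<^bsub>points G\<^esub> \<gamma>') \<otimes>\<^bsub>R\<^esub> (\<beta> \<otimes>\<^bsub>R\<^esub> \<beta>')"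
      using s s' by (simp add: group_elt_mult R.Units_closed R.m_ac)
    then show ?thesis unfolding T using s s' fixed_mult by blast
  qed
  have inv: "inv\<^bsub>R\<^esub> s \<in> ?T" if ss: "s \<in> ?T" for s
  proof -
    obtain \<gamma> \<beta> where s: "s = group_elt \<gamma> \<otimes>\<^bsub>R\<^esub> \<beta>" "\<gamma> \<in> \<Gamma>" "\<beta> \<in> Units R" "\<beta> \<in> fixed_ring M"
      using ss unfolding T by blast
    have "group_elt \<gamma> \<otimes>\<^bsub>R\<^esub> \<beta> \<otimes>\<^bsub>R\<^esub> (group_elt (inv\<^bsub>points G\<^esub> \<gamma>) \<otimes>\<^bsub>R\<^esub> inv\<^bsub>R\<^esub> \<beta>) =
        (group_elt \<gamma> \<otimes>\<^bsub>R\<^esub> group_elt (inv\<^bsub>points G\<^esub> \<gamma>)) \<otimes>\<^bsub>R\<^esub> (\<beta> \<otimes>\<^bsub>R\<^esub> inv\<^bsub>R\<^esub> \<beta>)"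
      using s by (simp add: R.Units_closed R.m_ac del: R.Units_r_inv)
    also have "\<dots> = \<one>\<^bsub>R\<^esub>" using s by (simp add: ga_simps(1) flip: group_elt_mult)
    finally have "inv\<^bsub>R\<^esub> s = group_elt (inv\<^bsub>points G\<^esub> \<gamma>) \<otimes>\<^bsub>R\<^esub> inv\<^bsub>R\<^esub> \<beta>"
      using s by (intro R.comm_inv_char) (auto simp: R.Units_closed)
    moreover have "inv\<^bsub>R\<^esub> \<beta> \<in> fixed_ring M"
      using s Gal_anti_mono[OF M] by (auto simp: fixed_ring_def act_Units(2) subset_iff)
    ultimately show ?thesis unfolding T using s by blast
  qed
  show ?thesis
    unfolding r_coset_eq_image bold_H_mult
  proof (intro equalityI subsetI)
    fix y assume "y \<in> (\<lambda>s. s \<otimes>\<^bsub>R\<^esub> (t \<otimes>\<^bsub>R\<^esub> \<alpha>)) ` ?T"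
    then obtain s where s: "s \<in> ?T" "y = s \<otimes>\<^bsub>R\<^esub> (t \<otimes>\<^bsub>R\<^esub> \<alpha>)" by blast
    then have "y = (s \<otimes>\<^bsub>R\<^esub> t) \<otimes>\<^bsub>R\<^esub> \<alpha>"
      using units t \<alpha> by (simp add: R.Units_closed R.m_assoc)
    then show "y \<in> (\<lambda>s. s \<otimes>\<^bsub>R\<^esub> \<alpha>) ` ?T" using mult s t by blast
  next
    fix y assume "y \<in> (\<lambda>s. s \<otimes>\<^bsub>R\<^esub> \<alpha>) ` ?T"
    then obtain s where s: "s \<in> ?T" "y = s \<otimes>\<^bsub>R\<^esub> \<alpha>" by blast
    have "(s \<otimes>\<^bsub>R\<^esub> inv\<^bsub>R\<^esub> t) \<otimes>\<^bsub>R\<^esub> (t \<otimes>\<^bsub>R\<^esub> \<alpha>) = s \<otimes>\<^bsub>R\<^esub> ((inv\<^bsub>R\<^esub> t \<otimes>\<^bsub>R\<^esub> t) \<otimes>\<^bsub>R\<^esub> \<alpha>)"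
      using units[OF s(1)] units[OF t] \<alpha> by (simp add: R.Units_closed R.m_assoc del: R.Units_l_inv)
    then have "y = (s \<otimes>\<^bsub>R\<^esub> inv\<^bsub>R\<^esub> t) \<otimes>\<^bsub>R\<^esub> (t \<otimes>\<^bsub>R\<^esub> \<alpha>)"
      using s units[OF t] \<alpha> by simp
    then show "y \<in> (\<lambda>s. s \<otimes>\<^bsub>R\<^esub> (t \<otimes>\<^bsub>R\<^esub> \<alpha>)) ` ?T"
      using mult[OF s(1) inv[OF t]] by blast
  qed
qed

section \<open>Norm and corestriction\<close>

lemma coboundary_coset:
  "h' \<in> B1 G M #>\<^bsub>Z1 G M\<^esub> h \<longleftrightarrow>
    (\<exists>\<gamma>\<in>\<Gamma>. h' = (\<lambda>\<sigma>\<in>Gal M. ((\<sigma> \<circ> \<gamma>) \<otimes>\<^bsub>points G\<^esub> inv\<^bsub>points G\<^esub> \<gamma>) \<otimes>\<^bsub>points G\<^esub> h \<sigma>))"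
proof -
  have "(\<lambda>\<sigma>\<in>Gal M. (\<lambda>\<sigma>\<in>Gal M. (\<sigma> \<circ> \<gamma>) \<otimes>\<^bsub>points G\<^esub> inv\<^bsub>points G\<^esub> \<gamma>) \<sigma> \<otimes>\<^bsub>points G\<^esub> h \<sigma>) =
      (\<lambda>\<sigma>\<in>Gal M. ((\<sigma> \<circ> \<gamma>) \<otimes>\<^bsub>points G\<^esub> inv\<^bsub>points G\<^esub> \<gamma>) \<otimes>\<^bsub>points G\<^esub> h \<sigma>)" for \<gamma>
    by (rule restrict_ext) simp
  then show ?thesis unfolding r_coset_eq_image Z1_simps B1_def image_image by (simp add: image_iff)
qed

lemma coboundary_coset_self:
  assumes M: "base_field \<subseteq> M" and h: "h \<in> Gal M \<rightarrow>\<^sub>E \<Gamma>"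
  shows "h \<in> B1 G M #>\<^bsub>Z1 G M\<^esub> h"
proof -
  have "h = (\<lambda>\<sigma>\<in>Gal M. ((\<sigma> \<circ> \<one>\<^bsub>points G\<^esub>) \<otimes>\<^bsub>points G\<^esub> inv\<^bsub>points G\<^esub> \<one>\<^bsub>points G\<^esub>) \<otimes>\<^bsub>points G\<^esub> h \<sigma>)"
  proof
    fix \<sigma>
    show "h \<sigma> = (\<lambda>\<sigma>\<in>Gal M. ((\<sigma> \<circ> \<one>\<^bsub>points G\<^esub>) \<otimes>\<^bsub>points G\<^esub> inv\<^bsub>points G\<^esub> \<one>\<^bsub>points G\<^esub>) \<otimes>\<^bsub>points G\<^esub> h \<sigma>) \<sigma>"
    proof (cases "\<sigma> \<in> Gal M")
      case True
      then have "\<sigma> \<in> Gal base_field" using Gal_anti_mono[OF M] by blast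
      then show ?thesis using True PiE_mem[OF h True] by (simp add: Gal_points_one)
    qed (use PiE_arb[OF h] in simp)
  qed
  then show ?thesis unfolding coboundary_coset by (intro bexI[of _ "\<one>\<^bsub>points G\<^esub>"]) auto
qed

text \<open>Since \<Gamma> is commutative, sending a point to its coboundary is a
  homomorphism.\<close>

lemma coboundary_mult:
  assumes "\<sigma> \<in> Gal base_field" "\<gamma> \<in> \<Gamma>" "\<delta> \<in> \<Gamma>" "z \<in> \<Gamma>"
  shows "((\<sigma> \<circ> \<gamma>) \<otimes>\<^bsub>points G\<^esub> inv\<^bsub>points G\<^esub> \<gamma>) \<otimes>\<^bsub>points G\<^esub>
      (((\<sigma> \<circ> \<delta>) \<otimes>\<^bsub>points G\<^esub> inv\<^bsub>points G\<^esub> \<delta>) \<otimes>\<^bsub>points G\<^esub> z) =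
    ((\<sigma> \<circ> (\<gamma> \<otimes>\<^bsub>points G\<^esub> \<delta>)) \<otimes>\<^bsub>points G\<^esub> inv\<^bsub>points G\<^esub> (\<gamma> \<otimes>\<^bsub>points G\<^esub> \<delta>)) \<otimes>\<^bsub>points G\<^esub> z"
  using assms Gal_points_closed[OF assms(1)]
  by (simp add: Gal_points_mult P.inv_mult P.m_ac)

lemma coboundary_coset_eq:
  assumes M: "base_field \<subseteq> M" and h: "\<And>\<sigma>. \<sigma> \<in> Gal M \<Longrightarrow> h \<sigma> \<in> \<Gamma>"
    and h': "h' \<in> B1 G M #>\<^bsub>Z1 G M\<^esub> h"
  shows "B1 G M #>\<^bsub>Z1 G M\<^esub> h' = B1 G M #>\<^bsub>Z1 G M\<^esub> h"
proof -
  have MK: "\<sigma> \<in> Gal base_field" if "\<sigma> \<in> Gal M" for \<sigma>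
    using that Gal_anti_mono[OF M] by blast
  let ?b = "\<lambda>\<gamma> \<sigma>. (\<sigma> \<circ> \<gamma>) \<otimes>\<^bsub>points G\<^esub> inv\<^bsub>points G\<^esub> \<gamma>"
  obtain \<delta> where \<delta>: "\<delta> \<in> \<Gamma>" and h'_eq: "h' = (\<lambda>\<sigma>\<in>Gal M. ?b \<delta> \<sigma> \<otimes>\<^bsub>points G\<^esub> h \<sigma>)"
    using h' unfolding coboundary_coset by blast
  have shift: "(\<lambda>\<sigma>\<in>Gal M. ?b \<gamma> \<sigma> \<otimes>\<^bsub>points G\<^esub> h' \<sigma>) =
      (\<lambda>\<sigma>\<in>Gal M. ?b (\<gamma> \<otimes>\<^bsub>points G\<^esub> \<delta>) \<sigma> \<otimes>\<^bsub>points G\<^esub> h \<sigma>)" if \<gamma>: "\<gamma> \<in> \<Gamma>" for \<gamma>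
    by (rule restrict_ext) (simp add: h'_eq coboundary_mult[OF MK \<gamma> \<delta> h])
  show ?thesis
  proof (intro equalityI subsetI)
    fix k assume "k \<in> B1 G M #>\<^bsub>Z1 G M\<^esub> h'"
    then obtain \<gamma> where \<gamma>: "\<gamma> \<in> \<Gamma>" "k = (\<lambda>\<sigma>\<in>Gal M. ?b \<gamma> \<sigma> \<otimes>\<^bsub>points G\<^esub> h' \<sigma>)"
      unfolding coboundary_coset by blast
    then show "k \<in> B1 G M #>\<^bsub>Z1 G M\<^esub> h"
      unfolding coboundary_coset using shift \<delta> by (intro bexI[of _ "\<gamma> \<otimes>\<^bsub>points G\<^esub> \<delta>"]) simp_all
  next
    fix k assume "k \<in> B1 G M #>\<^bsub>Z1 G M\<^esub> h"
    then obtain \<gamma> where \<gamma>: "\<gamma> \<in> \<Gamma>" "k = (\<lambda>\<sigma>\<in>Gal M. ?b \<gamma> \<sigma> \<otimes>\<^bsub>points G\<^esub> h \<sigma>)"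
      unfolding coboundary_coset by blast
    \<comment> \<open>The shift by \<delta> that leads from \<open>h\<close> to \<open>h'\<close>
      has to be undone.\<close>
    let ?\<gamma> = "\<gamma> \<otimes>\<^bsub>points G\<^esub> inv\<^bsub>points G\<^esub> \<delta>"
    have "?\<gamma> \<in> \<Gamma>" "?\<gamma> \<otimes>\<^bsub>points G\<^esub> \<delta> = \<gamma>" using \<gamma> \<delta> by (simp_all add: P.m_assoc)
    then show "k \<in> B1 G M #>\<^bsub>Z1 G M\<^esub> h'"
      unfolding coboundary_coset using shift[of ?\<gamma>] \<gamma>(2) by (intro bexI[of _ ?\<gamma>]) simp_all
  qed
qed

text \<open>The condition of \<open>Upsilon\<close> multiplied through by \<alpha>, which avoids
  inverses. Only the values of \<open>f\<close> on \<open>Gal M\<close> are constrained.\<close>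

definition has_cocycle :: "'k alg_closure set \<Rightarrow>
    (('i \<Rightarrow> 'k alg_closure) \<Rightarrow> 'k alg_closure) \<Rightarrow>
    (('k alg_closure \<Rightarrow> 'k alg_closure) \<Rightarrow> 'i \<Rightarrow> 'k alg_closure) \<Rightarrow> bool" where
  "has_cocycle M \<alpha> f \<longleftrightarrow> \<alpha> \<in> Units R \<and>
    (\<forall>\<sigma>\<in>Gal M. f \<sigma> \<in> \<Gamma> \<and> galois_act \<sigma> \<alpha> = group_elt (f \<sigma>) \<otimes>\<^bsub>R\<^esub> \<alpha>)"

lemma has_cocycleD:
  assumes "has_cocycle M \<alpha> f"
  shows "\<alpha> \<in> Units R" "\<alpha> \<in> carrier R" "\<And>\<sigma>. \<sigma> \<in> Gal M \<Longrightarrow> f \<sigma> \<in> \<Gamma>"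
    "\<And>\<sigma>. \<sigma> \<in> Gal M \<Longrightarrow> galois_act \<sigma> \<alpha> = group_elt (f \<sigma>) \<otimes>\<^bsub>R\<^esub> \<alpha>"
  using assms by (auto simp: has_cocycle_def R.Units_closed)

lemma Units_mult_eq_iff:
  assumes "\<alpha> \<in> Units R" "a \<in> carrier R" "b \<in> carrier R"
  shows "a = b \<otimes>\<^bsub>R\<^esub> inv\<^bsub>R\<^esub> \<alpha> \<longleftrightarrow> a \<otimes>\<^bsub>R\<^esub> \<alpha> = b"
proof
  assume "a = b \<otimes>\<^bsub>R\<^esub> inv\<^bsub>R\<^esub> \<alpha>"
  then show "a \<otimes>\<^bsub>R\<^esub> \<alpha> = b" using assms by (simp add: R.Units_closed R.m_assoc)
next
  assume "a \<otimes>\<^bsub>R\<^esub> \<alpha> = b"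
  then show "a = b \<otimes>\<^bsub>R\<^esub> inv\<^bsub>R\<^esub> \<alpha>" using assms by (auto simp: R.Units_closed R.m_assoc)
qed

text \<open>Membership in \<open>bold_H\<close> yields some point for each \<sigma>; injectivity of
  \<open>group_elt\<close> identifies it with \<open>f \<sigma>\<close>, which therefore lies in
  \<Gamma>.\<close>

lemma bold_H_cocycle_iff:
  assumes M: "base_field \<subseteq> M"
  shows "\<alpha> \<in> carrier (bold_H G M) \<and>
      (\<forall>\<sigma>\<in>Gal M. group_elt (f \<sigma>) = galois_act \<sigma> \<alpha> \<otimes>\<^bsub>R\<^esub> inv\<^bsub>R\<^esub> \<alpha>) \<longleftrightarrow> has_cocycle M \<alpha> f"
proof -
  have MK: "\<sigma> \<in> Gal base_field" if "\<sigma> \<in> Gal M" for \<sigma>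
    using that Gal_anti_mono[OF M] by blast
  have carrier: "\<alpha> \<in> carrier (bold_H G M) \<longleftrightarrow> \<alpha> \<in> Units R \<and>
      (\<forall>\<sigma>\<in>Gal M. galois_act \<sigma> \<alpha> \<otimes>\<^bsub>R\<^esub> inv\<^bsub>R\<^esub> \<alpha> \<in> group_elt ` \<Gamma>)"
    by (simp add: bold_H_def)
  have "group_elt (f \<sigma>) = galois_act \<sigma> \<alpha> \<otimes>\<^bsub>R\<^esub> inv\<^bsub>R\<^esub> \<alpha> \<longleftrightarrow>
      galois_act \<sigma> \<alpha> = group_elt (f \<sigma>) \<otimes>\<^bsub>R\<^esub> \<alpha>"
    if "\<alpha> \<in> Units R" "\<sigma> \<in> Gal M" "f \<sigma> \<in> \<Gamma>" for \<sigma>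
    using Units_mult_eq_iff[OF that(1), of "group_elt (f \<sigma>)" "galois_act \<sigma> \<alpha>"] that
    by (auto simp: act_closed[OF MK] R.Units_closed)
  moreover have "f \<sigma> \<in> \<Gamma>"
    if "group_elt (f \<sigma>) = galois_act \<sigma> \<alpha> \<otimes>\<^bsub>R\<^esub> inv\<^bsub>R\<^esub> \<alpha>"
      "galois_act \<sigma> \<alpha> \<otimes>\<^bsub>R\<^esub> inv\<^bsub>R\<^esub> \<alpha> \<in> group_elt ` \<Gamma>" for \<sigma>
    using that by (metis group_elt_eq_iff imageE)
  ultimately show ?thesis unfolding carrier has_cocycle_def by (metis imageI)
qed

text \<open>Multiplying the unit by a point changes its cocycle by the coboundary of that point, so
  every representative of a class is realised once one is.\<close>

lemma has_cocycle_shift: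
  assumes M: "base_field \<subseteq> M" and \<alpha>: "has_cocycle M \<alpha> f" and \<gamma>: "\<gamma> \<in> \<Gamma>"
    and f': "\<And>\<sigma>. \<sigma> \<in> Gal M \<Longrightarrow> f' \<sigma> = ((\<sigma> \<circ> \<gamma>) \<otimes>\<^bsub>points G\<^esub> inv\<^bsub>points G\<^esub> \<gamma>) \<otimes>\<^bsub>points G\<^esub> f \<sigma>"
  shows "has_cocycle M (group_elt \<gamma> \<otimes>\<^bsub>R\<^esub> \<alpha>) f'"
  unfolding has_cocycle_def
proof (intro conjI ballI)
  note D = has_cocycleD[OF \<alpha>]
  show "group_elt \<gamma> \<otimes>\<^bsub>R\<^esub> \<alpha> \<in> Units R" using \<gamma> D(1) group_elt_Units by blast
  fix \<sigma> assume \<sigma>: "\<sigma> \<in> Gal M"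
  have \<sigma>K: "\<sigma> \<in> Gal base_field" using \<sigma> Gal_anti_mono[OF M] by blast
  have \<sigma>\<gamma>: "\<sigma> \<circ> \<gamma> \<in> \<Gamma>" by (rule Gal_points_closed[OF \<sigma>K \<gamma>])
  show f'\<sigma>: "f' \<sigma> \<in> \<Gamma>" using f'[OF \<sigma>] \<sigma>\<gamma> \<gamma> D(3)[OF \<sigma>] by simp
  have "f' \<sigma> \<otimes>\<^bsub>points G\<^esub> \<gamma> = (\<sigma> \<circ> \<gamma>) \<otimes>\<^bsub>points G\<^esub> f \<sigma> \<otimes>\<^bsub>points G\<^esub> (inv\<^bsub>points G\<^esub> \<gamma> \<otimes>\<^bsub>points G\<^esub> \<gamma>)"
    unfolding f'[OF \<sigma>] using \<sigma>\<gamma> \<gamma> D(3)[OF \<sigma>]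
    by (simp add: P.m_ac del: P.l_inv P.r_inv P.Units_l_inv P.Units_r_inv)
  then have eq: "f' \<sigma> \<otimes>\<^bsub>points G\<^esub> \<gamma> = (\<sigma> \<circ> \<gamma>) \<otimes>\<^bsub>points G\<^esub> f \<sigma>"
    using \<sigma>\<gamma> \<gamma> D(3)[OF \<sigma>] by simp
  have "galois_act \<sigma> (group_elt \<gamma> \<otimes>\<^bsub>R\<^esub> \<alpha>) = group_elt (\<sigma> \<circ> \<gamma>) \<otimes>\<^bsub>R\<^esub> (group_elt (f \<sigma>) \<otimes>\<^bsub>R\<^esub> \<alpha>)"
    using \<gamma> D(2) by (simp add: act_mult[OF \<sigma>K] act_group_elt[OF \<sigma>K] D(4)[OF \<sigma>])
  also have "\<dots> = group_elt ((\<sigma> \<circ> \<gamma>) \<otimes>\<^bsub>points G\<^esub> f \<sigma>) \<otimes>\<^bsub>R\<^esub> \<alpha>"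
    using \<sigma>\<gamma> D(2) D(3)[OF \<sigma>] by (simp add: group_elt_mult R.m_assoc)
  also have "\<dots> = group_elt (f' \<sigma>) \<otimes>\<^bsub>R\<^esub> (group_elt \<gamma> \<otimes>\<^bsub>R\<^esub> \<alpha>)"
    unfolding eq[symmetric] using f'\<sigma> \<gamma> D(2) by (simp add: group_elt_mult R.m_assoc)
  finally show "galois_act \<sigma> (group_elt \<gamma> \<otimes>\<^bsub>R\<^esub> \<alpha>) = group_elt (f' \<sigma>) \<otimes>\<^bsub>R\<^esub> (group_elt \<gamma> \<otimes>\<^bsub>R\<^esub> \<alpha>)" .
qed

text \<open>In the quotient of the two units the common factor \<open>f \<sigma>\<close> cancels,
  which leaves an invariant unit.\<close>

lemma same_cocycle:
  assumes M: "base_field \<subseteq> M" and \<alpha>: "has_cocycle M \<alpha> f" and \<alpha>': "has_cocycle M \<alpha>' f"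
  shows "\<exists>\<beta>. \<beta> \<in> Units R \<and> \<beta> \<in> fixed_ring M \<and> \<alpha>' = \<beta> \<otimes>\<^bsub>R\<^esub> \<alpha>"
proof (intro exI conjI)
  note D = has_cocycleD[OF \<alpha>] and D' = has_cocycleD[OF \<alpha>']
  let ?\<beta> = "\<alpha>' \<otimes>\<^bsub>R\<^esub> inv\<^bsub>R\<^esub> \<alpha>"
  show \<beta>: "?\<beta> \<in> Units R" using D(1) D'(1) by blast
  then have \<beta>c: "?\<beta> \<in> carrier R" by (rule R.Units_closed)
  show eq: "\<alpha>' = ?\<beta> \<otimes>\<^bsub>R\<^esub> \<alpha>" using D(1) D'(2) by (simp add: R.Units_closed R.m_assoc)
  have "galois_act \<sigma> ?\<beta> = ?\<beta>" if \<sigma>: "\<sigma> \<in> Gal M" for \<sigma>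
  proof -
    have \<sigma>K: "\<sigma> \<in> Gal base_field" using \<sigma> Gal_anti_mono[OF M] by blast
    let ?x = "group_elt (f \<sigma>) \<otimes>\<^bsub>R\<^esub> \<alpha>"
    have x: "?x \<in> Units R" using D(1) D(3)[OF \<sigma>] group_elt_Units by blast
    have "?x \<otimes>\<^bsub>R\<^esub> galois_act \<sigma> ?\<beta> = galois_act \<sigma> (?\<beta> \<otimes>\<^bsub>R\<^esub> \<alpha>)"
      unfolding act_mult[OF \<sigma>K \<beta>c D(2)] D(4)[OF \<sigma>, symmetric]
      by (intro R.m_comm act_closed \<sigma>K \<beta>c D(2))
    also have "\<dots> = group_elt (f \<sigma>) \<otimes>\<^bsub>R\<^esub> (?\<beta> \<otimes>\<^bsub>R\<^esub> \<alpha>)"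
      using D'(4)[OF \<sigma>] by (simp only: eq[symmetric])
    also have "\<dots> = ?x \<otimes>\<^bsub>R\<^esub> ?\<beta>"
      using R.m_ac group_elt_closed[OF D(3)[OF \<sigma>]] \<beta>c D(2) by metis
    finally show ?thesis
      using R.Units_l_cancel[OF x act_closed[OF \<sigma>K \<beta>c] \<beta>c] by blast
  qed
  then show "?\<beta> \<in> fixed_ring M" using \<beta>c by (simp add: fixed_ring_def)
qed

text \<open>A competing unit for another representative is compared with \<alpha> in two moves: a
  point absorbs the coboundary, then an invariant unit accounts for the equal cocycles. Their
  product is a trivial class.\<close>

lemma Upsilon_eq:
  assumes M: "base_field \<subseteq> M" and A: "A_sub G M = fixed_ring M"
    and \<alpha>: "has_cocycle M \<alpha> f" and f: "f \<in> extensional (Gal M)"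
  shows "Upsilon G M (B1 G M #>\<^bsub>Z1 G M\<^esub> f) = trivial_classes G M #>\<^bsub>bold_H G M\<^esub> \<alpha>"
  unfolding Upsilon_def
proof (rule the_equality)
  have "f \<in> B1 G M #>\<^bsub>Z1 G M\<^esub> f"
    using has_cocycleD(3)[OF \<alpha>] f by (intro coboundary_coset_self[OF M]) (simp add: PiE_iff)
  then show "\<exists>\<alpha>'\<in>carrier (bold_H G M). \<exists>f'\<in>B1 G M #>\<^bsub>Z1 G M\<^esub> f.
      (\<forall>\<omega>\<in>Gal M. group_elt (f' \<omega>) = galois_act \<omega> \<alpha>' \<otimes>\<^bsub>R\<^esub> inv\<^bsub>R\<^esub> \<alpha>') \<and>
      trivial_classes G M #>\<^bsub>bold_H G M\<^esub> \<alpha> = trivial_classes G M #>\<^bsub>bold_H G M\<^esub> \<alpha>'"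
    using \<alpha>[folded bold_H_cocycle_iff[OF M]] by blast
next
  fix h assume "\<exists>\<alpha>'\<in>carrier (bold_H G M). \<exists>f'\<in>B1 G M #>\<^bsub>Z1 G M\<^esub> f.
      (\<forall>\<omega>\<in>Gal M. group_elt (f' \<omega>) = galois_act \<omega> \<alpha>' \<otimes>\<^bsub>R\<^esub> inv\<^bsub>R\<^esub> \<alpha>') \<and>
      h = trivial_classes G M #>\<^bsub>bold_H G M\<^esub> \<alpha>'"
  then obtain \<alpha>' f' where f': "f' \<in> B1 G M #>\<^bsub>Z1 G M\<^esub> f" and \<alpha>': "has_cocycle M \<alpha>' f'"
    and h: "h = trivial_classes G M #>\<^bsub>bold_H G M\<^esub> \<alpha>'"
    using bold_H_cocycle_iff[OF M] by blast
  obtain \<gamma> where \<gamma>: "\<gamma> \<in> \<Gamma>"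
    and f'_eq: "f' = (\<lambda>\<sigma>\<in>Gal M. ((\<sigma> \<circ> \<gamma>) \<otimes>\<^bsub>points G\<^esub> inv\<^bsub>points G\<^esub> \<gamma>) \<otimes>\<^bsub>points G\<^esub> f \<sigma>)"
    using f' unfolding coboundary_coset by blast
  have "has_cocycle M (group_elt \<gamma> \<otimes>\<^bsub>R\<^esub> \<alpha>) f'"
    by (rule has_cocycle_shift[OF M \<alpha> \<gamma>]) (simp add: f'_eq)
  from same_cocycle[OF M this \<alpha>'] obtain \<beta> where \<beta>: "\<beta> \<in> Units R" "\<beta> \<in> fixed_ring M"
    and eq: "\<alpha>' = \<beta> \<otimes>\<^bsub>R\<^esub> (group_elt \<gamma> \<otimes>\<^bsub>R\<^esub> \<alpha>)" by blast
  have "\<alpha>' = (group_elt \<gamma> \<otimes>\<^bsub>R\<^esub> \<beta>) \<otimes>\<^bsub>R\<^esub> \<alpha>"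
    using eq \<beta>(1) \<gamma> has_cocycleD(2)[OF \<alpha>] by (simp add: R.Units_closed R.m_ac)
  moreover have "group_elt \<gamma> \<otimes>\<^bsub>R\<^esub> \<beta> \<in> trivial_classes G M"
    using \<gamma> \<beta> unfolding trivial_classes_eq[OF M A] by blast
  ultimately show "h = trivial_classes G M #>\<^bsub>bold_H G M\<^esub> \<alpha>"
    using trivial_coset_eq[OF M A _ has_cocycleD(2)[OF \<alpha>]] h by simp
qed

text \<open>The common computation behind the action of \<open>Gal K\<close> on a norm and the
  change of transversal. The form of \<open>c\<close> copies \<open>cores_cochain\<close>, so that
  for a left translate the factor is the corestriction cochain.\<close>

lemma norm_family:
  assumes F: "transversal_family L \<omega> \<rho>" and \<alpha>: "has_cocycle L \<alpha> f"
  defines "c \<equiv> (\<lambda>j. let i = coset_index L \<omega> (\<rho> j); u = inv_into UNIV (\<omega> i) \<circ> \<rho> j in \<omega> i \<circ> f u)"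
  shows "c \<in> {1..extension_degree L} \<rightarrow> \<Gamma>"
    and "finprod R (\<lambda>j. galois_act (\<rho> j) \<alpha>) {1..extension_degree L} =
      group_elt (finprod (points G) c {1..extension_degree L}) \<otimes>\<^bsub>R\<^esub> norm_elt G L \<omega> \<alpha>"
proof -
  interpret F: transversal_family L \<omega> \<rho> by (rule F)
  note D = has_cocycleD[OF \<alpha>]
  let ?I = "{1..extension_degree L}"
  have c: "c j = \<omega> (F.slot j) \<circ> f (F.cofactor j)" for j
    by (simp add: c_def Let_def F.slot_def F.cofactor_def)
  show c_closed: "c \<in> ?I \<rightarrow> \<Gamma>"
    unfolding c using F.transversal_slot_Gal F.cofactor_Gal D(3) by (blast intro: Gal_points_closed)
  have \<omega>\<alpha>: "galois_act (\<omega> i) \<alpha> \<in> carrier R" if "i \<in> ?I" for i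
    using transversal_Gal[OF F.transversal that] D(2) by (rule act_closed)
  \<comment> \<open>The cofactor acts first and contributes its cocycle value, to which the
    transversal element is then applied.\<close>
  have step: "galois_act (\<rho> j) \<alpha> = group_elt (c j) \<otimes>\<^bsub>R\<^esub> galois_act (\<omega> (F.slot j)) \<alpha>" if j: "j \<in> ?I" for j
  proof -
    note s = F.transversal_slot_Gal[OF j] and u = F.cofactor_Gal[OF j]
    have uK: "F.cofactor j \<in> Gal base_field" using u F.Gal_L_subset by blast
    have "galois_act (\<rho> j) \<alpha> = galois_act (\<omega> (F.slot j)) (galois_act (F.cofactor j) \<alpha>)"
      unfolding act_comp[OF s uK] F.family_eq[OF j, symmetric] ..
    also have "\<dots> = group_elt (c j) \<otimes>\<^bsub>R\<^esub> galois_act (\<omega> (F.slot j)) \<alpha>"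
      unfolding D(4)[OF u] c using D(3)[OF u] D(2) by (simp add: act_mult[OF s] act_group_elt[OF s])
    finally show ?thesis .
  qed
  have "finprod R (\<lambda>j. galois_act (\<rho> j) \<alpha>) ?I =
      finprod R (\<lambda>j. group_elt (c j) \<otimes>\<^bsub>R\<^esub> galois_act (\<omega> (F.slot j)) \<alpha>) ?I"
    using c_closed \<omega>\<alpha> F.slot_in by (intro R.finprod_cong' refl step) (auto simp: Pi_iff)
  also have "\<dots> = finprod R (\<lambda>j. group_elt (c j)) ?I \<otimes>\<^bsub>R\<^esub> finprod R (\<lambda>j. galois_act (\<omega> (F.slot j)) \<alpha>) ?I"
    using c_closed \<omega>\<alpha> F.slot_in by (intro R.finprod_multf) (auto simp: Pi_iff)
  \<comment> \<open>After the points are split off, the rest is the norm with its factors permuted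
    by \<open>slot\<close>.\<close>
  also have "finprod R (\<lambda>j. galois_act (\<omega> (F.slot j)) \<alpha>) ?I = finprod R (\<lambda>i. galois_act (\<omega> i) \<alpha>) (F.slot ` ?I)"
    using \<omega>\<alpha> F.slot_bij by (intro R.finprod_reindex[symmetric]) (auto simp: bij_betw_def)
  also have "F.slot ` ?I = ?I" using F.slot_bij by (simp add: bij_betw_def)
  finally show "finprod R (\<lambda>j. galois_act (\<rho> j) \<alpha>) ?I =
      group_elt (finprod (points G) c ?I) \<otimes>\<^bsub>R\<^esub> norm_elt G L \<omega> \<alpha>"
    unfolding group_elt_finprod[OF c_closed] norm_elt_def .
qed

section \<open>The norm attached to one transversal\<close>

context
  fixes L :: "'k alg_closure set" and \<omega> :: "nat \<Rightarrow> 'k alg_closure \<Rightarrow> 'k alg_closure"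
  assumes base: "base_field \<subseteq> L" and trans: "transversal L \<omega>"
begin

lemma norm_closed:
  assumes "a \<in> carrier R"
  shows "norm_elt G L \<omega> a \<in> carrier R"
  unfolding norm_elt_def using assms transversal_Gal[OF trans]
  by (intro R.finprod_closed) (blast intro: act_closed)

lemma norm_mult:
  assumes "a \<in> carrier R" "b \<in> carrier R"
  shows "norm_elt G L \<omega> (a \<otimes>\<^bsub>R\<^esub> b) = norm_elt G L \<omega> a \<otimes>\<^bsub>R\<^esub> norm_elt G L \<omega> b"
proof -
  let ?I = "{1..extension_degree L}"
  have closed: "galois_act (\<omega> i) c \<in> carrier R" if "i \<in> ?I" "c \<in> carrier R" for i c
    using transversal_Gal[OF trans that(1)] that(2) by (rule act_closed)
  have "norm_elt G L \<omega> (a \<otimes>\<^bsub>R\<^esub> b) = finprod R (\<lambda>i. galois_act (\<omega> i) a \<otimes>\<^bsub>R\<^esub> galois_act (\<omega> i) b) ?I"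
    unfolding norm_elt_def using closed assms
    by (intro R.finprod_cong' refl) (auto simp: act_mult[OF transversal_Gal[OF trans]])
  then show ?thesis
    unfolding norm_elt_def using closed assms by (simp add: R.finprod_multf)
qed

lemma norm_group_elt:
  assumes "\<gamma> \<in> \<Gamma>"
  shows "\<exists>\<delta>\<in>\<Gamma>. norm_elt G L \<omega> (group_elt \<gamma>) = group_elt \<delta>"
proof -
  let ?I = "{1..extension_degree L}"
  have closed: "(\<lambda>i. \<omega> i \<circ> \<gamma>) \<in> ?I \<rightarrow> \<Gamma>"
    using transversal_Gal[OF trans] assms by (blast intro: Gal_points_closed)
  have "norm_elt G L \<omega> (group_elt \<gamma>) = finprod R (\<lambda>i. group_elt (\<omega> i \<circ> \<gamma>)) ?I"
    unfolding norm_elt_def using closed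
    by (intro R.finprod_cong' refl) (auto simp: act_group_elt[OF transversal_Gal[OF trans]] Pi_iff)
  then show ?thesis
    using group_elt_finprod[OF closed] P.finprod_closed[OF closed] by metis
qed

lemma norm_Units:
  assumes "a \<in> Units R"
  shows "norm_elt G L \<omega> a \<in> Units R"
proof (rule ga_UnitsI)
  have "norm_elt G L \<omega> \<one>\<^bsub>R\<^esub> = finprod R (\<lambda>i. \<one>\<^bsub>R\<^esub>) {1..extension_degree L}"
    unfolding norm_elt_def by (intro R.finprod_cong' refl) (auto simp: act_one[OF transversal_Gal[OF trans]])
  then show "norm_elt G L \<omega> a \<otimes>\<^bsub>R\<^esub> norm_elt G L \<omega> (inv\<^bsub>R\<^esub> a) = \<one>\<^bsub>R\<^esub>"
    using assms by (simp add: R.Units_closed flip: norm_mult)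
qed (use assms in \<open>auto intro: norm_closed R.Units_closed\<close>)

lemma norm_has_cocycle:
  assumes \<alpha>: "has_cocycle L \<alpha> f"
  shows "has_cocycle base_field (norm_elt G L \<omega> \<alpha>) (cores_cochain G L \<omega> f)"
  unfolding has_cocycle_def
proof (intro conjI ballI)
  note D = has_cocycleD[OF \<alpha>]
  show "norm_elt G L \<omega> \<alpha> \<in> Units R" by (rule norm_Units[OF D(1)])
  fix \<sigma> :: "'k alg_closure \<Rightarrow> 'k alg_closure" assume \<sigma>: "\<sigma> \<in> Gal base_field"
  let ?I = "{1..extension_degree L}"
  note F = transversal_family_left_mult[OF base trans \<sigma>]
  note N = norm_family[OF F \<alpha>]
  \<comment> \<open>The composition is bracketed as in \<open>norm_family\<close>; associativity
    matches it with \<open>cores_cochain\<close>.\<close>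
  let ?c = "\<lambda>j. let i = coset_index L \<omega> (\<sigma> \<circ> \<omega> j); u = inv_into UNIV (\<omega> i) \<circ> (\<sigma> \<circ> \<omega> j) in \<omega> i \<circ> f u"
  have cores: "cores_cochain G L \<omega> f \<sigma> = finprod (points G) ?c ?I"
    using \<sigma> by (simp add: cores_cochain_def comp_assoc)
  show "cores_cochain G L \<omega> f \<sigma> \<in> \<Gamma>"
    unfolding cores by (rule P.finprod_closed[OF N(1)])
  have closed: "(\<lambda>i. galois_act (\<omega> i) \<alpha>) \<in> ?I \<rightarrow> carrier R"
    using transversal_Gal[OF trans] D(2) by (blast intro: act_closed)
  have "galois_act \<sigma> (norm_elt G L \<omega> \<alpha>) = finprod R (\<lambda>i. galois_act \<sigma> (galois_act (\<omega> i) \<alpha>)) ?I"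
    unfolding norm_elt_def by (rule act_finprod[OF \<sigma> closed])
  also have "\<dots> = finprod R (\<lambda>i. galois_act (\<sigma> \<circ> \<omega> i) \<alpha>) ?I"
    using D(2) Gal_comp[OF \<sigma> transversal_Gal[OF trans]]
    by (intro R.finprod_cong' refl) (auto simp: act_comp[OF \<sigma> transversal_Gal[OF trans]] intro: act_closed)
  finally show "galois_act \<sigma> (norm_elt G L \<omega> \<alpha>) =
      group_elt (cores_cochain G L \<omega> f \<sigma>) \<otimes>\<^bsub>R\<^esub> norm_elt G L \<omega> \<alpha>"
    unfolding cores N(2) .
qed

text \<open>An invariant unit has the constant neutral cocycle. Every factor of its corestriction is
  neutral, so \<open>norm_has_cocycle\<close> says that the norm is invariant under
  \<open>Gal K\<close>.\<close>

lemma norm_fixed: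
  assumes "\<beta> \<in> Units R" "\<beta> \<in> fixed_ring L"
  shows "norm_elt G L \<omega> \<beta> \<in> fixed_ring base_field"
proof -
  let ?I = "{1..extension_degree L}"
  have \<beta>: "has_cocycle L \<beta> (\<lambda>_. \<one>\<^bsub>points G\<^esub>)"
    using assms by (auto simp: has_cocycle_def fixed_ring_def simp flip: ga_simps(1))
  have "cores_cochain G L \<omega> (\<lambda>_. \<one>\<^bsub>points G\<^esub>) \<sigma> = \<one>\<^bsub>points G\<^esub>" if \<sigma>: "\<sigma> \<in> Gal base_field" for \<sigma>
  proof -
    have "coset_index L \<omega> (\<sigma> \<circ> \<omega> j) \<in> ?I" if "j \<in> ?I" for j
      using Gal_comp[OF \<sigma> transversal_Gal[OF trans that]] by (rule coset_index(1)[OF trans])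
    then have "\<omega> (coset_index L \<omega> (\<sigma> \<circ> \<omega> j)) \<circ> \<one>\<^bsub>points G\<^esub> = \<one>\<^bsub>points G\<^esub>" if "j \<in> ?I" for j
      using that transversal_Gal[OF trans] by (blast intro: Gal_points_one)
    then show ?thesis
      unfolding cores_cochain_def Let_def restrict_apply'[OF \<sigma>] by (intro P.finprod_one_eqI)
  qed
  then show ?thesis
    using has_cocycleD(2,4)[OF norm_has_cocycle[OF \<beta>]]
    by (simp add: fixed_ring_def flip: ga_simps(1))
qed

lemma norm_transversal_change:
  assumes \<omega>': "transversal L \<omega>'" and \<alpha>: "has_cocycle L \<alpha> f"
  shows "\<exists>\<gamma>\<in>\<Gamma>. norm_elt G L \<omega>' \<alpha> = group_elt \<gamma> \<otimes>\<^bsub>R\<^esub> norm_elt G L \<omega> \<alpha>"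
  using norm_family[OF transversal_family_transversal[OF base trans \<omega>'] \<alpha>] P.finprod_closed
  unfolding norm_elt_def[of G L \<omega>'] by blast

end

text \<open>Independence of the choices is read off in the group algebra: both cochains are cocycles
  of norms, and these norms differ by a point whose coboundary relates the cochains.\<close>

lemma Cores_eq:
  assumes base: "base_field \<subseteq> L" and trans: "transversal L \<omega>"
    and \<alpha>: "has_cocycle L \<alpha> f" and f: "f \<in> extensional (Gal L)"
  shows "Cores G L (B1 G L #>\<^bsub>Z1 G L\<^esub> f) = B1 G base_field #>\<^bsub>Z1 G base_field\<^esub> cores_cochain G L \<omega> f"
  unfolding Cores_def
proof (rule the_equality)
  have "f \<in> B1 G L #>\<^bsub>Z1 G L\<^esub> f"
    using has_cocycleD(3)[OF \<alpha>] f by (intro coboundary_coset_self[OF base]) (simp add: PiE_iff)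
  then show "\<exists>\<omega>' f'. transversal L \<omega>' \<and> f' \<in> B1 G L #>\<^bsub>Z1 G L\<^esub> f \<and>
      B1 G base_field #>\<^bsub>Z1 G base_field\<^esub> cores_cochain G L \<omega> f =
      B1 G base_field #>\<^bsub>Z1 G base_field\<^esub> cores_cochain G L \<omega>' f'"
    using trans by blast
next
  fix y assume "\<exists>\<omega>' f'. transversal L \<omega>' \<and> f' \<in> B1 G L #>\<^bsub>Z1 G L\<^esub> f \<and>
      y = B1 G base_field #>\<^bsub>Z1 G base_field\<^esub> cores_cochain G L \<omega>' f'"
  then obtain \<omega>' f' where trans': "transversal L \<omega>'" and f': "f' \<in> B1 G L #>\<^bsub>Z1 G L\<^esub> f"
    and y: "y = B1 G base_field #>\<^bsub>Z1 G base_field\<^esub> cores_cochain G L \<omega>' f'" by blast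
  obtain \<gamma> where \<gamma>: "\<gamma> \<in> \<Gamma>"
    and f'_eq: "f' = (\<lambda>\<sigma>\<in>Gal L. ((\<sigma> \<circ> \<gamma>) \<otimes>\<^bsub>points G\<^esub> inv\<^bsub>points G\<^esub> \<gamma>) \<otimes>\<^bsub>points G\<^esub> f \<sigma>)"
    using f' unfolding coboundary_coset by blast
  let ?\<alpha>' = "group_elt \<gamma> \<otimes>\<^bsub>R\<^esub> \<alpha>"
  have \<alpha>': "has_cocycle L ?\<alpha>' f'"
    by (rule has_cocycle_shift[OF base \<alpha> \<gamma>]) (simp add: f'_eq)
  let ?N = "norm_elt G L \<omega> \<alpha>" and ?h = "cores_cochain G L \<omega> f" and ?h' = "cores_cochain G L \<omega>' f'"
  note N = has_cocycleD[OF norm_has_cocycle[OF base trans \<alpha>]]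
  note N' = has_cocycleD[OF norm_has_cocycle[OF base trans' \<alpha>']]
  obtain \<gamma>1 where \<gamma>1: "\<gamma>1 \<in> \<Gamma>" "norm_elt G L \<omega>' ?\<alpha>' = group_elt \<gamma>1 \<otimes>\<^bsub>R\<^esub> norm_elt G L \<omega> ?\<alpha>'"
    using norm_transversal_change[OF base trans trans' \<alpha>'] by blast
  obtain \<gamma>2 where \<gamma>2: "\<gamma>2 \<in> \<Gamma>" "norm_elt G L \<omega> (group_elt \<gamma>) = group_elt \<gamma>2"
    using norm_group_elt[OF base trans \<gamma>] by blast
  \<comment> \<open>One factor comes from the change of transversal, the other is the norm of the
    point that relates the two representatives.\<close>
  define \<delta> where "\<delta> = \<gamma>1 \<otimes>\<^bsub>points G\<^esub> \<gamma>2"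
  have \<delta>: "\<delta> \<in> \<Gamma>" using \<gamma>1 \<gamma>2 by (simp add: \<delta>_def)
  have N'_eq: "norm_elt G L \<omega>' ?\<alpha>' = group_elt \<delta> \<otimes>\<^bsub>R\<^esub> ?N"
    using \<gamma>1 \<gamma>2 \<gamma> has_cocycleD(2)[OF \<alpha>] N(2)
    by (simp add: norm_mult[OF base trans] \<delta>_def group_elt_mult R.m_assoc)
  have "?h' = (\<lambda>\<sigma>\<in>Gal base_field. ((\<sigma> \<circ> \<delta>) \<otimes>\<^bsub>points G\<^esub> inv\<^bsub>points G\<^esub> \<delta>) \<otimes>\<^bsub>points G\<^esub> ?h \<sigma>)"
  proof
    fix \<sigma>
    show "?h' \<sigma> = (\<lambda>\<sigma>\<in>Gal base_field. ((\<sigma> \<circ> \<delta>) \<otimes>\<^bsub>points G\<^esub> inv\<^bsub>points G\<^esub> \<delta>) \<otimes>\<^bsub>points G\<^esub> ?h \<sigma>) \<sigma>"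
    proof (cases "\<sigma> \<in> Gal base_field")
      case \<sigma>: True
      have \<sigma>\<delta>: "\<sigma> \<circ> \<delta> \<in> \<Gamma>" by (rule Gal_points_closed[OF \<sigma> \<delta>])
      \<comment> \<open>The action of \<sigma> on the second norm is computed in two ways, through
        its own cocycle and through its expression by the first norm; the unit \<open>?N\<close> is
        then cancelled.\<close>
      have "group_elt (?h' \<sigma> \<otimes>\<^bsub>points G\<^esub> \<delta>) \<otimes>\<^bsub>R\<^esub> ?N = galois_act \<sigma> (group_elt \<delta> \<otimes>\<^bsub>R\<^esub> ?N)"
        using N'(4)[OF \<sigma>] N'(3)[OF \<sigma>] \<delta> N(2) by (simp add: N'_eq group_elt_mult R.m_assoc)
      also have "\<dots> = group_elt ((\<sigma> \<circ> \<delta>) \<otimes>\<^bsub>points G\<^esub> ?h \<sigma>) \<otimes>\<^bsub>R\<^esub> ?N"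
        using \<delta> \<sigma>\<delta> N(2) N(3)[OF \<sigma>]
        by (simp add: act_mult[OF \<sigma>] act_group_elt[OF \<sigma>] N(4)[OF \<sigma>] group_elt_mult R.m_assoc)
      finally have "?N \<otimes>\<^bsub>R\<^esub> group_elt (?h' \<sigma> \<otimes>\<^bsub>points G\<^esub> \<delta>) = ?N \<otimes>\<^bsub>R\<^esub> group_elt ((\<sigma> \<circ> \<delta>) \<otimes>\<^bsub>points G\<^esub> ?h \<sigma>)"
        using N(2) N(3)[OF \<sigma>] N'(3)[OF \<sigma>] \<delta> \<sigma>\<delta> by (simp add: R.m_comm)
      then have eq: "?h' \<sigma> \<otimes>\<^bsub>points G\<^esub> \<delta> = (\<sigma> \<circ> \<delta>) \<otimes>\<^bsub>points G\<^esub> ?h \<sigma>"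
        using N(1) N(3)[OF \<sigma>] N'(3)[OF \<sigma>] \<delta> \<sigma>\<delta> by simp
      have "?h' \<sigma> = (?h' \<sigma> \<otimes>\<^bsub>points G\<^esub> \<delta>) \<otimes>\<^bsub>points G\<^esub> inv\<^bsub>points G\<^esub> \<delta>"
        using N'(3)[OF \<sigma>] \<delta> by (simp add: P.m_assoc)
      also have "\<dots> = ((\<sigma> \<circ> \<delta>) \<otimes>\<^bsub>points G\<^esub> inv\<^bsub>points G\<^esub> \<delta>) \<otimes>\<^bsub>points G\<^esub> ?h \<sigma>"
        unfolding eq using N(3)[OF \<sigma>] \<delta> \<sigma>\<delta> by (simp add: P.m_ac)
      finally show ?thesis using \<sigma> by simp
    qed (simp add: cores_cochain_def)
  qed
  then have "?h' \<in> B1 G base_field #>\<^bsub>Z1 G base_field\<^esub> ?h"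
    unfolding coboundary_coset using \<delta> by blast
  then show "y = B1 G base_field #>\<^bsub>Z1 G base_field\<^esub> ?h"
    unfolding y using N(3) by (intro coboundary_coset_eq) auto
qed

text \<open>The norm takes points to points and invariant units for \<open>L\<close> to invariant
  units for \<open>K\<close>, hence trivial classes to trivial classes.\<close>

lemma norm_on_H_eq:
  assumes L: "finite_galois_extension L" and trans: "transversal L \<omega>" and \<alpha>: "\<alpha> \<in> carrier R"
  shows "norm_on_H G L \<omega> (trivial_classes G L #>\<^bsub>bold_H G L\<^esub> \<alpha>) =
    trivial_classes G base_field #>\<^bsub>bold_H G base_field\<^esub> norm_elt G L \<omega> \<alpha>"
  unfolding norm_on_H_def
proof (rule the_equality)
  have base: "base_field \<subseteq> L" using galois_extension_closed(7)[OF L] .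
  note T = trivial_classes_eq[OF base A_sub_galois_extension[OF L trans]]
  have "\<one>\<^bsub>R\<^esub> \<in> trivial_classes G L"
  proof -
    have "\<one>\<^bsub>R\<^esub> = group_elt \<one>\<^bsub>points G\<^esub> \<otimes>\<^bsub>R\<^esub> \<one>\<^bsub>R\<^esub>" by (simp flip: ga_simps(1))
    moreover have "\<one>\<^bsub>R\<^esub> \<in> fixed_ring L"
      using Gal_anti_mono[OF base] by (auto simp: fixed_ring_def act_one subset_iff)
    ultimately show ?thesis unfolding T by blast
  qed
  moreover have "\<alpha> = \<one>\<^bsub>R\<^esub> \<otimes>\<^bsub>R\<^esub> \<alpha>" using \<alpha> by simp
  ultimately have "\<alpha> \<in> trivial_classes G L #>\<^bsub>bold_H G L\<^esub> \<alpha>"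
    unfolding r_coset_eq_image bold_H_mult by blast
  then show "\<exists>\<alpha>'\<in>trivial_classes G L #>\<^bsub>bold_H G L\<^esub> \<alpha>.
      trivial_classes G base_field #>\<^bsub>bold_H G base_field\<^esub> norm_elt G L \<omega> \<alpha> =
      trivial_classes G base_field #>\<^bsub>bold_H G base_field\<^esub> norm_elt G L \<omega> \<alpha>'"
    by blast
  fix h' assume "\<exists>\<alpha>'\<in>trivial_classes G L #>\<^bsub>bold_H G L\<^esub> \<alpha>.
      h' = trivial_classes G base_field #>\<^bsub>bold_H G base_field\<^esub> norm_elt G L \<omega> \<alpha>'"
  then obtain \<gamma> \<beta> where \<gamma>: "\<gamma> \<in> \<Gamma>" and \<beta>: "\<beta> \<in> Units R" "\<beta> \<in> fixed_ring L"
    and h': "h' = trivial_classes G base_field #>\<^bsub>bold_H G base_field\<^esub>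
      norm_elt G L \<omega> ((group_elt \<gamma> \<otimes>\<^bsub>R\<^esub> \<beta>) \<otimes>\<^bsub>R\<^esub> \<alpha>)"
    unfolding r_coset_eq_image bold_H_mult T by blast
  obtain \<delta> where \<delta>: "\<delta> \<in> \<Gamma>" "norm_elt G L \<omega> (group_elt \<gamma>) = group_elt \<delta>"
    using norm_group_elt[OF base trans \<gamma>] by blast
  let ?t = "group_elt \<delta> \<otimes>\<^bsub>R\<^esub> norm_elt G L \<omega> \<beta>"
  have "?t \<in> trivial_classes G base_field"
    unfolding trivial_classes_eq[OF order_refl A_sub_base_field]
    using \<delta> norm_Units[OF base trans \<beta>(1)] norm_fixed[OF base trans \<beta>] by blast
  moreover have "norm_elt G L \<omega> ((group_elt \<gamma> \<otimes>\<^bsub>R\<^esub> \<beta>) \<otimes>\<^bsub>R\<^esub> \<alpha>) = ?t \<otimes>\<^bsub>R\<^esub> norm_elt G L \<omega> \<alpha>"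
    using \<gamma> \<beta> \<alpha> \<delta> by (simp add: norm_mult[OF base trans] R.Units_closed)
  ultimately show "h' = trivial_classes G base_field #>\<^bsub>bold_H G base_field\<^esub> norm_elt G L \<omega> \<alpha>"
    unfolding h' by (simp add: trivial_coset_eq[OF order_refl A_sub_base_field] norm_closed[OF base trans \<alpha>])
qed

lemma Upsilon_Cores:
  assumes L: "finite_galois_extension L" and trans: "transversal L \<omega>" and x: "x \<in> carrier (H1 G L)"
  shows "Upsilon G base_field (Cores G L x) = norm_on_H G L \<omega> (Upsilon G L x)"
proof -
  have base: "base_field \<subseteq> L" using galois_extension_closed(7)[OF L] .
  obtain f where f: "f \<in> carrier (Z1 G L)" and x_eq: "x = B1 G L #>\<^bsub>Z1 G L\<^esub> f"
    using x by (auto simp: H1_def FactGroup_def RCOSETS_def)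
  have f_ext: "f \<in> extensional (Gal L)" and f_val: "\<And>\<sigma>. \<sigma> \<in> Gal L \<Longrightarrow> f \<sigma> \<in> \<Gamma>"
    and f_cocycle: "\<And>\<sigma> \<tau>. \<sigma> \<in> Gal L \<Longrightarrow> \<tau> \<in> Gal L \<Longrightarrow> f (\<sigma> \<circ> \<tau>) = f \<sigma> \<otimes>\<^bsub>points G\<^esub> (\<sigma> \<circ> f \<tau>)"
    using f unfolding Z1_simps by (auto simp only: PiE_iff)
  obtain E where E: "finite E" "\<And>\<sigma>. \<sigma> \<in> Gal L \<Longrightarrow> \<forall>e\<in>E. \<sigma> e = e \<Longrightarrow> f \<sigma> = \<one>\<^bsub>points G\<^esub>"
    using Z1_finite_support[OF base f] by blast
  \<comment> \<open>One unit for one representative suffices for both sides: \<alpha> evaluates the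
    right side, and its norm evaluates the left.\<close>
  obtain \<alpha> where \<alpha>: "has_cocycle L \<alpha> f"
    using hilbert_90[OF base f_val f_cocycle E] f_val unfolding has_cocycle_def by blast
  have "cores_cochain G L \<omega> f \<in> extensional (Gal base_field)" by (simp add: cores_cochain_def)
  then have "Upsilon G base_field (Cores G L x) =
      trivial_classes G base_field #>\<^bsub>bold_H G base_field\<^esub> norm_elt G L \<omega> \<alpha>"
    unfolding x_eq Cores_eq[OF base trans \<alpha> f_ext]
    by (intro Upsilon_eq A_sub_base_field norm_has_cocycle[OF base trans \<alpha>]) auto
  also have "\<dots> = norm_on_H G L \<omega> (Upsilon G L x)"
    unfolding x_eq Upsilon_eq[OF base A_sub_galois_extension[OF L trans] \<alpha> f_ext]
    by (rule norm_on_H_eq[OF L trans has_cocycleD(2)[OF \<alpha>], symmetric])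
  finally show ?thesis .
qed

end

theorem theorem2p9:
  fixes G :: "('k::field_char_0, 'i::finite) hopf_data"
    and L :: "'k alg_closure set"
    and \<omega> :: "nat \<Rightarrow> 'k alg_closure \<Rightarrow> 'k alg_closure"
    and x :: "(('k alg_closure \<Rightarrow> 'k alg_closure) \<Rightarrow> 'i \<Rightarrow> 'k alg_closure) set"
  assumes "finite_comm_group_scheme G"
    and "finite_galois_extension L"
    and "transversal L \<omega>"
    and "x \<in> carrier (H1 G L)"
  shows "Upsilon G base_field (Cores G L x) = norm_on_H G L \<omega> (Upsilon G L x)"
proof -
  interpret finite_comm_group_scheme_char_0 G
    using assms(1) by (rule finite_comm_group_scheme_char_0.intro)
  show ?thesis using assms(2-) by (rule Upsilon_Cores)
qed

end
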